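(* Let $r\ge k\ge 3$ and $s\ge 1$ be integers, and let $F$ be a graph consisting of $s$ components with chromatic number $r+1$, each with a color-critical edge, and any number of components with chromatic number at most $r$. Then for all sufficiently large $n$, $$\mathrm{ex}_k(n,\text{Berge-}F)=\mathcal{N}\big(K_k,\,K_{s-1}+T(n-s+1,r)\big).$$
   Context: All graphs and hypergraphs are finite and simple; hyperedges of a hypergraph are distinct, and a hypergraph is $k$-uniform if each hyperedge has exactly $k$ vertices. Given a hypergraph $\mathcal{H}$ and a graph $G$ (with the vertices of $G$ being vertices of $\mathcal{H}$), $\mathcal{H}$ is a Berge-$G$ (a Berge copy of $G$) if there is a bijection between the hyperedges of $\mathcal{H}$ and the edges of $G$ such that each hyperedge contains its image. A hypergraph is Berge-$F$-free if no subhypergraph of it is a Berge-$F$. $\mathrm{ex}_k(n,\text{Berge-}F)$ denotes the largest number of hyperedges in an $n$-vertex $k$-uniform Berge-$F$-free hypergraph. For graphs $H,G$, $\mathcal{N}(H,G)$ is the number of (not necessarily induced) copies of $H$ in $G$. $K_k$ is the complete graph on $k$ vertices. A color-critical edge of a graph is an edge whose deletion decreases the chromatic number. $T(m,r)$ is the Turán graph: the complete $r$-partite graph on $m$ vertices with part sizes differing by at most one. $K_i+T(n-i,r)$ is the $n$-vertex graph obtained from $T(n-i,r)$ by adding $i$ new vertices and joining each of them to every other vertex (including the other new vertices). "Sufficiently large $n$" means $n$ larger than a threshold depending only on $F$ and $k$. *)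

theory Defs
  imports Main "HOL-Library.Disjoint_Sets"
begin

(* A hypergraph is a pair of a vertex set and a set of hyperedges; a (simple) graph
   is a 2-uniform hypergraph. *)
type_synonym 'a hypergraph = "'a set \<times> 'a set set"

abbreviation verts :: "'a hypergraph \<Rightarrow> 'a set" where "verts \<equiv> fst"
abbreviation hedges :: "'a hypergraph \<Rightarrow> 'a set set" where "hedges \<equiv> snd"

definition hypergraph :: "'a hypergraph \<Rightarrow> bool" where
  "hypergraph H \<longleftrightarrow> finite (verts H) \<and> hedges H \<subseteq> Pow (verts H)"

definition uniform :: "nat \<Rightarrow> 'a hypergraph \<Rightarrow> bool" where
  "uniform k H \<longleftrightarrow> (\<forall>e\<in>hedges H. card e = k)"

definition graph :: "'a hypergraph \<Rightarrow> bool" where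
  "graph G \<longleftrightarrow> hypergraph G \<and> uniform 2 G"

definition subhypergraph :: "'a hypergraph \<Rightarrow> 'a hypergraph \<Rightarrow> bool" where
  "subhypergraph H' H \<longleftrightarrow> hypergraph H' \<and> verts H' \<subseteq> verts H \<and> hedges H' \<subseteq> hedges H"

definition isomorphic :: "'a hypergraph \<Rightarrow> 'b hypergraph \<Rightarrow> bool" where
  "isomorphic G H \<longleftrightarrow>
     (\<exists>f. bij_betw f (verts G) (verts H) \<and> hedges H = (\<lambda>e. f ` e) ` hedges G)"


definition is_Berge :: "'a hypergraph \<Rightarrow> 'a hypergraph \<Rightarrow> bool" where
  "is_Berge H G \<longleftrightarrow> verts G \<subseteq> verts H \<and>
     (\<exists>\<phi>. bij_betw \<phi> (hedges H) (hedges G) \<and> (\<forall>e\<in>hedges H. \<phi> e \<subseteq> e))"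

(* F is only given up to isomorphism, so every isomorphic copy of F inside the vertex
   set of H has to be considered. *)
definition Berge_free :: "'a hypergraph \<Rightarrow> 'b hypergraph \<Rightarrow> bool" where
  "Berge_free F H \<longleftrightarrow>
     \<not> (\<exists>H' G. subhypergraph H' H \<and> isomorphic F G \<and> is_Berge H' G)"

(* The set is finite (k-subsets of an n-set); it is nonempty, so that Max is meaningful,
   whenever F has an edge. Every n-vertex hypergraph has an isomorphic copy on
   natural numbers. *)
definition ex_Berge :: "nat \<Rightarrow> nat \<Rightarrow> 'a hypergraph \<Rightarrow> nat" where
  "ex_Berge k n F = Max {card (hedges H) | H :: nat hypergraph.
     hypergraph H \<and> card (verts H) = n \<and> uniform k H \<and> Berge_free F H}"

definition num_copies :: "'a hypergraph \<Rightarrow> 'b hypergraph \<Rightarrow> nat" where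
  "num_copies H G = card {S. subhypergraph S G \<and> isomorphic H S}"


definition proper_coloring :: "'a hypergraph \<Rightarrow> nat \<Rightarrow> ('a \<Rightarrow> nat) \<Rightarrow> bool" where
  "proper_coloring G m c \<longleftrightarrow>
     c ` verts G \<subseteq> {..<m} \<and> (\<forall>u v. {u, v} \<in> hedges G \<longrightarrow> c u \<noteq> c v)"

definition chromatic_number :: "'a hypergraph \<Rightarrow> nat" where
  "chromatic_number G = (LEAST m. \<exists>c. proper_coloring G m c)"

definition color_critical_edge :: "'a hypergraph \<Rightarrow> 'a set \<Rightarrow> bool" where
  "color_critical_edge G e \<longleftrightarrow> e \<in> hedges G \<and>
     chromatic_number (verts G, hedges G - {e}) < chromatic_number G"

definition induced_subgraph :: "'a hypergraph \<Rightarrow> 'a set \<Rightarrow> 'a hypergraph" where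
  "induced_subgraph G A = (A, {e \<in> hedges G. e \<subseteq> A})"

definition components :: "'a hypergraph \<Rightarrow> 'a hypergraph set" where
  "components G =
     (\<lambda>v. induced_subgraph G {u \<in> verts G. (v, u) \<in> {(x, y). {x, y} \<in> hedges G}\<^sup>*}) ` verts G"


definition complete_graph :: "nat \<Rightarrow> nat hypergraph" where
  "complete_graph k = ({..<k}, {e. e \<subseteq> {..<k} \<and> card e = 2})"

definition complete_balanced_multipartite :: "nat \<Rightarrow> 'a hypergraph \<Rightarrow> bool" where
  "complete_balanced_multipartite r G \<longleftrightarrow> (\<exists>P :: nat \<Rightarrow> 'a set.
     disjoint_family_on P {..<r} \<and> verts G = (\<Union>i<r. P i) \<and>
     hedges G = {{u, v} | u v. \<exists>i<r. \<exists>j<r. i \<noteq> j \<and> u \<in> P i \<and> v \<in> P j} \<and>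
     (\<forall>i<r. \<forall>j<r. card (P i) \<le> card (P j) + 1))"

(* The parts are the residue classes modulo r. *)
definition turan_graph :: "nat \<Rightarrow> nat \<Rightarrow> nat hypergraph" where
  "turan_graph m r = ({..<m}, {{u, v} | u v. u < m \<and> v < m \<and> u mod r \<noteq> v mod r})"

lemma turan_graph_complete_balanced_multipartite:
  assumes "r > 0"
  shows "complete_balanced_multipartite r (turan_graph m r)"
proof -
  define P where "P = (\<lambda>i. {v. v < m \<and> v mod r = i})"
  have fin: "finite (P i)" for i
    by (simp add: P_def)
  have disj: "disjoint_family_on P {..<r}"
    by (auto simp: disjoint_family_on_def P_def)
  have V: "{..<m} = (\<Union>i<r. P i)"
    using assms by (auto simp: P_def)
  have E: "{{u, v} | u v. u < m \<and> v < m \<and> u mod r \<noteq> v mod r} =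
      {{u, v} | u v. \<exists>i<r. \<exists>j<r. i \<noteq> j \<and> u \<in> P i \<and> v \<in> P j}"
    using assms by (auto simp: P_def; metis mod_less_divisor)
  have "card (P i) \<le> card (P j) + 1" if ij: "i < r" "j < r" for i j
  proof -
    let ?g = "\<lambda>v. v - i - r + j"
    have ge: "i + r \<le> v" if "v \<in> P i - {i}" for v
    proof -
      have v: "v mod r = i" "v \<noteq> i"
        using that by (auto simp: P_def)
      have "v div r \<noteq> 0"
        using v ij by (metis div_mult_mod_eq mult_0 add_0)
      then have "r * 1 \<le> r * (v div r)"
        by (intro mult_le_mono2) simp
      then show ?thesis
        using v(1) mult_div_mod_eq[of r v] by linarith
    qed
    have inj: "inj_on ?g (P i - {i})"
    proof (rule inj_onI)
      fix x y assume xy: "x \<in> P i - {i}" "y \<in> P i - {i}" "?g x = ?g y"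
      show "x = y"
        using ge[OF xy(1)] ge[OF xy(2)] xy(3) by linarith
    qed
    have img: "?g ` (P i - {i}) \<subseteq> P j"
    proof
      fix w assume "w \<in> ?g ` (P i - {i})"
      then obtain v where v: "v \<in> P i - {i}" "w = ?g v"
        by blast
      have m: "v < m" "v mod r = i"
        using v by (auto simp: P_def)
      have "r dvd v - i"
        using m(2) by (metis minus_mod_eq_mult_div dvd_triv_left)
      then have "r dvd v - i - r"
        by (meson dvd_diff_nat dvd_refl)
      then obtain q where "v - i - r = r * q"
        by blast
      then have "w mod r = j"
        using v(2) ij by simp
      then show "w \<in> P j"
        using ge[OF v(1)] v(2) m(1) ij by (simp add: P_def)
    qed
    have "card (P i) \<le> card (P i - {i}) + 1"
      by (simp add: card_Diff_singleton_if, linarith?)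
    also have "card (P i - {i}) \<le> card (P j)"
      by (rule card_inj_on_le[OF inj img fin])
    finally show ?thesis
      by simp
  qed
  then show ?thesis
    unfolding complete_balanced_multipartite_def turan_graph_def fst_conv snd_conv
    using disj V E by blast
qed

(* The join G + H: the disjoint union of G and H with all edges between the two added. *)
definition graph_join :: "'a hypergraph \<Rightarrow> 'b hypergraph \<Rightarrow> ('a + 'b) hypergraph" where
  "graph_join G H = (verts G <+> verts H,
     (\<lambda>e. Inl ` e) ` hedges G \<union> (\<lambda>e. Inr ` e) ` hedges H \<union>
     {{Inl u, Inr v} | u v. u \<in> verts G \<and> v \<in> verts H})"

end

theory Submission
  imports Complex_Main "HOL-Combinatorics.Transposition" "HOL-Library.FuncSet" Defs
begin

text \<open>Lower bound: in the hypergraph of the \<open>k\<close>-cliques of the extremal graph, the core of a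
  Berge copy of \<open>F\<close> is a subgraph of that graph, so each of the \<open>s\<close> components of chromatic number
  \<open>r + 1\<close> needs one of the \<open>s - 1\<close> universal vertices.

  Upper bound: removing vertices of small degree reduces the problem to hypergraphs in which every
  degree is asymptotically that of the extremal example. Call a pair of vertices heavy if it lies in
  many hyperedges; a copy of \<open>F\<close> all of whose edges but a bounded number of prescribed ones are heavy
  extends greedily to a Berge copy. By the Moon-Moser inequality the heavy graph has almost
  everywhere degree at least \<open>(1 - 1 / r - \<epsilon>) n\<close>, hence contains a large complete \<open>r\<close>-partite
  graph, and the traces of the vertices on it yield an almost complete \<open>r\<close>-partition of almost all
  vertices. A vertex with many heavy neighbours in every class (an apex), or a hyperedge with two
  vertices in one class, can play the role of a color-critical edge, so there are fewer than
  \<open>s\<close> disjoint ones. With \<open>s - 1\<close> apexes every hyperedge is a clique of the join of a complete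
  and a complete \<open>r\<close>-partite graph; with fewer apexes the number of such cliques drops by order
  \<open>n ^ (k - 1)\<close>, which outweighs the few other hyperedges.\<close>

section \<open>Components and colorings\<close>

text \<open>The degree condition only speaks of \<open>(k - 1)\<close>-cliques in heavy
  neighbourhoods, and \<open>k\<close> may be much smaller than \<open>r\<close>; the obstacle is a
  small neighbourhood that is rich in cliques. If it contains a positive density of
  \<open>r\<close>-cliques, its vertex is attached to large complete \<open>r\<close>-partite heavy
  graphs. Boundedly many vertices can be of this kind, since \<open>s\<close> of them sharing such a
  graph are \<open>s\<close> apexes. At all other vertices \<open>r\<close>-cliques are sparse while
  \<open>(k - 1)\<close>-cliques are almost as many as in the Turan graph, which forces Turan size.
  Restricting attention to heavy pairs is harmless because light pairs lie in
  \<open>O(n ^ 2)\<close> hyperedges altogether. As \<open>k \<ge> 3\<close>, these can dominate the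
  degree of only boundedly many vertices. A color-critical edge can be made the only monochromatic
  edge of its component, in any prescribed color. Hence a hyperedge with two vertices in an
  arbitrary class can represent it, and different components can use different classes. The vertex
  deletion is calibrated so that its degree threshold is the growth of the extremal number itself,
  which is asymptotically at least \<open>c0 * n ^ (k - 1)\<close>.\<close>

lemma graph_edgeE:
  assumes "graph G" "e \<in> hedges G"
  obtains u v where "e = {u, v}" "u \<noteq> v" "u \<in> verts G" "v \<in> verts G"
proof -
  have "card e = 2" "e \<subseteq> verts G"
    using assms by (auto simp: graph_def uniform_def hypergraph_def)
  then show ?thesis
    using that by (auto simp: card_2_iff)
qed

lemma graph_edge:
  assumes "graph G" "{u, v} \<in> hedges G"
  shows "u \<noteq> v" "u \<in> verts G" "v \<in> verts G"
  using graph_edgeE[OF assms] by (auto simp: doubleton_eq_iff)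

lemma graph_finite: "graph G \<Longrightarrow> finite (verts G)" "graph G \<Longrightarrow> finite (hedges G)"
  by (auto simp: graph_def hypergraph_def intro: finite_subset)

lemma chromatic_number_le: "proper_coloring G m c \<Longrightarrow> chromatic_number G \<le> m"
  unfolding chromatic_number_def by (rule Least_le) blast

lemma proper_coloringD:
  assumes "proper_coloring G m c"
  shows "u \<in> verts G \<Longrightarrow> c u < m" "{u, v} \<in> hedges G \<Longrightarrow> c u \<noteq> c v"
  using assms by (auto simp: proper_coloring_def)

text \<open>An injective coloring shows that the \<open>LEAST\<close> in
  \<open>chromatic_number\<close> is attained; a larger palette is then harmless.\<close>

lemma proper_coloring_exists:
  assumes "graph G" "chromatic_number G \<le> m"
  obtains c where "proper_coloring G m c"
proof -
  obtain h :: "'a \<Rightarrow> nat" where h: "bij_betw h (verts G) {..<card (verts G)}"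
    using ex_bij_betw_finite_nat[OF graph_finite(1)[OF assms(1)]] by (auto simp: atLeast0LessThan)
  have "proper_coloring G (card (verts G)) h"
    unfolding proper_coloring_def
  proof (intro conjI allI impI)
    fix u v assume "{u, v} \<in> hedges G"
    from graph_edge[OF assms(1) this] show "h u \<noteq> h v"
      using h by (auto simp: bij_betw_def dest: inj_onD)
  qed (use h in \<open>auto simp: bij_betw_def\<close>)
  then have "\<exists>c. proper_coloring G (chromatic_number G) c"
    unfolding chromatic_number_def
    using LeastI[of "\<lambda>m. \<exists>c. proper_coloring G m c" "card (verts G)"] by blast
  then obtain c where "proper_coloring G (chromatic_number G) c" ..
  then have "proper_coloring G m c"
    using assms(2) unfolding proper_coloring_def by (meson lessThan_subset_iff order_trans)
  then show ?thesis by (rule that)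
qed

definition reach :: "'a hypergraph \<Rightarrow> 'a \<Rightarrow> 'a set" where
  "reach G v = {u \<in> verts G. (v, u) \<in> {(x, y). {x, y} \<in> hedges G}\<^sup>*}"

lemma components_reach: "components G = (\<lambda>v. induced_subgraph G (reach G v)) ` verts G"
  by (simp add: components_def reach_def)

lemma reach_self: "v \<in> verts G \<Longrightarrow> v \<in> reach G v"
  by (simp add: reach_def)

lemma reach_sub: "reach G v \<subseteq> verts G"
  by (auto simp: reach_def)

lemma reach_eq:
  assumes "u \<in> reach G v" shows "reach G u = reach G v"
proof -
  let ?R = "{(x, y). {x, y} \<in> hedges G}"
  have "sym ?R" by (auto simp: sym_def insert_commute)
  then have "sym (?R\<^sup>*)" by (rule sym_rtrancl)
  then have "(u, v) \<in> ?R\<^sup>*" "(v, u) \<in> ?R\<^sup>*"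
    using assms by (auto simp: reach_def dest: symD)
  then show ?thesis
    by (auto simp: reach_def intro: rtrancl_trans)
qed

lemma reach_edge:
  assumes "graph G" "{u, v} \<in> hedges G" shows "reach G u = reach G v"
proof -
  have "v \<in> reach G u"
    using assms graph_edge[OF assms] by (auto simp: reach_def)
  then show ?thesis using reach_eq by metis
qed

lemma graph_induced:
  assumes "graph G" "A \<subseteq> verts G" shows "graph (induced_subgraph G A)"
  using assms finite_subset
  by (auto simp: graph_def hypergraph_def uniform_def induced_subgraph_def)

lemma component_edge:
  assumes "graph G" "{u, v} \<in> hedges G"
  shows "{u, v} \<in> hedges (induced_subgraph G (reach G u))"
  using assms reach_edge[OF assms] graph_edge[OF assms] reach_self[of u G] reach_self[of v G]
  by (auto simp: induced_subgraph_def)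

text \<open>The vertex groups \<open>gr\<close> are unions of components: group \<open>i\<close> contains the
  \<open>i\<close>-th component of chromatic number \<open>r + 1\<close>, with critical edge \<open>{a i, b i}\<close>, and
  the remaining components are put into group \<open>0\<close>.\<close>
locale critical_graph =
  fixes F :: "'a hypergraph" and r s :: nat and a b :: "nat \<Rightarrow> 'a" and gr :: "'a \<Rightarrow> nat"
  assumes graphF: "graph F"
    and crit_edge: "i < s \<Longrightarrow> {a i, b i} \<in> hedges F"
    and gr_a: "i < s \<Longrightarrow> gr (a i) = i"
    and gr_b: "i < s \<Longrightarrow> gr (b i) = i"
    and gr_less: "u \<in> verts F \<Longrightarrow> gr u < s"
    and gr_edge: "{u, v} \<in> hedges F \<Longrightarrow> gr u = gr v"
    and coloring: "(\<And>i. i < s \<Longrightarrow> \<kappa> i < r) \<Longrightarrow>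
      \<exists>c. (\<forall>u\<in>verts F. c u < r) \<and> (\<forall>i<s. c (a i) = \<kappa> i \<and> c (b i) = \<kappa> i) \<and>
        (\<forall>u v. {u, v} \<in> hedges F \<longrightarrow> (\<forall>i<s. {u, v} \<noteq> {a i, b i}) \<longrightarrow> c u \<noteq> c v)"

text \<open>If the endpoints of \<open>e\<close> had different colors, the coloring of
  \<open>C\<close> without \<open>e\<close> would color \<open>C\<close> itself with
  \<open>r\<close> colors. This forced coincidence lets both endpoints be placed in one class later
  on.\<close>

lemma critical_edge_coloring:
  assumes "graph C" "color_critical_edge C e" "chromatic_number C = r + 1"
  obtains x y c where "e = {x, y}" "e \<in> hedges C" "proper_coloring (verts C, hedges C - {e}) r c" "c x = c y"
proof -
  have e: "e \<in> hedges C" and less: "chromatic_number (verts C, hedges C - {e}) \<le> r"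
    using assms by (auto simp: color_critical_edge_def)
  have "graph (verts C, hedges C - {e})"
    using assms(1) by (auto simp: graph_def hypergraph_def uniform_def)
  from proper_coloring_exists[OF this less] obtain c where
    c: "proper_coloring (verts C, hedges C - {e}) r c" .
  obtain x y where xy: "e = {x, y}"
    using graph_edgeE[OF assms(1) e] by metis
  have "c x = c y"
  proof (rule ccontr)
    assume "c x \<noteq> c y"
    then have "proper_coloring C r c"
      using c xy by (auto simp: proper_coloring_def doubleton_eq_iff) metis+
    then show False using chromatic_number_le assms(3) by fastforce
  qed
  then show ?thesis using that xy e c by blast
qed

text \<open>On each critical component a transposition of colors exchanges the common color of the
  critical endpoints for the prescribed \<open>\<kappa> i\<close>. Components share no edges, so all
  prescriptions are met at once.\<close>

lemma critical_graph_exists: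
  fixes F :: "'a hypergraph"
  assumes F: "graph F" and s1: "s \<ge> 1"
    and card: "card {C \<in> components F. chromatic_number C = r + 1} = s"
    and crit: "\<And>C. C \<in> components F \<Longrightarrow> chromatic_number C = r + 1 \<Longrightarrow> \<exists>e. color_critical_edge C e"
    and rest: "\<And>C. C \<in> components F \<Longrightarrow> chromatic_number C \<noteq> r + 1 \<Longrightarrow> chromatic_number C \<le> r"
  obtains a b gr where "critical_graph F r s a b gr"
proof -
  let ?T = "{C \<in> components F. chromatic_number C = r + 1}"
  let ?comp = "\<lambda>u. induced_subgraph F (reach F u)"
  have "finite ?T" by (simp add: components_reach graph_finite(1)[OF F])
  then obtain h where h: "bij_betw h ?T {..<s}"
    using ex_bij_betw_finite_nat[of ?T] card by (auto simp: atLeast0LessThan)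
  define D where "D = inv_into ?T h"
  have D: "D i \<in> ?T" "h (D i) = i" if "i < s" for i
    using that bij_betw_inv_into_right[OF h, of i] bij_betw_apply[OF bij_betw_inv_into[OF h], of i]
    by (auto simp: D_def)
  have gr_comp: "graph C" if "C \<in> components F" for C
    using that graph_induced[OF F] reach_sub[of F] by (auto simp: components_reach)
  have "\<exists>x y c. {x, y} \<in> hedges (D i) \<and>
      proper_coloring (verts (D i), hedges (D i) - {{x, y}}) r c \<and> c x = c y" if i: "i < s" for i
  proof -
    obtain e where "color_critical_edge (D i) e" using crit D[OF i] by blast
    then show ?thesis
      using critical_edge_coloring[of "D i" e r] D[OF i] gr_comp by simp metis
  qed
  then obtain a b col where ab: "\<And>i. i < s \<Longrightarrow> {a i, b i} \<in> hedges (D i)"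
    and col: "\<And>i. i < s \<Longrightarrow> proper_coloring (verts (D i), hedges (D i) - {{a i, b i}}) r (col i)"
    and colab: "\<And>i. i < s \<Longrightarrow> col i (a i) = col i (b i)"
    by metis
  have col': "proper_coloring C r (SOME c. proper_coloring C r c)" if "C \<in> components F" "C \<notin> ?T" for C
  proof -
    have "chromatic_number C \<noteq> r + 1" using that by simp
    from proper_coloring_exists[OF gr_comp[OF that(1)] rest[OF that(1) this]]
    obtain c where "proper_coloring C r c" .
    then show ?thesis by (rule someI[of "proper_coloring C r"])
  qed
  \<comment> \<open>The default \<open>0\<close> is a legal group because
    \<open>s \<ge> 1\<close>.\<close>
  define gr where "gr = (\<lambda>u. if ?comp u \<in> ?T then h (?comp u) else 0)"
  have vD: "?comp u = D i" if iu: "i < s" "u \<in> verts (D i)" for u i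
  proof -
    obtain v where v: "D i = ?comp v" using D(1)[OF iu(1)] by (auto simp: components_reach)
    then have "u \<in> reach F v" using iu by (auto simp: induced_subgraph_def)
    then show ?thesis using v reach_eq by metis
  qed
  have abv: "a i \<in> verts (D i)" "b i \<in> verts (D i)" if "i < s" for i
    using graph_edge[OF gr_comp ab[OF that]] D[OF that] by auto
  have grD: "gr u = i" if "i < s" "u \<in> verts (D i)" for u i
    using vD[OF that] D[OF that(1)] by (simp add: gr_def)
  have Dh: "h C < s" "D (h C) = C" if "C \<in> ?T" for C
    using bij_betw_apply[OF h that] bij_betw_inv_into_left[OF h that] by (simp_all add: D_def)
  have "critical_graph F r s a b gr"
  proof
    show "graph F" by fact
  next
    fix i assume i: "i < s"
    show "{a i, b i} \<in> hedges F"
      using ab[OF i] D(1)[OF i] by (auto simp: components_reach induced_subgraph_def)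
    show "gr (a i) = i" "gr (b i) = i" using abv[OF i] grD[OF i] by auto
  next
    fix u show "gr u < s" using Dh s1 by (auto simp: gr_def)
  next
    fix u v assume "{u, v} \<in> hedges F"
    then have "?comp u = ?comp v" using reach_edge[OF F] by metis
    then show "gr u = gr v" by (simp add: gr_def)
  next
    fix \<kappa> :: "nat \<Rightarrow> nat" assume \<kappa>: "\<And>i. i < s \<Longrightarrow> \<kappa> i < r"
    define c where "c = (\<lambda>u. if ?comp u \<in> ?T then transpose (col (gr u) (a (gr u))) (\<kappa> (gr u)) (col (gr u) u)
        else (SOME c. proper_coloring (?comp u) r c) u)"
    have cD: "c u = transpose (col i (a i)) (\<kappa> i) (col i u)" if "i < s" "u \<in> verts (D i)" for u i
      using vD[OF that] grD[OF that] D(1)[OF that(1)] by (simp add: c_def)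
    have ltr: "col i u < r" if "i < s" "u \<in> verts (D i)" for i u
      using col[OF that(1)] that(2) by (auto simp: proper_coloring_def)
    have uin: "u \<in> verts (?comp u)" "?comp u \<in> components F" if "u \<in> verts F" for u
      using that reach_self[OF that] by (auto simp: induced_subgraph_def components_reach)
    have 1: "c u < r" if u: "u \<in> verts F" for u
    proof (cases "?comp u \<in> ?T")
      case True
      then have i: "h (?comp u) < s" "u \<in> verts (D (h (?comp u)))"
        using Dh uin[OF u] by auto
      show ?thesis
        using cD[OF i] ltr[OF i] ltr[OF i(1) abv(1)[OF i(1)]] \<kappa>[OF i(1)] by (auto simp: transpose_def)
    next
      case False
      then show ?thesis using proper_coloringD(1)[OF col'[OF uin(2)[OF u] False] uin(1)[OF u]]
        by (simp only: c_def False if_False)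
    qed
    have 2: "c (a i) = \<kappa> i" "c (b i) = \<kappa> i" if "i < s" for i
      using cD[OF that] abv[OF that] colab[OF that] by (auto simp: transpose_def)
    have 3: "c u \<noteq> c v" if e: "{u, v} \<in> hedges F" and ne: "\<forall>i<s. {u, v} \<noteq> {a i, b i}" for u v
    proof -
      have eq: "?comp u = ?comp v" using reach_edge[OF F e] by simp
      have e': "{u, v} \<in> hedges (?comp u)" by (rule component_edge[OF F e])
      have uv: "u \<in> verts F" "v \<in> verts F" using graph_edge[OF F e] by auto
      show ?thesis
      proof (cases "?comp u \<in> ?T")
        case True
        then have i: "h (?comp u) < s" "u \<in> verts (D (h (?comp u)))" "v \<in> verts (D (h (?comp u)))"
          using Dh uin[OF uv(1)] uin[OF uv(2)] eq by auto
        have "{u, v} \<in> hedges (D (h (?comp u))) - {{a (h (?comp u)), b (h (?comp u))}}"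
          using Dh(2)[OF True] e' ne i(1) by auto
        then have "col (h (?comp u)) u \<noteq> col (h (?comp u)) v"
          using col[OF i(1)] by (auto simp: proper_coloring_def)
        then show ?thesis
          unfolding cD[OF i(1,2)] cD[OF i(1,3)] by (metis transpose_involutory)
      next
        case False
        have "(SOME c. proper_coloring (?comp u) r c) u \<noteq> (SOME c. proper_coloring (?comp u) r c) v"
          by (rule proper_coloringD(2)[OF col'[OF uin(2)[OF uv(1)] False] e'])
        then show ?thesis by (simp only: c_def False eq[symmetric] if_False not_False_eq_True)
      qed
    qed
    show "\<exists>c. (\<forall>u\<in>verts F. c u < r) \<and> (\<forall>i<s. c (a i) = \<kappa> i \<and> c (b i) = \<kappa> i) \<and>
        (\<forall>u v. {u, v} \<in> hedges F \<longrightarrow> (\<forall>i<s. {u, v} \<noteq> {a i, b i}) \<longrightarrow> c u \<noteq> c v)"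
      using 1 2 3 by blast
  qed
  then show ?thesis by (rule that)
qed

section \<open>Embedding Berge copies\<close>

text \<open>Each \<open>\<Phi> x\<close> has at least as many elements as \<open>X\<close> and the
  forbidden set \<open>B\<close> together, so a greedy choice never gets stuck.\<close>

lemma distinct_representatives:
  assumes "finite X" "finite B" "\<And>x. x \<in> X \<Longrightarrow> finite (\<Phi> x)"
    "\<And>x. x \<in> X \<Longrightarrow> card X + card B \<le> card (\<Phi> x)"
  shows "\<exists>g. inj_on g X \<and> (\<forall>x\<in>X. g x \<in> \<Phi> x - B)"
  using assms
proof (induction X rule: finite_induct)
  case empty then show ?case by simp
next
  case (insert x X)
  have "\<exists>g. inj_on g X \<and> (\<forall>x\<in>X. g x \<in> \<Phi> x - B)"
    using insert.prems insert.hyps by (intro insert.IH) fastforce+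
  then obtain g where g: "inj_on g X" "\<And>x. x \<in> X \<Longrightarrow> g x \<in> \<Phi> x - B" by blast
  have "card (g ` X \<union> B) \<le> card X + card B"
    using card_Un_le[of "g ` X" B] card_image_le[OF insert.hyps(1), of g] by linarith
  also have "\<dots> < card (\<Phi> x)"
    using insert.prems(3)[of x] insert.hyps by simp
  finally have "\<not> \<Phi> x \<subseteq> g ` X \<union> B"
    using card_mono[of "g ` X \<union> B" "\<Phi> x"] insert.hyps insert.prems by (meson finite_UnI finite_imageI leD)
  then obtain y where y: "y \<in> \<Phi> x" "y \<notin> g ` X" "y \<notin> B" by blast
  have "inj_on (g(x := y)) (insert x X)"
    using g(1) y insert.hyps by (auto simp: inj_on_def)
  moreover have "\<forall>z\<in>insert x X. (g(x := y)) z \<in> \<Phi> z - B"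
    using g(2) y by auto
  ultimately show ?case by blast
qed

text \<open>The vertices of \<open>S\<close> are placed one by one. An image already placed excludes
  itself and at most \<open>D\<close> non-neighbours in the class of the next vertex, and
  \<open>B\<close> is reserved; the lower bound on \<open>Z w\<close> leaves room for this. No edge
  relation on \<open>S\<close> is involved: all pairs of different colors become adjacent, which
  serves every graph properly colored by \<open>c\<close>.\<close>

lemma greedy_embedding:
  fixes c :: "'a \<Rightarrow> nat"
  assumes "finite S" "finite B" "\<And>w. w \<in> S \<Longrightarrow> c w < r"
    and fin: "\<And>w. w \<in> S \<Longrightarrow> finite (Z w) \<and> Z w \<subseteq> P (c w)"
    and finP: "\<And>i. i < r \<Longrightarrow> finite (P i)"
    and D: "\<And>i j u. i < r \<Longrightarrow> j < r \<Longrightarrow> i \<noteq> j \<Longrightarrow> u \<in> P i \<Longrightarrow> card {w \<in> P j. \<not> adj u w} \<le> D"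
    and big: "\<And>w. w \<in> S \<Longrightarrow> card B + card S * (D + 1) \<le> card (Z w)"
    and sym: "\<And>u v. adj u v \<Longrightarrow> adj v u"
  shows "\<exists>g. inj_on g S \<and> (\<forall>w\<in>S. g w \<in> Z w - B) \<and> (\<forall>v\<in>S. \<forall>w\<in>S. c v \<noteq> c w \<longrightarrow> adj (g v) (g w))"
  using assms(1,3) fin big
proof (induction S rule: finite_induct)
  case empty then show ?case by simp
next
  case (insert x S)
  have "\<exists>g. inj_on g S \<and> (\<forall>w\<in>S. g w \<in> Z w - B) \<and> (\<forall>v\<in>S. \<forall>w\<in>S. c v \<noteq> c w \<longrightarrow> adj (g v) (g w))"
    using insert.prems insert.hyps by (intro insert.IH) fastforce+
  then obtain g where g: "inj_on g S" "\<And>w. w \<in> S \<Longrightarrow> g w \<in> Z w - B"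
    "\<And>v w. v \<in> S \<Longrightarrow> w \<in> S \<Longrightarrow> c v \<noteq> c w \<Longrightarrow> adj (g v) (g w)" by blast
  define bad where "bad = (\<lambda>w. if c w = c x then {} else {p \<in> P (c x). \<not> adj (g w) p})"
  define X where "X = g ` S \<union> B \<union> (\<Union>w\<in>S. bad w)"
  have gP: "g w \<in> P (c w)" if "w \<in> S" for w
    using g(2)[OF that] insert.prems(2)[of w] that by auto
  have cx: "c x < r" using insert.prems by simp
  have "card (bad w) \<le> D" if "w \<in> S" for w
    using D[OF _ cx _ gP[OF that]] insert.prems(1)[of w] that by (auto simp: bad_def)
  then have "card (\<Union>w\<in>S. bad w) \<le> card S * D"
    using card_UN_le[OF insert.hyps(1), of bad] sum_bounded_above[of S "\<lambda>w. card (bad w)" D]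
    unfolding of_nat_id by (meson order_trans)
  moreover have "card X \<le> card (g ` S) + card B + card (\<Union>w\<in>S. bad w)"
    using card_Un_le[of "g ` S \<union> B" "\<Union>w\<in>S. bad w"] card_Un_le[of "g ` S" B] unfolding X_def by linarith
  moreover have "card (g ` S) \<le> card S" by (rule card_image_le[OF insert.hyps(1)])
  moreover have "card B + Suc (card S) * (D + 1) \<le> card (Z x)"
    using insert.prems(3)[of x] insert.hyps by simp
  ultimately have "card X < card (Z x)" by (simp add: algebra_simps)
  moreover have "finite X" using insert.hyps assms(2) finP[OF cx] by (auto simp: X_def bad_def)
  ultimately have "\<not> Z x \<subseteq> X" using card_mono leD by blast
  then obtain y where yX: "y \<in> Z x" "y \<notin> X" by blast
  then have y: "y \<in> Z x" "y \<notin> g ` S" "y \<notin> B" "\<And>w. w \<in> S \<Longrightarrow> y \<notin> bad w" by (auto simp: X_def)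
  have yP: "y \<in> P (c x)" using y insert.prems(2)[of x] by auto
  let ?g = "g(x := y)"
  have adjy: "adj (g w) y" if "w \<in> S" "c w \<noteq> c x" for w
    using y(4)[OF that(1)] that yP by (simp add: bad_def)
  have "inj_on ?g (insert x S)"
    using g(1) y insert.hyps by (auto simp: inj_on_def)
  moreover have "\<forall>z\<in>insert x S. ?g z \<in> Z z - B"
    using g(2) y by auto
  moreover have "\<forall>v\<in>insert x S. \<forall>w\<in>insert x S. c v \<noteq> c w \<longrightarrow> adj (?g v) (?g w)"
  proof (intro ballI impI)
    fix v w assume vw: "v \<in> insert x S" "w \<in> insert x S" "c v \<noteq> c w"
    then consider "v = x" "w \<in> S" | "w = x" "v \<in> S" | "v \<in> S" "w \<in> S" by auto
    then show "adj (?g v) (?g w)"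
    proof cases
      case 1
      then have "w \<noteq> x" using insert.hyps by blast
      then show ?thesis using 1 vw adjy[of w] sym by simp
    next
      case 2
      then have "v \<noteq> x" using insert.hyps by blast
      then show ?thesis using 2 vw adjy[of v] by simp
    next
      case 3
      then have "v \<noteq> x" "w \<noteq> x" using insert.hyps by auto
      then show ?thesis using 3 vw g(3) by simp
    qed
  qed
  ultimately show ?case by blast
qed

section \<open>Heavy pairs and their extension to Berge copies\<close>

definition heavy :: "nat \<Rightarrow> 'b set set \<Rightarrow> 'b \<Rightarrow> 'b \<Rightarrow> bool" where
  "heavy L E u v \<longleftrightarrow> u \<noteq> v \<and> L \<le> card {e \<in> E. u \<in> e \<and> v \<in> e}"

lemma heavy_sym: "heavy L E u v \<Longrightarrow> heavy L E v u"
  by (auto simp: heavy_def conj_commute)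

lemma heavy_irrefl: "\<not> heavy L E u u"
  by (simp add: heavy_def)

text \<open>A Berge copy is easier to give from the side of \<open>F\<close>: an injective choice
  \<open>g\<close> of a hyperedge over each edge is inverted to obtain the required bijection. The
  subhypergraph keeps all of \<open>V\<close> and only loses hyperedges.\<close>

lemma not_Berge_freeI:
  assumes "graph F" "hypergraph (V, E)" "inj_on f (verts F)" "f ` verts F \<subseteq> V"
    and g: "inj_on g (hedges F)" "g ` hedges F \<subseteq> E" "\<And>e. e \<in> hedges F \<Longrightarrow> f ` e \<subseteq> g e"
  shows "\<not> Berge_free F (V, E)"
proof -
  let ?G = "(f ` verts F, (\<lambda>e. f ` e) ` hedges F)"
  let ?H = "(V, g ` hedges F)"
  let ?\<phi> = "\<lambda>h. f ` inv_into (hedges F) g h"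
  have sub: "hedges F \<subseteq> Pow (verts F)" using assms(1) by (auto simp: graph_def hypergraph_def)
  have "subhypergraph ?H (V, E)"
    using assms(2) g(2) unfolding subhypergraph_def hypergraph_def fst_conv snd_conv by blast
  moreover have "isomorphic F ?G"
    using assms(3) by (auto simp: isomorphic_def bij_betw_def)
  moreover have "is_Berge ?H ?G"
  proof -
    have "inj_on (\<lambda>e. f ` e) (hedges F)"
      using inj_on_image_Pow[OF assms(3)] sub inj_on_subset by blast
    then have "bij_betw (\<lambda>e. f ` e) (hedges F) (hedges ?G)" by (simp add: bij_betw_def)
    moreover have "bij_betw (inv_into (hedges F) g) (g ` hedges F) (hedges F)"
      using g(1) by (simp add: bij_betw_inv_into inj_on_imp_bij_betw)
    ultimately have "bij_betw ?\<phi> (hedges ?H) (hedges ?G)"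
      using bij_betw_trans[of "inv_into (hedges F) g" "g ` hedges F" "hedges F" "\<lambda>e. f ` e" "hedges ?G"]
      by (simp add: comp_def)
    moreover have "\<forall>h\<in>hedges ?H. ?\<phi> h \<subseteq> h"
      using g by (auto simp: inv_into_f_f)
    ultimately show ?thesis
      using assms(4) unfolding is_Berge_def by auto
  qed
  ultimately show ?thesis unfolding Berge_free_def by blast
qed

text \<open>The \<open>i\<close>-th trigger serves as the critical edge of group \<open>i\<close>: an apex \<open>y i\<close> takes the place
  of one endpoint, a pair \<open>y i\<close>, \<open>z i\<close> that of both.\<close>
lemma (in critical_graph) trigger_embedding:
  assumes H: "hypergraph (V, E)"
    and L: "card (hedges F) + s \<le> L"
    and PV: "\<And>j. j < r \<Longrightarrow> P j \<subseteq> V"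
    and r0: "r > 0"
    and D: "\<And>i j u. i < r \<Longrightarrow> j < r \<Longrightarrow> i \<noteq> j \<Longrightarrow> u \<in> P i \<Longrightarrow> card {w \<in> P j. \<not> heavy L E u w} \<le> D"
    and M: "2 * s + card (verts F) * (D + 1) \<le> M"
    and PM: "\<And>j. j < r \<Longrightarrow> M \<le> card (P j)"
    and I: "I \<subseteq> {..<s}"
    and apex: "\<And>i j. i \<in> I \<Longrightarrow> j < r \<Longrightarrow> M \<le> card {w \<in> P j. heavy L E (y i) w}"
    and pair: "\<And>i. i \<in> {..<s} - I \<Longrightarrow> ee i \<in> E \<and> y i \<in> ee i \<and> z i \<in> ee i \<and> \<kappa> i < r"
    and pairM: "\<And>i j. i \<in> {..<s} - I \<Longrightarrow> j < r \<Longrightarrow> j \<noteq> \<kappa> i \<Longrightarrow>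
       M \<le> card {w \<in> P j. heavy L E (y i) w \<and> heavy L E (z i) w}"
    and yV: "y ` {..<s} \<subseteq> V"
    and inj: "inj_on y {..<s}" "inj_on z ({..<s} - I)" "y ` {..<s} \<inter> z ` ({..<s} - I) = {}"
      "inj_on ee ({..<s} - I)"
  shows "\<not> Berge_free F (V, E)"
proof -
  let ?J = "{..<s} - I"
  \<comment> \<open>For an apex every color would do: \<open>a i\<close> goes to the apex, which has
    many heavy neighbours in every class, and \<open>b i\<close> is then placed greedily in class
    \<open>0\<close>.\<close>
  define \<kappa>' where "\<kappa>' = (\<lambda>i. if i \<in> I then 0 else \<kappa> i)"
  have "\<kappa>' i < r" if "i < s" for i
    using pair[of i] that r0 by (auto simp: \<kappa>'_def)
  then obtain c where c: "\<And>u. u \<in> verts F \<Longrightarrow> c u < r"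
    "\<And>i. i < s \<Longrightarrow> c (a i) = \<kappa>' i" "\<And>i. i < s \<Longrightarrow> c (b i) = \<kappa>' i"
    "\<And>u v. {u, v} \<in> hedges F \<Longrightarrow> (\<forall>i<s. {u, v} \<noteq> {a i, b i}) \<Longrightarrow> c u \<noteq> c v"
    using coloring[of \<kappa>'] by blast
  have finV: "finite V" and EV: "E \<subseteq> Pow V" using H by (auto simp: hypergraph_def)
  have finE: "finite E" using EV finV by (meson finite_Pow_iff finite_subset)
  have finF: "finite (verts F)" "finite (hedges F)" using graph_finite[OF graphF] by auto
  have ab: "a i \<noteq> b i" "a i \<in> verts F" "b i \<in> verts F" if "i < s" for i
    using graph_edge[OF graphF crit_edge[OF that]] by auto
  have inja: "inj_on a {..<s}" "inj_on b {..<s}"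
    using gr_a gr_b by (metis inj_onI lessThan_iff)+
  have anb: "a i \<noteq> b j" if "i < s" "j < s" for i j
    using that gr_a gr_b ab by metis
  \<comment> \<open>The vertices still to be placed: \<open>a i\<close> always has a prescribed
    image, \<open>b i\<close> only if trigger \<open>i\<close> is a pair.\<close>
  define S where "S = verts F - a ` {..<s} - b ` ?J"
  \<comment> \<open>Edges stay inside a group, so \<open>gr w\<close> tells which trigger vertices
    \<open>w\<close> may have to see. If the trigger is a pair, a vertex of color
    \<open>\<kappa> (gr w)\<close> is adjacent to neither endpoint, both having this color, and any
    vertex of its class is allowed.\<close>
  define Z where "Z = (\<lambda>w. {p \<in> P (c w). if gr w \<in> I then heavy L E (y (gr w)) p else
     c w \<noteq> \<kappa> (gr w) \<longrightarrow> heavy L E (y (gr w)) p \<and> heavy L E (z (gr w)) p})"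
  define B where "B = y ` {..<s} \<union> z ` ?J"
  have finB: "finite B" by (simp add: B_def)
  have cardB: "card B \<le> 2 * s"
    using card_Un_le[of "y ` {..<s}" "z ` ?J"] card_image_le[of "{..<s}" y] card_image_le[of ?J z]
      card_mono[of "{..<s}" ?J] by (simp add: B_def)
  have SF: "S \<subseteq> verts F" by (auto simp: S_def)
  have finP: "finite (P j)" if "j < r" for j using PV[OF that] finV finite_subset by blast
  have ZM: "M \<le> card (Z w)" if "w \<in> S" for w
  proof -
    have w: "w \<in> verts F" using that SF by blast
    note cw = c(1)[OF w] gr_less[OF w]
    show ?thesis
    proof (cases "gr w \<in> I")
      case True
      then show ?thesis using apex[OF True cw(1)] by (simp add: Z_def)
    next
      case False
      then show ?thesis using pairM[of "gr w" "c w"] PM[OF cw(1)] cw by (cases "c w = \<kappa> (gr w)") (auto simp: Z_def)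
    qed
  qed
  have "\<exists>g. inj_on g S \<and> (\<forall>w\<in>S. g w \<in> Z w - B) \<and>
      (\<forall>v\<in>S. \<forall>w\<in>S. c v \<noteq> c w \<longrightarrow> heavy L E (g v) (g w))"
  proof (rule greedy_embedding[where r = r and P = P and D = D])
    show "finite S" using SF finF finite_subset by blast
    show "c w < r" if "w \<in> S" for w using c(1) SF that by blast
    show "finite (Z w) \<and> Z w \<subseteq> P (c w)" if "w \<in> S" for w
    proof -
      have "Z w \<subseteq> P (c w)" by (auto simp: Z_def)
      then show ?thesis using finP[OF c(1)] SF that finite_subset by blast
    qed
    show "card B + card S * (D + 1) \<le> card (Z w)" if "w \<in> S" for w
    proof -
      have "card S * (D + 1) \<le> card (verts F) * (D + 1)"
        using card_mono[OF finF(1) SF] by (intro mult_le_mono1)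
      then show ?thesis using cardB M ZM[OF that] by linarith
    qed
  qed (use finB finP D heavy_sym in auto)
  then obtain g where g: "inj_on g S" "\<And>w. w \<in> S \<Longrightarrow> g w \<in> Z w" "\<And>w. w \<in> S \<Longrightarrow> g w \<notin> B"
    "\<And>v w. v \<in> S \<Longrightarrow> w \<in> S \<Longrightarrow> c v \<noteq> c w \<Longrightarrow> heavy L E (g v) (g w)"
    by blast
  define f where "f = (\<lambda>w. if w \<in> a ` {..<s} then y (gr w) else if w \<in> b ` ?J then z (gr w) else g w)"
  have fa: "f (a i) = y i" if "i < s" for i using that gr_a by (auto simp: f_def)
  have fb: "f (b i) = z i" if "i \<in> ?J" for i
  proof -
    have "b i \<notin> a ` {..<s}" using anb that by (metis DiffD1 imageE lessThan_iff)
    then show ?thesis using that gr_b by (auto simp: f_def)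
  qed
  have fS: "f w = g w" if "w \<in> S" for w using that by (auto simp: f_def S_def)
  have split: "w \<in> S \<or> (\<exists>i<s. w = a i) \<or> (\<exists>i\<in>?J. w = b i)" if "w \<in> verts F" for w
    using that unfolding S_def by blast
  have bI: "b i \<in> S" if "i \<in> I" for i
  proof -
    have i: "i < s" using that I by blast
    have "b i \<notin> b ` ?J" using that i inja(2) by (auto dest: inj_onD)
    moreover have "b i \<notin> a ` {..<s}" using anb i by fastforce
    ultimately show ?thesis using ab[OF i] by (simp add: S_def)
  qed
  have fB: "f w \<in> B \<longleftrightarrow> w \<notin> S" if "w \<in> verts F" for w
  proof
    assume "f w \<in> B" then show "w \<notin> S" using fS g(3) by metis
  next
    assume "w \<notin> S"
    then have "(\<exists>i<s. w = a i) \<or> (\<exists>i\<in>?J. w = b i)" using split[OF that] by blast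
    then show "f w \<in> B" using fa fb by (auto simp: B_def)
  qed
  have injf: "inj_on f (verts F)"
  proof (rule inj_onI)
    fix u v assume uv: "u \<in> verts F" "v \<in> verts F" and eq: "f u = f v"
    show "u = v"
    proof (cases "u \<in> S")
      case True
      then have "v \<in> S" using fB uv eq by metis
      then show ?thesis using True eq fS g(1) by (metis inj_onD)
    next
      case False
      then have "v \<notin> S" using fB uv eq by metis
      obtain i where i: "i < s" "u = a i \<or> i \<in> ?J \<and> u = b i" using False split[OF uv(1)] by blast
      obtain j where j: "j < s" "v = a j \<or> j \<in> ?J \<and> v = b j" using \<open>v \<notin> S\<close> split[OF uv(2)] by blast
      have yz: "y i \<noteq> z j" if "i < s" "j \<in> ?J" for i j using inj(3) that by blast
      have yy: "y i = y j \<Longrightarrow> i = j" using inj_onD[OF inj(1)] i j by simp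
      have zz: "i \<in> ?J \<Longrightarrow> j \<in> ?J \<Longrightarrow> z i = z j \<Longrightarrow> i = j" using inj_onD[OF inj(2)] by simp
      from i(2) j(2) show ?thesis
      proof (elim disjE conjE)
        assume "u = a i" "v = a j" then show ?thesis using eq fa i j yy by simp
      next
        assume "u = a i" "j \<in> ?J" "v = b j" then show ?thesis using eq fa fb i(1) yz[of i j] by simp
      next
        assume "i \<in> ?J" "u = b i" "v = a j" then show ?thesis using eq fa fb j(1) yz[of j i] by simp
      next
        assume "i \<in> ?J" "u = b i" "j \<in> ?J" "v = b j" then show ?thesis using eq fb zz by simp
      qed
    qed
  qed
  have zV: "z i \<in> V" if "i \<in> ?J" for i using pair[OF that] EV by blast
  have gV: "g w \<in> V" if "w \<in> S" for w
    using g(2)[OF that] PV[OF c(1)] SF that by (auto simp: Z_def)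
  have fV: "f ` verts F \<subseteq> V"
  proof
    fix p assume "p \<in> f ` verts F"
    then obtain w where w: "w \<in> verts F" "p = f w" by blast
    from split[OF w(1)] show "p \<in> V" using w fa fb fS gV zV yV by auto
  qed
  \<comment> \<open>These edges are represented by the given hyperedges \<open>ee i\<close>. Every
    other edge of \<open>F\<close>, including the critical edges at apexes, is mapped to a heavy
    pair.\<close>
  define K where "K = {{a i, b i} | i. i \<in> ?J}"
  have KF: "K \<subseteq> hedges F" using crit_edge by (auto simp: K_def)
  have main: "heavy L E (f u) (f v)" if e: "{u, v} \<in> hedges F" "{u, v} \<notin> K" for u v
  proof -
    have uv: "u \<noteq> v" "u \<in> verts F" "v \<in> verts F" using graph_edge[OF graphF e(1)] by auto
    have g': "gr u = gr v" by (rule gr_edge[OF e(1)])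
    show ?thesis
    proof (cases "\<exists>i<s. {u, v} = {a i, b i}")
      case True
      then obtain i where i: "i < s" "{u, v} = {a i, b i}" by auto
      then have iI: "i \<in> I" using e(2) by (auto simp: K_def)
      have "f (b i) \<in> Z (b i)" using g(2)[OF bI[OF iI]] fS[OF bI[OF iI]] by simp
      then have "heavy L E (f (a i)) (f (b i))"
        using fa[OF i(1)] gr_b[OF i(1)] iI by (simp add: Z_def)
      then show ?thesis using i(2) heavy_sym by (auto simp: doubleton_eq_iff)
    next
      case False
      then have cuv: "c u \<noteq> c v" using c(4)[OF e(1)] by blast
      have aux: "heavy L E (f u) (f v)"
        if v: "v \<in> S" and u: "u \<in> verts F" "u \<notin> S" and gg: "gr u = gr v" and cc: "c u \<noteq> c v" for u v
      proof -
        have "f v \<in> Z v" using g(2)[OF v] fS[OF v] by simp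
        from split[OF u(1)] u(2) consider i where "i < s" "u = a i" | i where "i \<in> ?J" "u = b i" by blast
        then show ?thesis
        proof cases
          case (1 i)
          then have "gr v = i" "c u = \<kappa>' i" using gg gr_a c(2) by auto
          then show ?thesis using \<open>f v \<in> Z v\<close> 1 cc fa[OF 1(1)] by (auto simp: Z_def \<kappa>'_def split: if_splits)
        next
          case (2 i)
          then have "gr v = i" "c u = \<kappa>' i" using gg gr_b c(3) by auto
          then show ?thesis using \<open>f v \<in> Z v\<close> 2 cc fb[OF 2(1)] by (auto simp: Z_def \<kappa>'_def split: if_splits)
        qed
      qed
      have "u \<in> S \<or> v \<in> S"
      proof (rule ccontr)
        assume "\<not> ?thesis"
        then have "\<exists>i<s. u = a i \<or> u = b i" "\<exists>i<s. v = a i \<or> v = b i"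
          using split[OF uv(2)] split[OF uv(3)] by auto
        then obtain i j where "i < s" "u = a i \<or> u = b i" "j < s" "v = a j \<or> v = b j" by blast
        moreover then have "i = j" using g' gr_a gr_b by metis
        ultimately show False using uv(1) False by (auto simp: insert_commute)
      qed
      then show ?thesis
      proof (elim disjE)
        assume u: "u \<in> S"
        show ?thesis
        proof (cases "v \<in> S")
          case True then show ?thesis using g(4)[OF u True cuv] fS u by simp
        next
          case False
          have "heavy L E (f v) (f u)"
            using aux[OF u uv(3) False] g' cuv by simp
          then show ?thesis by (rule heavy_sym)
        qed
      next
        assume v: "v \<in> S"
        show ?thesis
        proof (cases "u \<in> S")
          case True then show ?thesis using g(4)[OF True v cuv] fS v by simp
        next
          case False
          show ?thesis using aux[OF v uv(2) False g' cuv] .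
        qed
      qed
    qed
  qed
  have ex: "\<exists>\<psi>. inj_on \<psi> (hedges F - K) \<and> (\<forall>e\<in>hedges F - K. \<psi> e \<in> {h \<in> E. f ` e \<subseteq> h} - ee ` ?J)"
  proof (rule distinct_representatives)
    fix e assume e: "e \<in> hedges F - K"
    then obtain u v where uv: "e = {u, v}" using graph_edgeE[OF graphF, of e] by blast
    then have "heavy L E (f u) (f v)" using main e by auto
    then have "L \<le> card {h \<in> E. f ` e \<subseteq> h}" using uv by (simp add: heavy_def)
    moreover have "card (hedges F - K) + card (ee ` ?J) \<le> card (hedges F) + s"
      using card_mono[OF finF(2), of "hedges F - K"] card_image_le[of ?J ee] card_mono[of "{..<s}" ?J]
      by fastforce
    ultimately show "card (hedges F - K) + card (ee ` ?J) \<le> card {h \<in> E. f ` e \<subseteq> h}"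
      using L by linarith
  qed (use finF finE in auto)
  then obtain \<psi> where \<psi>0: "inj_on \<psi> (hedges F - K) \<and>
      (\<forall>e\<in>hedges F - K. \<psi> e \<in> {h \<in> E. f ` e \<subseteq> h} - ee ` ?J)" ..
  then have \<psi>: "inj_on \<psi> (hedges F - K)"
    "\<And>e. e \<in> hedges F - K \<Longrightarrow> \<psi> e \<in> E \<and> f ` e \<subseteq> \<psi> e \<and> \<psi> e \<notin> ee ` ?J"
    by auto
  \<comment> \<open>Both endpoints of \<open>{a i, b i}\<close> lie in group \<open>i\<close>, so an
    arbitrary one recovers the index.\<close>
  define idx where "idx = (\<lambda>e. gr (SOME u. u \<in> e))"
  have idx: "idx {a i, b i} = i" if "i < s" for i
  proof -
    have "(SOME u. u \<in> {a i, b i}) \<in> {a i, b i}" by (rule someI[of _ "a i"]) simp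
    then show ?thesis using gr_a[OF that] gr_b[OF that] by (auto simp: idx_def)
  qed
  define G where "G = (\<lambda>e. if e \<in> K then ee (idx e) else \<psi> e)"
  have GK: "G {a i, b i} = ee i" if "i \<in> ?J" for i
    using that idx by (auto simp: G_def K_def)
  have Gn: "G e = \<psi> e" if "e \<notin> K" for e using that by (simp add: G_def)
  have Kimg: "G e \<in> ee ` ?J \<longleftrightarrow> e \<in> K" if "e \<in> hedges F" for e
  proof (cases "e \<in> K")
    case True
    then obtain i where "i \<in> ?J" "e = {a i, b i}" by (auto simp: K_def)
    then show ?thesis using GK True by simp
  next
    case False
    then show ?thesis using Gn \<psi>(2)[of e] that by simp
  qed
  have injG: "inj_on G (hedges F)"
  proof (rule inj_onI)
    fix e e' assume ee: "e \<in> hedges F" "e' \<in> hedges F" and eq: "G e = G e'"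
    show "e = e'"
    proof (cases "e \<in> K")
      case True
      then have "e' \<in> K" using Kimg ee eq by metis
      with True obtain i j where "i \<in> ?J" "e = {a i, b i}" "j \<in> ?J" "e' = {a j, b j}"
        by (auto simp: K_def)
      then show ?thesis using eq GK inj(4) by (metis inj_onD)
    next
      case False
      then have "e' \<notin> K" using Kimg ee eq by metis
      then show ?thesis using eq False ee Gn \<psi>(1) by (auto dest: inj_onD)
    qed
  qed
  have Gsub: "f ` e \<subseteq> G e \<and> G e \<in> E" if "e \<in> hedges F" for e
  proof (cases "e \<in> K")
    case True
    then obtain i where i: "i \<in> ?J" "e = {a i, b i}" by (auto simp: K_def)
    then show ?thesis using GK[OF i(1)] pair[OF i(1)] fa fb by auto
  next
    case False then show ?thesis using Gn \<psi>(2)[of e] that by simp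
  qed
  show ?thesis
    by (rule not_Berge_freeI[OF graphF H injf fV injG]) (use Gsub in auto)
qed

section \<open>Counting transversals\<close>

text \<open>The elementary symmetric polynomial of degree \<open>k\<close>. Evaluated at the class
  sizes it counts the \<open>k\<close>-cliques of a complete multipartite graph.\<close>

definition esym :: "nat \<Rightarrow> 'i set \<Rightarrow> ('i \<Rightarrow> nat) \<Rightarrow> nat" where
  "esym k I p = (\<Sum>S | S \<subseteq> I \<and> card S = k. \<Prod>i\<in>S. p i)"

lemma esym_cong: "(\<And>i. i \<in> I \<Longrightarrow> p i = q i) \<Longrightarrow> esym k I p = esym k I q"
  unfolding esym_def by (intro sum.cong prod.cong) auto

lemma esym_0: "finite I \<Longrightarrow> esym 0 I p = 1"
proof -
  assume "finite I"
  then have "{S. S \<subseteq> I \<and> card S = 0} = {{}}" by (auto dest: finite_subset)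
  then show ?thesis by (simp add: esym_def)
qed

lemma esym_empty: "esym (Suc k) {} p = 0"
  by (auto simp: esym_def intro!: sum.neutral)

lemma esym_insert:
  assumes "finite I" "u \<notin> I"
  shows "esym (Suc k) (insert u I) p = esym (Suc k) I p + p u * esym k I p"
proof -
  let ?A = "{S. S \<subseteq> I \<and> card S = Suc k}" and ?B = "{S. S \<subseteq> I \<and> card S = k}"
  have fin: "finite S" if "S \<subseteq> I" for S using that assms(1) finite_subset by blast
  have eq: "{S. S \<subseteq> insert u I \<and> card S = Suc k} = ?A \<union> insert u ` ?B"
  proof (intro equalityI subsetI)
    fix S assume S: "S \<in> {S. S \<subseteq> insert u I \<and> card S = Suc k}"
    show "S \<in> ?A \<union> insert u ` ?B"
    proof (cases "u \<in> S")
      case True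
      then have "S = insert u (S - {u})" "S - {u} \<subseteq> I" "card (S - {u}) = k" using S by auto
      then show ?thesis by blast
    qed (use S in auto)
  next
    fix S assume "S \<in> ?A \<union> insert u ` ?B"
    then show "S \<in> {S. S \<subseteq> insert u I \<and> card S = Suc k}"
      using assms fin by (auto simp: card_insert_if)
  qed
  have inj: "inj_on (insert u) ?B"
  proof (rule inj_onI)
    fix S S' assume "S \<in> ?B" "S' \<in> ?B" "insert u S = insert u S'"
    then show "S = S'" using assms(2) by (metis (lifting) insert_ident mem_Collect_eq subsetD)
  qed
  have "esym (Suc k) (insert u I) p = (\<Sum>S\<in>?A. \<Prod>i\<in>S. p i) + (\<Sum>S\<in>insert u ` ?B. \<Prod>i\<in>S. p i)"
    unfolding esym_def eq using assms by (intro sum.union_disjoint) auto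
  also have "(\<Sum>S\<in>insert u ` ?B. \<Prod>i\<in>S. p i) = (\<Sum>S\<in>?B. \<Prod>i\<in>insert u S. p i)"
    by (simp add: sum.reindex[OF inj])
  also have "\<dots> = (\<Sum>S\<in>?B. p u * (\<Prod>i\<in>S. p i))"
    using assms fin by (intro sum.cong refl prod.insert) auto
  finally show ?thesis by (simp add: esym_def sum_distrib_left)
qed

lemma esym_ge:
  assumes "finite I" "\<And>i. i \<in> I \<Longrightarrow> x \<le> p i"
  shows "(card I choose k) * x ^ k \<le> esym k I p"
proof -
  have "(\<Sum>S | S \<subseteq> I \<and> card S = k. x ^ k) \<le> esym k I p"
    unfolding esym_def
  proof (rule sum_mono)
    fix S assume S: "S \<in> {S. S \<subseteq> I \<and> card S = k}"
    then have "(\<Prod>i\<in>S. x) \<le> (\<Prod>i\<in>S. p i)" using assms(2) by (intro prod_mono) auto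
    then show "x ^ k \<le> (\<Prod>i\<in>S. p i)" using S by simp
  qed
  then show ?thesis using n_subsets[OF assms(1), of k] by simp
qed

section \<open>Transversals of a partition into classes\<close>

definition transversals :: "nat \<Rightarrow> 'a set \<Rightarrow> ('a \<Rightarrow> 'i) \<Rightarrow> 'a set set" where
  "transversals k W c = {S. S \<subseteq> W \<and> card S = k \<and> inj_on c S}"

lemma finite_transversals: "finite W \<Longrightarrow> finite (transversals k W c)"
  by (auto simp: transversals_def intro: finite_subset[of _ "Pow W"])

lemma transversals_0: "finite W \<Longrightarrow> transversals 0 W c = {{}}"
  by (auto simp: transversals_def dest: finite_subset)

text \<open>A transversal meets the class \<open>u\<close> in at most one vertex. This is the set
  version of the recursion \<open>esym_insert\<close> and drives the induction over the
  classes.\<close>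

lemma transversals_split:
  fixes c :: "'a \<Rightarrow> 'i" and u :: 'i
  assumes "finite W"
  defines "W0 \<equiv> {w \<in> W. c w \<noteq> u}" and "W1 \<equiv> {w \<in> W. c w = u}"
  shows "card (transversals (Suc k) W c) =
    card (transversals (Suc k) W0 c) + card W1 * card (transversals k W0 c)"
proof -
  let ?T = "transversals k W0 c"
  let ?g = "\<lambda>(w, S). insert w S"
  have T: "S \<subseteq> W0 \<and> finite S \<and> card S = k \<and> inj_on c S" if "S \<in> ?T" for S
    using that assms(1) finite_subset by (fastforce simp: transversals_def W0_def)
  have eq: "transversals (Suc k) W c = transversals (Suc k) W0 c \<union> ?g ` (W1 \<times> ?T)"
  proof (intro equalityI subsetI)
    fix S assume S: "S \<in> transversals (Suc k) W c"
    then have S': "S \<subseteq> W" "card S = Suc k" "inj_on c S" by (auto simp: transversals_def)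
    show "S \<in> transversals (Suc k) W0 c \<union> ?g ` (W1 \<times> ?T)"
    proof (cases "\<exists>w\<in>S. c w = u")
      case True
      then obtain w where w: "w \<in> S" "c w = u" by blast
      have "S - {w} \<subseteq> W0"
        using S' w by (auto simp: W0_def dest: inj_onD)
      moreover have "inj_on c (S - {w})" using S'(3) by (rule inj_on_subset) auto
      ultimately have "S - {w} \<in> ?T" using S' w by (simp add: transversals_def)
      moreover have "w \<in> W1" using S' w by (auto simp: W1_def)
      moreover have "S = ?g (w, S - {w})" using w by auto
      ultimately show ?thesis by blast
    next
      case False
      then show ?thesis using S' by (auto simp: transversals_def W0_def)
    qed
  next
    fix S assume "S \<in> transversals (Suc k) W0 c \<union> ?g ` (W1 \<times> ?T)"
    then show "S \<in> transversals (Suc k) W c"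
    proof
      assume "S \<in> transversals (Suc k) W0 c" then show ?thesis by (auto simp: transversals_def W0_def)
    next
      assume "S \<in> ?g ` (W1 \<times> ?T)"
      then obtain w S' where w: "w \<in> W1" "S' \<in> ?T" "S = insert w S'" by auto
      have "w \<notin> S'" using T[OF w(2)] w(1) by (auto simp: W0_def W1_def)
      then show ?thesis using T[OF w(2)] w by (auto simp: transversals_def W0_def W1_def)
    qed
  qed
  have inj: "inj_on ?g (W1 \<times> ?T)"
  proof (rule inj_onI, clarify)
    fix w S w' S' assume h: "w \<in> W1" "S \<in> ?T" "w' \<in> W1" "S' \<in> ?T" "insert w S = insert w' S'"
    have d: "W0 \<inter> W1 = {}" by (auto simp: W0_def W1_def)
    then have "w = w'" using h T[OF h(2)] T[OF h(4)] by blast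
    moreover have "w \<notin> S" "w' \<notin> S'" using d h T[OF h(2)] T[OF h(4)] by blast+
    ultimately show "w = w' \<and> S = S'" using h(5) by (simp add: insert_ident)
  qed
  have "card (transversals (Suc k) W c) = card (transversals (Suc k) W0 c) + card (?g ` (W1 \<times> ?T))"
    unfolding eq
  proof (rule card_Un_disjoint)
    show "transversals (Suc k) W0 c \<inter> ?g ` (W1 \<times> ?T) = {}"
      by (auto simp: transversals_def W0_def W1_def)
    show "finite (transversals (Suc k) W0 c)" "finite (?g ` (W1 \<times> ?T))"
      using assms(1) by (auto simp: W0_def W1_def intro!: finite_transversals finite_imageI finite_cartesian_product)
  qed
  then show ?thesis by (simp add: card_image[OF inj] card_cartesian_product)
qed

lemma card_transversals:
  assumes "finite I" "finite W" "c ` W \<subseteq> I"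
  shows "card (transversals k W c) = esym k I (\<lambda>i. card {w \<in> W. c w = i})"
  using assms
proof (induction I arbitrary: W k rule: finite_induct)
  case empty
  then have "W = {}" by simp
  then show ?case
  proof (cases k)
    case 0 then show ?thesis using \<open>W = {}\<close> by (simp add: esym_0 transversals_0)
  next
    case (Suc k')
    have "transversals (Suc k') {} c = {}" by (auto simp: transversals_def)
    then show ?thesis using Suc \<open>W = {}\<close> by (simp add: esym_empty)
  qed
next
  case (insert u I)
  let ?W0 = "{w \<in> W. c w \<noteq> u}"
  have IH: "card (transversals k ?W0 c) = esym k I (\<lambda>i. card {w \<in> W. c w = i})" for k
  proof -
    have "card (transversals k ?W0 c) = esym k I (\<lambda>i. card {w \<in> ?W0. c w = i})"
      using insert.prems by (intro insert.IH) auto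
    also have "\<dots> = esym k I (\<lambda>i. card {w \<in> W. c w = i})"
      using insert.hyps by (intro esym_cong arg_cong[where f = card]) auto
    finally show ?thesis .
  qed
  show ?case
  proof (cases k)
    case 0
    then show ?thesis using insert by (simp add: transversals_0 esym_0)
  next
    case (Suc k')
    show ?thesis
      unfolding Suc transversals_split[OF insert.prems(1), of k' c u] esym_insert[OF insert.hyps] IH by simp
  qed
qed

section \<open>Balancing class sizes\<close>

text \<open>With the other values fixed, \<open>esym\<close> is a combination with nonnegative
  coefficients of \<open>1\<close>, the sum and the product of \<open>p i\<close> and
  \<open>p j\<close>. Moving one unit from the larger to the smaller keeps the sum and does not
  decrease the product.\<close>

lemma esym_shift:
  assumes "finite I" "i \<in> I" "j \<in> I" "p j < p i"
  shows "esym k I p \<le> esym k I (p(i := p i - 1, j := p j + 1))"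
proof -
  define J where "J = I - {i, j}"
  define q where "q = p(i := p i - 1, j := p j + 1)"
  have ij: "i \<noteq> j" using assms by auto
  have I: "I = insert i (insert j J)" and J: "finite J" "j \<notin> J" "i \<notin> insert j J"
    using assms ij by (auto simp: J_def)
  have qJ: "esym k J q = esym k J p" for k
    by (rule esym_cong) (auto simp: q_def J_def)
  have q: "q i = p i - 1" "q j = p j + 1" using ij by (auto simp: q_def)
  have fj: "finite (insert j J)" using J by simp
  have "esym k I p \<le> esym k I q"
  proof (cases k)
    case 0 then show ?thesis using assms by (simp add: esym_0)
  next
    case (Suc k1)
    show ?thesis
    proof (cases k1)
      case 0
      then show ?thesis using assms(4)
        unfolding Suc I esym_insert[OF fj J(3)] esym_insert[OF J(1,2)] 0 qJ q esym_0[OF fj] esym_0[OF J(1)]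
        by simp
    next
      case (Suc k2)
      obtain d where d: "p i = Suc (p j + d)" using assms(4) less_iff_Suc_add by blast
      show ?thesis
        unfolding \<open>k = Suc k1\<close> Suc I esym_insert[OF fj J(3)] esym_insert[OF J(1,2)] qJ q d
        by (simp add: algebra_simps)
    qed
  qed
  then show ?thesis by (simp add: q_def)
qed

text \<open>Units are moved from an index above its target to one below it. Balance of
  \<open>p\<close> guarantees that the former value is the larger one, so \<open>esym_shift\<close>
  applies, and each move lowers the total excess by one. The indices outside \<open>R\<close> stay
  fixed; they will be the singleton classes of the universal vertices.\<close>

lemma esym_balanced_max:
  assumes "finite I" "R \<subseteq> I" "\<And>i. i \<in> I - R \<Longrightarrow> q i = p i" "sum q R = sum p R"
    and bal: "\<And>i j. i \<in> R \<Longrightarrow> j \<in> R \<Longrightarrow> p i \<le> p j + 1"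
  shows "esym k I q \<le> esym k I p"
  using assms(3,4)
proof (induction "\<Sum>i\<in>R. q i - p i" arbitrary: q rule: less_induct)
  case less
  have finR: "finite R" using assms finite_subset by blast
  show ?case
  proof (cases "\<forall>i\<in>R. q i \<le> p i")
    case True
    have "q i = p i" if "i \<in> R" for i
    proof (rule ccontr)
      assume "q i \<noteq> p i"
      then have "q i < p i" using True that by force
      then have "sum q R < sum p R" using True that finR by (intro sum_strict_mono_ex1) auto
      then show False using less by simp
    qed
    then have "q i = p i" if "i \<in> I" for i using less.prems(1) that by blast
    then show ?thesis using esym_cong[of I q p] by simp
  next
    case False
    then obtain i where i: "i \<in> R" "p i < q i" by force
    have "\<exists>j\<in>R. q j < p j"
    proof (rule ccontr)
      assume "\<not> ?thesis"
      then have "sum p R < sum q R" using i finR by (intro sum_strict_mono_ex1) (auto simp: not_less)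
      then show False using less by simp
    qed
    then obtain j where j: "j \<in> R" "q j < p j" by blast
    have ij: "i \<noteq> j" using i j by auto
    have lt: "q j < q i" using i j bal[OF j(1) i(1)] by linarith
    let ?q = "q(i := q i - 1, j := q j + 1)"
    have R: "R = insert i (insert j (R - {i, j}))" using i j by auto
    have sum': "sum f R = f i + (f j + sum f (R - {i, j}))" for f :: "_ \<Rightarrow> nat"
      using finR ij by (subst R) simp
    have "esym k I q \<le> esym k I ?q"
      using assms i j lt by (intro esym_shift) auto
    also have "\<dots> \<le> esym k I p"
    proof (rule less.hyps)
      have "(\<Sum>x\<in>R - {i, j}. ?q x - p x) = (\<Sum>x\<in>R - {i, j}. q x - p x)"
        by (rule sum.cong) auto
      then show "(\<Sum>i\<in>R. ?q i - p i) < (\<Sum>i\<in>R. q i - p i)"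
        unfolding sum' using i j ij by simp
      have "sum ?q (R - {i, j}) = sum q (R - {i, j})"
        by (rule sum.cong) auto
      then show "sum ?q R = sum p R"
        using less.prems(2) ij lt unfolding sum' by simp
      show "?q x = p x" if "x \<in> I - R" for x using less.prems(1)[OF that] that i j by auto
    qed
    finally show ?thesis .
  qed
qed

section \<open>Cliques of a Turan graph joined to a complete graph\<close>

definition residue_count :: "nat \<Rightarrow> nat \<Rightarrow> nat \<Rightarrow> nat" where
  "residue_count m r j = card {v. v < m \<and> v mod r = j}"

lemma residue_count_Suc:
  "residue_count (Suc m) r j = residue_count m r j + (if m mod r = j then 1 else 0)"
proof -
  have "{v. v < Suc m \<and> v mod r = j} = {v. v < m \<and> v mod r = j} \<union> (if m mod r = j then {m} else {})"
    by (auto simp: less_Suc_eq)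
  then show ?thesis by (simp add: residue_count_def)
qed

lemma residue_count_eq:
  assumes "j < r"
  shows "residue_count m r j = m div r + (if j < m mod r then 1 else 0)"
proof (induction m)
  case 0 then show ?case by (simp add: residue_count_def)
next
  case (Suc m)
  have "m mod r < r" using assms by simp
  then show ?case
    using assms Suc residue_count_Suc[of m r j] by (auto simp: mod_Suc div_Suc)
qed

text \<open>The number of \<open>k\<close>-cliques of the join of the complete graph on
  \<open>a\<close> vertices and \<open>T(m, r)\<close>: each universal vertex counts as a class of
  size one beside the \<open>r\<close> residue classes.\<close>

definition turan_clique_count :: "nat \<Rightarrow> nat \<Rightarrow> nat \<Rightarrow> nat \<Rightarrow> nat" where
  "turan_clique_count a m r k =
     esym k (Inl ` {..<a} \<union> Inr ` {..<r}) (case_sum (\<lambda>_::nat. 1) (residue_count m r))"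

text \<open>The new vertex enters class \<open>m mod r\<close> and forms a clique with one vertex
  from each of any \<open>k\<close> other residue classes, all of size at least
  \<open>m div r\<close>. Cliques through the universal vertices are left out; they are of lower
  order in \<open>m\<close>.\<close>

lemma turan_clique_count_Suc:
  assumes "r > 0"
  shows "turan_clique_count a m r (Suc k) + (r - 1 choose k) * (m div r) ^ k
    \<le> turan_clique_count a (Suc m) r (Suc k)"
proof -
  define i where "i = m mod r"
  let ?I = "Inl ` {..<a} \<union> Inr ` {..<r} :: (nat + nat) set"
  define J where "J = ?I - {Inr i}"
  have i: "i < r" using assms by (simp add: i_def)
  have I: "?I = insert (Inr i) J" and J: "finite J" "Inr i \<notin> J" using i by (auto simp: J_def)
  let ?p = "case_sum (\<lambda>_::nat. 1) (residue_count m r)"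
  let ?q = "case_sum (\<lambda>_::nat. 1) (residue_count (Suc m) r)"
  have pq: "esym k J ?q = esym k J ?p" for k
    by (rule esym_cong) (auto simp: J_def residue_count_Suc i_def split: sum.split)
  have sub: "Inr ` ({..<r} - {i}) \<subseteq> J" by (auto simp: J_def)
  have "(card (Inr ` ({..<r} - {i}) :: (nat + nat) set) choose k) * (m div r) ^ k
      \<le> esym k (Inr ` ({..<r} - {i})) ?p"
    by (rule esym_ge) (auto simp: residue_count_eq)
  also have "\<dots> \<le> esym k J ?p"
    unfolding esym_def using J sub by (intro sum_mono2) auto
  finally have "(r - 1 choose k) * (m div r) ^ k \<le> esym k J ?p"
    using i by (simp add: card_image)
  then show ?thesis
    unfolding turan_clique_count_def I esym_insert[OF J] pq
    by (simp add: residue_count_Suc i_def)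
qed

text \<open>These are the \<open>k\<close>-cliques of the join of the complete graph on \<open>A\<close> and the complete
  multipartite graph on \<open>V - A\<close> with classes given by \<open>col\<close>.\<close>
definition apex_transversals :: "nat \<Rightarrow> 'a set \<Rightarrow> 'a set \<Rightarrow> ('a \<Rightarrow> nat) \<Rightarrow> 'a set set" where
  "apex_transversals k V A col = {S. S \<subseteq> V \<and> card S = k \<and> inj_on col (S - A)}"

lemma finite_apex_transversals: "finite V \<Longrightarrow> finite (apex_transversals k V A col)"
  by (auto simp: apex_transversals_def intro: finite_subset[of _ "Pow V"])

lemma card_apex_transversals:
  assumes "finite V" "A \<subseteq> V" "\<And>v. v \<in> V - A \<Longrightarrow> col v < r"
  shows "card (apex_transversals k V A col) =
    esym k (Inl ` {..<card A} \<union> Inr ` {..<r}) (case_sum (\<lambda>_::nat. 1) (\<lambda>j. card {v \<in> V - A. col v = j}))"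
proof -
  have finA: "finite A" using assms finite_subset by blast
  obtain h where h: "bij_betw h A {..<card A}"
    using ex_bij_betw_finite_nat[OF finA] by (auto simp: atLeast0LessThan)
  define c where "c = (\<lambda>v. if v \<in> A then Inl (h v) else Inr (col v))"
  let ?I = "Inl ` {..<card A} \<union> Inr ` {..<r} :: (nat + nat) set"
  have "inj_on c S \<longleftrightarrow> inj_on col (S - A)" for S
  proof
    assume "inj_on c S" then show "inj_on col (S - A)"
      by (auto simp: inj_on_def c_def)
  next
    assume *: "inj_on col (S - A)"
    have "inj_on h A" using h by (simp add: bij_betw_def)
    with * show "inj_on c S" by (auto simp: inj_on_def c_def split: if_splits)
  qed
  then have "apex_transversals k V A col = transversals k V c"
    by (auto simp: apex_transversals_def transversals_def)
  also have "card \<dots> = esym k ?I (\<lambda>i. card {v \<in> V. c v = i})"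
    using assms h by (intro card_transversals) (auto simp: c_def bij_betw_def)
  also have "\<dots> = esym k ?I (case_sum (\<lambda>_::nat. 1) (\<lambda>j. card {v \<in> V - A. col v = j}))"
  proof (rule esym_cong)
    fix i assume "i \<in> ?I"
    then consider x where "x < card A" "i = Inl x" | j where "i = Inr j" by auto
    then show "card {v \<in> V. c v = i} = case_sum (\<lambda>_. 1) (\<lambda>j. card {v \<in> V - A. col v = j}) i"
    proof cases
      case (1 x)
      have "x \<in> h ` A" using h 1 by (simp add: bij_betw_def)
      then obtain v where v: "v \<in> A" "h v = x" by blast
      have "{w \<in> V. c w = i} = {v}"
      proof (intro equalityI subsetI)
        fix w assume "w \<in> {w \<in> V. c w = i}"
        then have "w \<in> A" "h w = x" using 1 by (auto simp: c_def split: if_splits)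
        then show "w \<in> {v}" using v h by (auto simp: bij_betw_def dest: inj_onD)
      qed (use 1 v assms in \<open>auto simp: c_def\<close>)
      then show ?thesis using 1 by simp
    next
      case (2 j)
      then have "{w \<in> V. c w = i} = {v \<in> V - A. col v = j}" by (auto simp: c_def split: if_splits)
      then show ?thesis using 2 by simp
    qed
  qed
  finally show ?thesis .
qed

lemma card_apex_transversals_le:
  assumes "finite V" "A \<subseteq> V" "\<And>v. v \<in> V - A \<Longrightarrow> col v < r"
  shows "card (apex_transversals k V A col) \<le> turan_clique_count (card A) (card V - card A) r k"
proof -
  let ?I = "Inl ` {..<card A} \<union> Inr ` {..<r} :: (nat + nat) set"
  let ?q = "case_sum (\<lambda>_::nat. 1) (\<lambda>j. card {v \<in> V - A. col v = j})"
  let ?m = "card V - card A"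
  let ?p = "case_sum (\<lambda>_::nat. 1) (residue_count ?m r)"
  have tot: "(\<Sum>j<r. card {v \<in> W. f v = j}) = card W" if "finite W" "\<And>v. v \<in> W \<Longrightarrow> f v < r"
    for W :: "'x set" and f
    using sum.group[of W "{..<r}" f "\<lambda>_. 1 :: nat"] that by (simp add: image_subset_iff)
  have "sum ?q (Inr ` {..<r}) = (\<Sum>j<r. card {v \<in> V - A. col v = j})"
    by (simp add: sum.reindex)
  also have "\<dots> = card (V - A)" using assms by (intro tot) auto
  also have "\<dots> = ?m" using assms by (simp add: card_Diff_subset finite_subset)
  also have "\<dots> = (\<Sum>j<r. card {v \<in> {..<?m}. v mod r = j})"
  proof (cases "r = 0")
    case True
    then have "V = A" using assms by auto
    then show ?thesis using True by simp
  next
    case False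
    then show ?thesis using tot[of "{..<?m}" "\<lambda>v. v mod r"] by simp
  qed
  also have "\<dots> = sum ?p (Inr ` {..<r})"
    by (simp add: sum.reindex residue_count_def)
  finally have eq: "sum ?q (Inr ` {..<r}) = sum ?p (Inr ` {..<r})" .
  have "esym k ?I ?q \<le> esym k ?I ?p"
    by (rule esym_balanced_max[where R = "Inr ` {..<r}", OF _ _ _ eq]) (auto simp: residue_count_eq)
  then show ?thesis
    using card_apex_transversals[OF assms] by (simp add: turan_clique_count_def)
qed

lemma apex_transversals_mono:
  "A \<subseteq> A' \<Longrightarrow> apex_transversals k V A col \<subseteq> apex_transversals k V A' col"
  by (auto simp: apex_transversals_def intro: inj_on_subset)

lemma card_apex_transversals_insert:
  assumes V: "finite V" and x: "x \<in> V - A" and J: "finite J" "col x \<in> J"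
    and Q: "\<And>j. j \<in> J \<Longrightarrow> Q j \<subseteq> V - A - {x} \<and> q \<le> card (Q j) \<and> (\<forall>v\<in>Q j. col v = j)"
  shows "card (apex_transversals (Suc (card J)) V A col) + q ^ card J
    \<le> card (apex_transversals (Suc (card J)) V (insert x A) col)"
proof -
  let ?T = "apex_transversals (Suc (card J)) V"
  let ?g = "\<lambda>f. insert x (f ` J)"
  have PQ: "f j \<in> V - A - {x} \<and> col (f j) = j" if "f \<in> Pi\<^sub>E J Q" "j \<in> J" for f j
    using Q[OF that(2)] that by fastforce
  have inj: "inj_on ?g (Pi\<^sub>E J Q)"
  proof (rule inj_onI)
    fix f f' assume f: "f \<in> Pi\<^sub>E J Q" "f' \<in> Pi\<^sub>E J Q" "?g f = ?g f'"
    show "f = f'"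
    proof (rule PiE_ext[OF f(1,2)])
      fix j assume j: "j \<in> J"
      then have "f j \<in> insert x (f' ` J)" using f(3) by blast
      then obtain j' where "j' \<in> J" "f j = f' j'" using PQ[OF f(1) j] by auto
      then show "f j = f' j" using PQ[OF f(1) j] PQ[OF f(2), of j'] by auto
    qed
  qed
  have sub: "?g ` Pi\<^sub>E J Q \<subseteq> ?T (insert x A) col - ?T A col"
  proof
    fix S assume "S \<in> ?g ` Pi\<^sub>E J Q"
    then obtain f where f: "f \<in> Pi\<^sub>E J Q" "S = ?g f" by blast
    note P = PQ[OF f(1)]
    have injf: "inj_on f J" using P by (metis inj_onI)
    have xf: "x \<notin> f ` J" using P by auto
    have "card S = Suc (card J)" using f(2) xf J card_image[OF injf] by simp
    moreover have "S \<subseteq> V" using f(2) P x by auto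
    moreover have "inj_on col (S - insert x A)" using f(2) P by (auto simp: inj_on_def)
    moreover have "\<not> inj_on col (S - A)"
    proof
      assume "inj_on col (S - A)"
      moreover have "f (col x) \<in> S - A" "x \<in> S - A" "col (f (col x)) = col x"
        using P[OF J(2)] f(2) J(2) x by auto
      ultimately have "f (col x) = x" by (auto dest: inj_onD)
      then show False using P[OF J(2)] by simp
    qed
    ultimately show "S \<in> ?T (insert x A) col - ?T A col" by (simp add: apex_transversals_def)
  qed
  have "q ^ card J \<le> card (Pi\<^sub>E J Q)"
  proof -
    have "(\<Prod>j\<in>J. q) \<le> (\<Prod>j\<in>J. card (Q j))" using Q by (intro prod_mono) simp
    then show ?thesis by (simp add: card_PiE[OF J(1)])
  qed
  also have "\<dots> \<le> card (?T (insert x A) col - ?T A col)"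
    by (rule card_inj_on_le[OF inj sub]) (simp add: finite_apex_transversals[OF V])
  also have "\<dots> = card (?T (insert x A) col) - card (?T A col)"
    by (rule card_Diff_subset[OF finite_apex_transversals[OF V] apex_transversals_mono[OF subset_insertI]])
  finally show ?thesis
    using card_mono[OF finite_apex_transversals[OF V] apex_transversals_mono[of A "insert x A" "Suc (card J)" V col]]
    by fastforce
qed

section \<open>Clique counts and complete multipartite subgraphs\<close>

text \<open>The Cauchy-Schwarz inequality, from the nonnegativity of the variance.\<close>

lemma sum_power2_le:
  fixes f :: "'i \<Rightarrow> real"
  assumes "finite A"
  shows "(sum f A)\<^sup>2 \<le> card A * (\<Sum>i\<in>A. (f i)\<^sup>2)"
proof (cases "A = {}")
  case False
  define m where "m = sum f A / card A"
  have c: "real (card A) > 0" using assms False by (simp add: card_gt_0_iff)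
  have "0 \<le> (\<Sum>i\<in>A. (f i - m)\<^sup>2)" by (simp add: sum_nonneg)
  also have "\<dots> = (\<Sum>i\<in>A. (f i)\<^sup>2 - (2 * m) * f i + m\<^sup>2)"
    by (rule sum.cong) (simp_all add: power2_diff)
  also have "\<dots> = (\<Sum>i\<in>A. (f i)\<^sup>2) - 2 * m * sum f A + card A * m\<^sup>2"
    by (simp only: sum.distrib sum_subtractf sum_distrib_left[symmetric] sum_constant)
  also have "\<dots> = (\<Sum>i\<in>A. (f i)\<^sup>2) - (sum f A)\<^sup>2 / card A"
    using c by (simp add: m_def field_simps power2_eq_square)
  finally show ?thesis using c by (simp add: field_simps)
qed simp

section \<open>The Moon-Moser inequality\<close>

definition cliques :: "('b \<Rightarrow> 'b \<Rightarrow> bool) \<Rightarrow> 'b set \<Rightarrow> nat \<Rightarrow> 'b set set" where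
  "cliques adj W j = {S. S \<subseteq> W \<and> card S = j \<and> (\<forall>u\<in>S. \<forall>v\<in>S. u \<noteq> v \<longrightarrow> adj u v)}"

definition extensions :: "('b \<Rightarrow> 'b \<Rightarrow> bool) \<Rightarrow> 'b set \<Rightarrow> 'b set \<Rightarrow> 'b set" where
  "extensions adj W S = {v \<in> W. v \<notin> S \<and> (\<forall>u\<in>S. adj u v)}"

locale finite_graph =
  fixes adj :: "'b \<Rightarrow> 'b \<Rightarrow> bool" and W :: "'b set"
  assumes fin: "finite W" and sym: "adj u v \<Longrightarrow> adj v u"
begin

abbreviation "N j \<equiv> card (cliques adj W j)"
abbreviation "d S \<equiv> card (extensions adj W S)"

lemma finite_cliques: "finite (cliques adj W j)"
  using fin by (auto simp: cliques_def intro: finite_subset[of _ "Pow W"])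

lemma finite_clique: "S \<in> cliques adj W j \<Longrightarrow> finite S"
  using fin by (auto simp: cliques_def intro: finite_subset)

lemma finite_extensions: "finite (extensions adj W S)"
  using fin by (simp add: extensions_def)

lemma clique_insert:
  assumes "S \<in> cliques adj W j" "v \<in> extensions adj W S"
  shows "insert v S \<in> cliques adj W (Suc j)"
  using assms finite_clique[OF assms(1)] sym by (auto simp: cliques_def extensions_def)

lemma clique_remove:
  assumes "T \<in> cliques adj W (Suc j)" "v \<in> T"
  shows "T - {v} \<in> cliques adj W j" "v \<in> extensions adj W (T - {v})"
  using assms finite_clique[OF assms(1)] by (auto simp: cliques_def extensions_def)

text \<open>Pairs of a clique and an extending vertex correspond to larger cliques with a
  distinguished vertex. With \<open>g = d\<close> the left side becomes the sum of the squared
  degrees.\<close>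

lemma sum_extensions:
  "(\<Sum>S\<in>cliques adj W j. \<Sum>v\<in>extensions adj W S. g S) =
    (\<Sum>T\<in>cliques adj W (Suc j). \<Sum>v\<in>T. g (T - {v}))" for g :: "'b set \<Rightarrow> nat"
proof -
  have "(\<Sum>S\<in>cliques adj W j. \<Sum>v\<in>extensions adj W S. g S) =
      (\<Sum>(S, v)\<in>(SIGMA S:cliques adj W j. extensions adj W S). g S)"
    by (rule sum.Sigma) (auto simp: finite_cliques finite_extensions)
  also have "\<dots> = (\<Sum>(T, v)\<in>(SIGMA T:cliques adj W (Suc j). T). g (T - {v}))"
  proof (rule sum.reindex_bij_witness[where i = "\<lambda>(T, v). (T - {v}, v)" and j = "\<lambda>(S, v). (insert v S, v)"])
    fix x assume "x \<in> (SIGMA S:cliques adj W j. extensions adj W S)"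
    then obtain S v where x: "x = (S, v)" "S \<in> cliques adj W j" "v \<in> extensions adj W S" by blast
    have "v \<notin> S" using x(3) by (simp add: extensions_def)
    then show "(case case x of (S, v) \<Rightarrow> (insert v S, v) of (T, v) \<Rightarrow> (T - {v}, v)) = x"
      "(case case x of (S, v) \<Rightarrow> (insert v S, v) of (T, v) \<Rightarrow> g (T - {v})) = (case x of (S, v) \<Rightarrow> g S)"
      using x(1) by auto
    show "(case x of (S, v) \<Rightarrow> (insert v S, v)) \<in> (SIGMA T:cliques adj W (Suc j). T)"
      using x clique_insert by auto
  next
    fix y assume "y \<in> (SIGMA T:cliques adj W (Suc j). T)"
    then obtain T v where y: "y = (T, v)" "T \<in> cliques adj W (Suc j)" "v \<in> T" by blast
    show "(case case y of (T, v) \<Rightarrow> (T - {v}, v) of (S, v) \<Rightarrow> (insert v S, v)) = y"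
      using y by auto
    show "(case y of (T, v) \<Rightarrow> (T - {v}, v)) \<in> (SIGMA S:cliques adj W j. extensions adj W S)"
      using y clique_remove by auto
  qed
  also have "\<dots> = (\<Sum>T\<in>cliques adj W (Suc j). \<Sum>v\<in>T. g (T - {v}))"
    by (rule sum.Sigma[symmetric]) (auto simp: finite_cliques finite_clique)
  finally show ?thesis .
qed

lemma sum_degrees: "(\<Sum>S\<in>cliques adj W j. d S) = Suc j * N (Suc j)"
proof -
  have "(\<Sum>S\<in>cliques adj W j. d S) = (\<Sum>T\<in>cliques adj W (Suc j). \<Sum>v\<in>T. 1)"
    using sum_extensions[of "\<lambda>_. 1" j] by simp
  also have "\<dots> = (\<Sum>T\<in>cliques adj W (Suc j). Suc j)"
    by (rule sum.cong) (auto simp: cliques_def)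
  finally show ?thesis by simp
qed

text \<open>A vertex that extends two facets of \<open>T\<close> is adjacent to all of
  \<open>T\<close>. Thus each vertex of \<open>W\<close> is counted at most once, or
  \<open>i + 1\<close> times if it extends \<open>T\<close> itself.\<close>

lemma sum_facets_le:
  assumes T: "T \<in> cliques adj W (Suc i)"
  shows "(\<Sum>v\<in>T. d (T - {v})) \<le> card W + i * d T"
proof -
  have finT: "finite T" and cT: "card T = Suc i" using finite_clique[OF T] T by (auto simp: cliques_def)
  have "(\<Sum>v\<in>T. d (T - {v})) = (\<Sum>v\<in>T. \<Sum>w\<in>W. if w \<in> extensions adj W (T - {v}) then 1 else 0)"
    using fin by (intro sum.cong refl) (auto simp: sum.If_cases extensions_def intro: arg_cong[where f = card])
  also have "\<dots> = (\<Sum>w\<in>W. \<Sum>v\<in>T. if w \<in> extensions adj W (T - {v}) then 1 else 0)"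
    by (rule sum.swap)
  also have "\<dots> \<le> (\<Sum>w\<in>W. 1 + (if w \<in> extensions adj W T then i else 0))"
  proof (rule sum_mono)
    fix w assume "w \<in> W"
    let ?X = "{v \<in> T. w \<in> extensions adj W (T - {v})}"
    have "(\<Sum>v\<in>T. if w \<in> extensions adj W (T - {v}) then 1 else 0) = card ?X"
      using finT by (simp add: sum.If_cases Int_def)
    also have "card ?X \<le> 1 + (if w \<in> extensions adj W T then i else 0)"
    proof (cases "w \<in> extensions adj W T")
      case True
      then show ?thesis using card_mono[of T ?X] finT cT by auto
    next
      case False
      have "v = v'" if "v \<in> ?X" "v' \<in> ?X" for v v'
      proof (rule ccontr)
        assume "v \<noteq> v'"
        show False
        proof (cases "w \<in> T")
          case True
          then have "w = v" "w = v'" using that by (auto simp: extensions_def)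
          then show False using \<open>v \<noteq> v'\<close> by simp
        next
          case wT: False
          have "adj u w" if "u \<in> T" for u
            using that \<open>v \<in> ?X\<close> \<open>v' \<in> ?X\<close> \<open>v \<noteq> v'\<close> by (cases "u = v") (auto simp: extensions_def)
          then show False using False wT \<open>w \<in> W\<close> by (auto simp: extensions_def)
        qed
      qed
      then have "card ?X \<le> 1" using finT by (intro card_le_Suc0_iff_eq[THEN iffD2, simplified One_nat_def[symmetric]]) auto
      then show ?thesis using False by simp
    qed
    finally show "(\<Sum>v\<in>T. if w \<in> extensions adj W (T - {v}) then 1 else 0) \<le>
      1 + (if w \<in> extensions adj W T then i else 0)" .
  qed
  also have "\<dots> = card W + i * d T"
  proof -
    have "(\<Sum>w\<in>W. if w \<in> extensions adj W T then i else 0) = card (W \<inter> extensions adj W T) * i"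
      using fin by (simp add: sum.If_cases)
    moreover have "W \<inter> extensions adj W T = extensions adj W T" by (auto simp: extensions_def)
    ultimately show ?thesis unfolding sum.distrib by simp
  qed
  finally show ?thesis .
qed

text \<open>Cauchy-Schwarz for the degrees of the \<open>i\<close>-cliques, whose squares are
  regrouped over the facets of the \<open>(i + 1)\<close>-cliques.\<close>

lemma moon_moser:
  "(Suc i * N (Suc i))\<^sup>2 \<le> N i * (card W * N (Suc i) + i * (i + 2) * N (i + 2))"
proof -
  have "(\<Sum>S\<in>cliques adj W i. (d S)\<^sup>2) = (\<Sum>T\<in>cliques adj W (Suc i). \<Sum>v\<in>T. d (T - {v}))"
    using sum_extensions[of d i] by (simp add: power2_eq_square)
  also have "\<dots> \<le> (\<Sum>T\<in>cliques adj W (Suc i). card W + i * d T)"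
    by (rule sum_mono) (rule sum_facets_le)
  also have "\<dots> = card W * N (Suc i) + i * (i + 2) * N (i + 2)"
    using sum_degrees[of "Suc i"] by (simp add: sum.distrib sum_distrib_left[symmetric] algebra_simps)
  finally have *: "(\<Sum>S\<in>cliques adj W i. (d S)\<^sup>2) \<le> card W * N (Suc i) + i * (i + 2) * N (i + 2)" .
  have "real ((Suc i * N (Suc i))\<^sup>2) \<le> N i * (\<Sum>S\<in>cliques adj W i. (real (d S))\<^sup>2)"
    using sum_power2_le[OF finite_cliques, of "\<lambda>S. real (d S)" i]
    by (simp only: of_nat_sum[symmetric] sum_degrees of_nat_power)
  also have "\<dots> = real (N i * (\<Sum>S\<in>cliques adj W i. (d S)\<^sup>2))" by simp
  finally have "(Suc i * N (Suc i))\<^sup>2 \<le> N i * (\<Sum>S\<in>cliques adj W i. (d S)\<^sup>2)"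
    by (simp only: of_nat_le_iff)
  also have "\<dots> \<le> N i * (card W * N (Suc i) + i * (i + 2) * N (i + 2))"
    using * by (rule mult_le_mono2)
  finally show ?thesis .
qed

lemma cliques_0: "cliques adj W 0 = {{}}"
  using fin by (auto simp: cliques_def dest: finite_subset)

lemma N_1: "N 1 = card W"
proof -
  have "cliques adj W 1 = (\<lambda>v. {v}) ` W" by (auto simp: cliques_def card_1_singleton_iff)
  then show ?thesis by (simp add: card_image)
qed

lemma N_Suc_eq_0: "N j = 0 \<Longrightarrow> N (Suc j) = 0"
  using sum_degrees[of j] finite_cliques[of j] by auto

end

text \<open>For the Turan graph with \<open>R\<close> parts on \<open>D\<close> vertices the clique ratio
  \<open>(j + 1) * N (j + 1) / (D * N j)\<close> is \<open>1 - j / R\<close>. Once it exceeds this value by \<open>\<eta>\<close>,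
  the Moon-Moser inequality propagates the excess to all larger \<open>j\<close>.\<close>
lemma (in finite_graph) clique_ratio_step:
  fixes D \<eta> R :: real and j :: nat and q :: "nat \<Rightarrow> real"
  defines "q \<equiv> \<lambda>j. real (j + 1) * real (N (j + 1)) / (D * N j)"
  assumes D: "D > 0" "card W \<le> D" and j: "j \<ge> 1" "j \<le> R" and \<eta>: "\<eta> > 0"
    and qj: "1 - j / R + \<eta> \<le> q j"
  shows "1 - real (j + 1) / R + \<eta> \<le> q (j + 1)"
proof -
  have R: "R > 0" using j by simp
  have "q j > 0" using qj \<eta> j R by (smt (verit) divide_le_eq_1_pos)
  then have "q j \<noteq> 0" by simp
  then have pos: "N j > 0" "N (j + 1) > 0" by (auto simp: q_def)
  let ?a = "real (N j)" and ?b = "real (N (j + 1))" and ?c = "real (N (j + 2))"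
  have "real ((Suc j * N (Suc j))\<^sup>2) \<le> real (N j * (card W * N (Suc j) + j * (j + 2) * N (j + 2)))"
    using moon_moser[of j] by (simp only: of_nat_le_iff)
  then have "((j + 1) * ?b)\<^sup>2 \<le> ?a * (card W * ?b + j * (j + 2) * ?c)" by (simp add: algebra_simps)
  also have "\<dots> \<le> ?a * (D * ?b + j * (j + 2) * ?c)"
    using D by (intro mult_left_mono add_right_mono mult_right_mono) auto
  finally have "((j + 1) * ?b)\<^sup>2 / (D * ?a * ?b) \<le> ?a * (D * ?b + j * (j + 2) * ?c) / (D * ?a * ?b)"
    using D pos by (intro divide_right_mono) auto
  moreover have "((j + 1) * ?b)\<^sup>2 / (D * ?a * ?b) = (j + 1) * q j"
    using D pos by (simp add: q_def field_simps power2_eq_square)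
  moreover have "?a * (D * ?b + j * (j + 2) * ?c) / (D * ?a * ?b) = 1 + j * q (j + 1)"
    using D pos by (simp add: q_def field_simps)
  \<comment> \<open>The Moon-Moser inequality in ratio form. The Turan ratios
    \<open>1 - j / R\<close> satisfy it with equality, so an excess \<open>\<eta>\<close> at
    \<open>j\<close> forces at least the same excess at \<open>j + 1\<close>.\<close>
  ultimately have "(j + 1) * q j \<le> 1 + j * q (j + 1)" by simp
  moreover have "(j + 1) * (1 - j / R + \<eta>) \<le> (j + 1) * q j" using qj by (intro mult_left_mono) auto
  moreover have "(j + 1) * (1 - j / R + \<eta>) - 1 = j * (1 - (j + 1) / R + \<eta>) + \<eta>"
    using R by (simp add: field_simps)
  ultimately have "j * (1 - (j + 1) / R + \<eta>) \<le> j * q (j + 1)" using \<eta> by linarith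
  then show ?thesis using j by simp
qed

text \<open>The Turan ratios multiply up to the density of \<open>K\<close>-cliques in a balanced
  complete \<open>R\<close>-partite graph.\<close>

lemma prod_turan_ratio:
  assumes "K \<le> R"
  shows "(\<Prod>i<K. (1 - real i / real R) / (i + 1)) = real (R choose K) / real R ^ K"
  using assms
proof (induction K)
  case (Suc K)
  have "Suc K * (R choose Suc K) = (R - K) * (R choose K)"
    using binomial_absorb_comp[of R K] binomial_absorption[of K R] by simp
  then have "real (Suc K) * real (R choose Suc K) = real (R - K) * real (R choose K)"
    by (metis of_nat_mult)
  then have e: "real (R choose Suc K) = (real R - real K) * real (R choose K) / (1 + real K)"
    using Suc.prems by (simp add: of_nat_diff field_simps)
  have R: "real R > 0" using Suc.prems by simp
  have "(\<Prod>i<Suc K. (1 - real i / real R) / (i + 1)) =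
      real (R choose K) / real R ^ K * ((1 - real K / real R) / (1 + real K))"
    using Suc by simp
  also have "\<dots> = ((real R - real K) * real (R choose K) / (1 + real K)) / real R ^ Suc K"
    using R by (simp add: field_simps)
  finally show ?case unfolding e .
qed simp

text \<open>Contrapositively, a neighbourhood with few \<open>R + 1\<close>-cliques that carries almost as many
  \<open>K\<close>-cliques as a neighbourhood in the Turan graph is almost as large as one.\<close>
lemma few_vertices_many_cliques:
  fixes R K :: nat and \<epsilon> :: real
  assumes K: "1 \<le> K" "K \<le> R" and \<epsilon>: "\<epsilon> > 0"
  shows "\<exists>\<delta>>0. \<forall>(adj :: 'b \<Rightarrow> 'b \<Rightarrow> bool) W (n :: real). finite_graph adj W \<longrightarrow> n > 0 \<longrightarrow>
    card W \<le> (1 - 1 / (R + 1) - \<epsilon>) * n \<longrightarrow>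
    (real (R choose K) / (R + 1) ^ K - \<delta>) * n ^ K \<le> card (cliques adj W K) \<longrightarrow>
    \<delta> * n ^ (R + 1) \<le> card (cliques adj W (R + 1))"
proof -
  define c0 where "c0 = real (R choose K) / (R + 1) ^ K"
  define \<beta> where "\<beta> = 1 - 1 / (R + 1) - \<epsilon>"
  have c0: "c0 > 0" using K by (simp add: c0_def)
  show ?thesis
  proof (cases "\<beta> \<le> 0")
    case True
    show ?thesis
    proof (intro exI[of _ "c0 / 2"] conjI allI impI)
      show "c0 / 2 > 0" using c0 by simp
      fix adj :: "'b \<Rightarrow> 'b \<Rightarrow> bool" and W and n :: real
      assume fg: "finite_graph adj W" and n: "n > 0" and small: "card W \<le> (1 - 1 / (R + 1) - \<epsilon>) * n"
        and many: "(real (R choose K) / (R + 1) ^ K - c0 / 2) * n ^ K \<le> card (cliques adj W K)"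
      interpret finite_graph adj W by fact
      have "(1 - 1 / (R + 1) - \<epsilon>) * n \<le> 0" using True n by (simp add: \<beta>_def mult_nonpos_nonneg)
      then have "real (card W) \<le> 0" using small by linarith
      then have "W = {}" using fin by simp
      then have "cliques adj W K = {}" using K by (auto simp: cliques_def)
      then have "(c0 - c0 / 2) * n ^ K \<le> 0" using many by (simp add: c0_def)
      moreover have "(c0 - c0 / 2) * n ^ K > 0" using c0 n by (intro mult_pos_pos) auto
      ultimately show "c0 / 2 * n ^ (R + 1) \<le> card (cliques adj W (R + 1))" by linarith
    qed
  next
    case False
    have "1 - 1 / (real R + 1) = R / (R + 1)" by (simp add: field_simps)
    then have \<beta>: "\<beta> > 0" "\<beta> < R / (R + 1)" using False \<epsilon> by (auto simp: \<beta>_def add.commute)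
    have R0: "R > 0" using K by simp
    \<comment> \<open>If no ratio below index \<open>K\<close> exceeds its Turan value by
      \<open>\<eta>\<close>, there are at most \<open>h \<eta> * n ^ K\<close> cliques of size
      \<open>K\<close>. At \<open>\<eta> = 0\<close> this density is below \<open>c0\<close> because
      \<open>\<beta> < R / (R + 1)\<close>, and continuity leaves room for a positive
      \<open>\<eta>\<close>.\<close>
    define h where "h = (\<lambda>\<eta>. \<beta> ^ K * (\<Prod>i<K. (1 - real i / R + \<eta>) / (i + 1)))"
    have "h 0 = \<beta> ^ K * (real (R choose K) / real R ^ K)"
      unfolding h_def using prod_turan_ratio[OF K(2)] by simp
    also have "\<dots> < (R / (R + 1)) ^ K * (real (R choose K) / real R ^ K)"
      using \<beta> K R0 by (intro mult_strict_right_mono power_strict_mono) auto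
    also have "\<dots> = c0" using R0 by (simp add: c0_def power_divide)
    finally have h0: "h 0 < c0" .
    define c1 where "c1 = (h 0 + c0) / 2"
    have c1: "h 0 < c1" "c1 < c0" using h0 by (auto simp: c1_def)
    have "isCont h 0" unfolding h_def by (intro continuous_intros) auto
    then have "(h \<longlongrightarrow> h 0) (at_right 0)" by (simp add: isCont_def filterlim_at_split)
    then have "eventually (\<lambda>\<eta>. h \<eta> < c1) (at_right 0)" using c1 order_tendstoD(2) by blast
    then obtain \<eta> where \<eta>: "\<eta> > 0" "h \<eta> < c1"
      unfolding eventually_at_right_field using field_lbound_gt_zero[of 1] by (metis dense)
    \<comment> \<open>Once the ratios are excessive, they are at least \<open>\<eta>\<close> up to
      index \<open>R\<close>, so each further clique size multiplies the count by at least
      \<open>\<eta> * D / (R + 1) = B * n\<close>.\<close>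
    define B where "B = \<eta> * \<beta> / (R + 1)"
    have B: "B > 0" using \<eta> \<beta> by (simp add: B_def)
    define \<delta> where "\<delta> = min (c0 - c1) (min (c0 / 2) (c0 / 2 * B ^ (R + 1 - K)))"
    have \<delta>: "\<delta> > 0" "\<delta> \<le> c0 - c1" "\<delta> \<le> c0 / 2" "\<delta> \<le> c0 / 2 * B ^ (R + 1 - K)"
    proof -
      have "c0 - c1 > 0" "c0 / 2 > 0" "c0 / 2 * B ^ (R + 1 - K) > 0" using c0 c1 B by simp_all
      then show "\<delta> > 0" unfolding \<delta>_def by linarith
    qed (unfold \<delta>_def, linarith+)
    show ?thesis
    proof (intro exI[of _ \<delta>] conjI allI impI)
      show "\<delta> > 0" by fact
      fix adj :: "'b \<Rightarrow> 'b \<Rightarrow> bool" and W and n :: real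
      assume fg: "finite_graph adj W" and n: "n > 0" and small: "card W \<le> (1 - 1 / (R + 1) - \<epsilon>) * n"
        and many: "(real (R choose K) / (R + 1) ^ K - \<delta>) * n ^ K \<le> card (cliques adj W K)"
      interpret finite_graph adj W by fact
      define D where "D = \<beta> * n"
      have D: "D > 0" "card W \<le> D" using \<beta> n small by (auto simp: D_def \<beta>_def)
      define q where "q = (\<lambda>j::nat. real (j + 1) * real (N (j + 1)) / (D * N j))"
      have Nq: "real (N (j + 1)) = q j * D / (j + 1) * N j" for j
      proof (cases "N j = 0")
        case True then show ?thesis using N_Suc_eq_0[of j] by simp
      next
        case False
        have "y = x * y / (D * z) * D / x * z" if "x > 0" "z > 0" for x y z :: real
          using that D by (simp add: field_simps)
        from this[of "real (j + 1)" "real (N j)"] show ?thesis using False by (simp add: q_def)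
      qed
      have "\<exists>i<K. 1 - i / R + \<eta> \<le> q i"
      proof (rule ccontr)
        assume "\<not> ?thesis"
        then have qi: "q i \<le> 1 - i / R + \<eta>" if "i < K" for i using that by force
        have "real (N j) \<le> (\<Prod>i<j. (1 - real i / R + \<eta>) / (i + 1)) * D ^ j" if "j \<le> K" for j
          using that
        proof (induction j)
          case 0 then show ?case by (simp add: cliques_0)
        next
          case (Suc j)
          have q0: "q j \<ge> 0" using D by (simp add: q_def)
          have "real (N (j + 1)) \<le> (1 - real j / R + \<eta>) * D / (j + 1) * N j"
            unfolding Nq[of j] using qi[of j] Suc.prems D
            by (intro mult_right_mono divide_right_mono) auto
          also have "\<dots> \<le> (1 - real j / R + \<eta>) * D / (j + 1) * ((\<Prod>i<j. (1 - real i / R + \<eta>) / (i + 1)) * D ^ j)"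
            using Suc qi[of j] q0 D by (intro mult_left_mono divide_nonneg_nonneg mult_nonneg_nonneg) auto
          finally show ?case by (simp add: field_simps)
        qed
        from this[of K] have "real (N K) \<le> h \<eta> * n ^ K"
          by (simp add: h_def D_def power_mult_distrib algebra_simps)
        also have "\<dots> < c1 * n ^ K" using \<eta> n by simp
        also have "\<dots> \<le> (c0 - \<delta>) * n ^ K" using \<delta> n by (intro mult_right_mono) auto
        finally show False using many by (simp add: c0_def)
      qed
      then obtain i where i: "i < K" "1 - i / R + \<eta> \<le> q i" by blast
      \<comment> \<open>The ratio at index \<open>0\<close> is \<open>card W / D \<le> 1\<close> and
        cannot be excessive, whereas the propagation step has to start at a positive index.\<close>
      have i1: "i \<ge> 1"
      proof (rule ccontr)
        assume "\<not> ?thesis"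
        then have "i = 0" by simp
        then have "1 + \<eta> \<le> card W / D" using i(2) N_1 by (simp add: q_def cliques_0)
        then show False using D \<eta> by (simp add: field_simps) (smt (verit) mult_pos_pos)
      qed
      have qj: "1 - j / R + \<eta> \<le> q j" if "i \<le> j" "j \<le> R" for j
        using that
      proof (induction j rule: dec_induct)
        case base then show ?case using i by simp
      next
        case (step m)
        have "1 - (m + 1) / R + \<eta> \<le> q (m + 1)"
          unfolding q_def
          using step i1 \<eta> D by (intro clique_ratio_step) (auto simp: q_def)
        then show ?case by (simp add: algebra_simps)
      qed
      have grow: "N K * (B * n) ^ (j - K) \<le> N j" if "K \<le> j" "j \<le> R + 1" for j
        using that
      proof (induction j rule: dec_induct)
        case base then show ?case by simp
      next
        case (step m)
        have m: "m \<le> R" "i \<le> m" using step i by auto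
        have "\<eta> \<le> 1 - m / R + \<eta>" using m R0 by simp
        then have "\<eta> \<le> q m" using qj[OF m(2,1)] by linarith
        have "B * n = \<eta> * D / (R + 1)" by (simp add: B_def D_def)
        also have "\<dots> \<le> q m * D / (m + 1)"
          using \<open>\<eta> \<le> q m\<close> D \<eta> m by (intro frac_le mult_right_mono) auto
        finally have Bq: "B * n \<le> q m * D / (m + 1)" .
        have "N K * (B * n) ^ (Suc m - K) = B * n * (N K * (B * n) ^ (m - K))"
          using step by (simp add: Suc_diff_le)
        also have "\<dots> \<le> q m * D / (m + 1) * N m"
        proof (rule mult_mono)
          have "0 \<le> B * n" using B n by simp
          then show "0 \<le> q m * D / (m + 1)" using Bq by linarith
        qed (use step Bq B n in auto)
        also have "\<dots> = N (Suc m)" using Nq[of m] by simp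
        finally show ?case .
      qed
      have "\<delta> * n ^ (R + 1) \<le> c0 / 2 * B ^ (R + 1 - K) * n ^ (R + 1)"
        using \<delta> n by (intro mult_right_mono) auto
      also have "\<dots> = c0 / 2 * n ^ K * (B * n) ^ (R + 1 - K)"
      proof -
        have "n ^ (R + 1) = n ^ K * n ^ (R + 1 - K)" using K by (simp add: power_add[symmetric])
        then show ?thesis by (simp only: power_mult_distrib mult_ac)
      qed
      also have "\<dots> \<le> N K * (B * n) ^ (R + 1 - K)"
      proof (rule mult_right_mono)
        have "c0 / 2 * n ^ K \<le> (c0 - \<delta>) * n ^ K" using \<delta> n by (intro mult_right_mono) auto
        then show "c0 / 2 * n ^ K \<le> N K" using many by (simp add: c0_def)
      qed (use B n in auto)
      also have "\<dots> \<le> N (R + 1)" using grow[of "R + 1"] K by simp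
      finally show "\<delta> * n ^ (R + 1) \<le> card (cliques adj W (R + 1))" .
    qed
  qed
qed

text \<open>Among \<open>J\<close> dense subsets of \<open>Y\<close> a positive proportion of points lies in at least
  \<open>T\<close> of them; the set of indices is then pigeonholed.\<close>
lemma dense_sets_common:
  fixes \<delta> :: real
  assumes Y: "finite Y" and J: "finite J" "2 * T \<le> \<delta> * card J" "T \<le> card J" and T: "T > 0"
    and dense: "\<And>x. x \<in> J \<Longrightarrow> \<delta> * card Y \<le> card {y \<in> Y. R x y}"
  shows "\<exists>S\<subseteq>J. card S = T \<and> \<delta> / (2 * 2 ^ card J) * card Y \<le> card {y \<in> Y. \<forall>x\<in>S. R x y}"
proof -
  define deg where "deg = (\<lambda>y. card {x \<in> J. R x y})"
  define Y' where "Y' = {y \<in> Y. T \<le> deg y}"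
  have finY': "finite Y'" using Y by (simp add: Y'_def)
  have "J \<noteq> {}" using J T by auto
  then have cJ: "real (card J) > 0" using J by (simp add: card_gt_0_iff)
  have "\<delta> * card Y * card J \<le> (\<Sum>x\<in>J. real (card {y \<in> Y. R x y}))"
    using sum_mono[of J "\<lambda>_. \<delta> * card Y"] dense by (simp add: mult.commute)
  also have "\<dots> = (\<Sum>y\<in>Y. deg y)"
  proof -
    have "(\<Sum>x\<in>J. card {y \<in> Y. R x y}) = (\<Sum>y\<in>Y. deg y)"
      by (rule sum_multicount_gen) (use J Y in \<open>auto simp: deg_def\<close>)
    then show ?thesis by (simp only: of_nat_sum[symmetric])
  qed
  also have "\<dots> = (\<Sum>y\<in>Y'. deg y) + (\<Sum>y\<in>Y - Y'. deg y)"
    using sum.subset_diff[of Y' Y deg] Y by (simp add: Y'_def)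
  also have "\<dots> \<le> real (card Y' * card J + card Y * T)"
  proof -
    have "(\<Sum>y\<in>Y'. deg y) \<le> (\<Sum>y\<in>Y'. card J)"
      by (rule sum_mono) (auto simp: deg_def J intro: card_mono)
    moreover have "(\<Sum>y\<in>Y - Y'. deg y) \<le> (\<Sum>y\<in>Y - Y'. T)"
      by (rule sum_mono) (auto simp: Y'_def)
    moreover have "card (Y - Y') * T \<le> card Y * T" using Y by (intro mult_le_mono1 card_mono) auto
    ultimately have "(\<Sum>y\<in>Y'. deg y) + (\<Sum>y\<in>Y - Y'. deg y) \<le> card Y' * card J + card Y * T"
      unfolding sum_constant of_nat_id by linarith
    then show ?thesis by (simp only: of_nat_le_iff)
  qed
  finally have "\<delta> * card Y * card J \<le> real (card Y') * card J + card Y * T" by simp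
  moreover have "card Y * T * 2 \<le> card Y * (\<delta> * card J)"
    using mult_left_mono[OF J(2), of "card Y"] by (simp add: algebra_simps)
  ultimately have "(\<delta> / 2 * card Y) * card J \<le> real (card Y') * card J" by (simp add: algebra_simps)
  then have Y'_big: "\<delta> / 2 * card Y \<le> card Y'" using cJ by (rule mult_right_le_imp_le)
  have "\<exists>S. S \<subseteq> {x \<in> J. R x y} \<and> card S = T" if "y \<in> Y'" for y
    using that obtain_subset_with_card_n[of T "{x \<in> J. R x y}"] by (auto simp: Y'_def deg_def)
  then obtain f where f: "\<And>y. y \<in> Y' \<Longrightarrow> f y \<subseteq> {x \<in> J. R x y} \<and> card (f y) = T" by metis
  let ?P = "{S. S \<subseteq> J \<and> card S = T}"
  have finP: "finite ?P" using J by auto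
  obtain S0 where "S0 \<in> ?P" using obtain_subset_with_card_n[OF J(3)] by blast
  then have P0: "?P \<noteq> {}" by blast
  show ?thesis
  proof (rule ccontr)
    assume no: "\<not> ?thesis"
    let ?x = "\<delta> / (2 * 2 ^ card J) * card Y"
    have small: "real (card {y \<in> Y'. f y = S}) < ?x" if S: "S \<in> ?P" for S
    proof -
      have "{y \<in> Y'. f y = S} \<subseteq> {y \<in> Y. \<forall>x\<in>S. R x y}" using f by (auto simp: Y'_def)
      then have "card {y \<in> Y'. f y = S} \<le> card {y \<in> Y. \<forall>x\<in>S. R x y}" using Y by (intro card_mono) auto
      moreover have "real (card {y \<in> Y. \<forall>x\<in>S. R x y}) < ?x"
        using no S by (auto simp: not_le)
      ultimately show ?thesis by linarith
    qed
    have "real (card {y \<in> Y'. f y = S0}) < ?x" using small \<open>S0 \<in> ?P\<close> by blast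
    then have x0: "?x \<ge> 0" by linarith
    have "card Y' = (\<Sum>S\<in>?P. \<Sum>y\<in>{y \<in> Y'. f y = S}. 1)"
      using sum.group[OF finY' finP, of f "\<lambda>_. 1 :: nat"] f by force
    then have "real (card Y') = (\<Sum>S\<in>?P. real (card {y \<in> Y'. f y = S}))" by simp
    also have "\<dots> < (\<Sum>S\<in>?P. ?x)" using finP P0 small by (intro sum_strict_mono) auto
    also have "\<dots> = card ?P * ?x" by simp
    also have "\<dots> \<le> 2 ^ card J * ?x"
    proof (rule mult_right_mono[OF _ x0])
      have "card ?P \<le> card (Pow J)" using J by (intro card_mono) auto
      then show "real (card ?P) \<le> 2 ^ card J"
        using J(1) by (simp add: card_Pow)
    qed
    also have "\<dots> = \<delta> / 2 * card Y" by simp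
    finally show False using Y'_big by linarith
  qed
qed

section \<open>Complete multipartite structures in dense relations\<close>

text \<open>The theorem of Erdos that a dense \<open>r\<close>-ary relation contains a complete box
  with sides of size \<open>T\<close>, by induction on the arity. Among constantly many first
  coordinates with dense links, \<open>T\<close> share a dense set of tails, and the induction
  hypothesis is applied to these common tails.\<close>

lemma dense_lists_complete:
  fixes \<delta> :: real
  assumes "\<delta> > 0" "T > 0"
  shows "\<exists>n0. \<forall>(V :: 'b set) R. finite V \<longrightarrow> n0 \<le> card V \<longrightarrow>
    \<delta> * card V ^ r \<le> card {xs. set xs \<subseteq> V \<and> length xs = r \<and> R xs} \<longrightarrow>
    (\<exists>A. (\<forall>i<r. A i \<subseteq> V \<and> card (A i) = T) \<and>
       (\<forall>xs. length xs = r \<longrightarrow> (\<forall>i<r. xs ! i \<in> A i) \<longrightarrow> R xs))"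
  using assms(1)
proof (induction r arbitrary: \<delta>)
  case 0
  show ?case
  proof (intro exI[of _ 0] allI impI)
    fix V :: "'b set" and R
    assume *: "\<delta> * card V ^ 0 \<le> card {xs. set xs \<subseteq> V \<and> length xs = 0 \<and> R xs}"
    have "{xs. set xs \<subseteq> V \<and> length xs = 0 \<and> R xs} \<noteq> {}"
    proof
      assume e: "{xs. set xs \<subseteq> V \<and> length xs = 0 \<and> R xs} = {}"
      show False using * 0 unfolding e by simp
    qed
    then show "\<exists>A. (\<forall>i<0. A i \<subseteq> V \<and> card (A i) = T) \<and>
       (\<forall>xs. length xs = 0 \<longrightarrow> (\<forall>i<0. xs ! i \<in> A i) \<longrightarrow> R xs)" by auto
  qed
next
  case (Suc r)
  \<comment> \<open>With \<open>4 * T / \<delta>\<close> first coordinates,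
    \<open>dense_sets_common\<close> applies at density \<open>\<delta> / 2\<close>. As
    \<open>M\<close> is a constant, the pigeonhole loss \<open>2 ^ M\<close> in
    \<open>\<delta>'\<close> is one too.\<close>
  define M where "M = nat \<lceil>4 * T / \<delta>\<rceil> + T"
  define \<delta>' where "\<delta>' = \<delta> / 2 / (2 * 2 ^ M)"
  have \<delta>': "\<delta>' > 0" using Suc.prems by (simp add: \<delta>'_def)
  obtain n0 where n0: "\<And>(V :: 'b set) R. finite V \<Longrightarrow> n0 \<le> card V \<Longrightarrow>
    \<delta>' * card V ^ r \<le> card {xs. set xs \<subseteq> V \<and> length xs = r \<and> R xs} \<Longrightarrow>
    (\<exists>A. (\<forall>i<r. A i \<subseteq> V \<and> card (A i) = T) \<and>
       (\<forall>xs. length xs = r \<longrightarrow> (\<forall>i<r. xs ! i \<in> A i) \<longrightarrow> R xs))"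
    using Suc.IH[OF \<delta>'] by blast
  show ?case
  proof (intro exI[of _ "max (max n0 1) (nat \<lceil>2 * M / \<delta>\<rceil>)"] allI impI)
    fix V :: "'b set" and R
    assume V: "finite V" and n: "max (max n0 1) (nat \<lceil>2 * M / \<delta>\<rceil>) \<le> card V"
      and many: "\<delta> * card V ^ Suc r \<le> card {xs. set xs \<subseteq> V \<and> length xs = Suc r \<and> R xs}"
    let ?n = "real (card V)"
    have n': "n0 \<le> card V" "?n > 0" "2 * M / \<delta> \<le> ?n" using n by auto
    define L where "L = {xs. set xs \<subseteq> V \<and> length xs = r}"
    have L: "finite L" "card L = card V ^ r"
      using finite_lists_length_eq[OF V] card_lists_length_eq[OF V] by (auto simp: L_def)
    define deg where "deg = (\<lambda>x. card {xs \<in> L. R (x # xs)})"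
    have "{xs. set xs \<subseteq> V \<and> length xs = Suc r \<and> R xs} =
        (\<lambda>(x, xs). x # xs) ` (SIGMA x:V. {xs \<in> L. R (x # xs)})"
      by (auto simp: L_def length_Suc_conv image_iff)
    then have "card {xs. set xs \<subseteq> V \<and> length xs = Suc r \<and> R xs} = card (SIGMA x:V. {xs \<in> L. R (x # xs)})"
      by (simp add: card_image inj_on_def)
    also have "\<dots> = (\<Sum>x\<in>V. deg x)" using V L by (simp add: deg_def)
    finally have sumdeg: "\<delta> * ?n ^ Suc r \<le> (\<Sum>x\<in>V. real (deg x))" using many by simp
    define X where "X = {x \<in> V. \<delta> / 2 * ?n ^ r \<le> deg x}"
    have XV: "X \<subseteq> V" and finX: "finite X" using V by (auto simp: X_def)
    have "(\<Sum>x\<in>V. real (deg x)) = (\<Sum>x\<in>X. real (deg x)) + (\<Sum>x\<in>V - X. real (deg x))"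
      using sum.subset_diff[OF XV V, of "\<lambda>x. real (deg x)"] by simp
    moreover have "(\<Sum>x\<in>X. real (deg x)) \<le> card X * ?n ^ r"
    proof -
      have "real (deg x) \<le> ?n ^ r" for x
      proof -
        have "deg x \<le> card L" unfolding deg_def using L by (intro card_mono) auto
        then show ?thesis using L(2) by (metis of_nat_le_iff of_nat_power)
      qed
      then show ?thesis using sum_bounded_above[of X "\<lambda>x. real (deg x)" "?n ^ r"] by simp
    qed
    moreover have "(\<Sum>x\<in>V - X. real (deg x)) \<le> ?n * (\<delta> / 2 * ?n ^ r)"
    proof -
      have "(\<Sum>x\<in>V - X. real (deg x)) \<le> card (V - X) * (\<delta> / 2 * ?n ^ r)"
        by (rule sum_bounded_above) (auto simp: X_def)
      also have "\<dots> \<le> ?n * (\<delta> / 2 * ?n ^ r)"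
        using V Suc.prems by (intro mult_right_mono) (auto intro: card_mono)
      finally show ?thesis .
    qed
    ultimately have "\<delta> / 2 * ?n * ?n ^ r \<le> card X * ?n ^ r" using sumdeg by (simp add: algebra_simps)
    then have "\<delta> / 2 * ?n \<le> card X" by (rule mult_right_le_imp_le) (use n' in simp)
    moreover have "M \<le> \<delta> / 2 * ?n" using n'(3) Suc.prems by (simp add: field_simps)
    ultimately have "M \<le> card X" by linarith
    then obtain J where J: "J \<subseteq> X" "card J = M" "finite J" by (metis obtain_subset_with_card_n)
    have "\<exists>S\<subseteq>J. card S = T \<and> \<delta> / 2 / (2 * 2 ^ card J) * card L \<le> card {y \<in> L. \<forall>x\<in>S. R (x # y)}"
    proof -
      have "4 * T / \<delta> \<le> M" unfolding M_def by linarith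
      then have a: "2 * real T \<le> \<delta> / 2 * card J" using J Suc.prems by (simp add: field_simps)
      have b: "T \<le> card J" using J by (simp add: M_def)
      have c: "\<delta> / 2 * card L \<le> card {y \<in> L. R (x # y)}" if "x \<in> J" for x
        using that J L by (auto simp: X_def deg_def)
      show ?thesis
        using dense_sets_common[OF L(1) J(3) a b assms(2), of "\<lambda>x xs. R (x # xs)"] c by blast
    qed
    then obtain S where S: "S \<subseteq> J" "card S = T"
      "\<delta>' * ?n ^ r \<le> card {y \<in> L. \<forall>x\<in>S. R (x # y)}"
      using J L by (auto simp: \<delta>'_def)
    have "{y \<in> L. \<forall>x\<in>S. R (x # y)} = {xs. set xs \<subseteq> V \<and> length xs = r \<and> (\<forall>x\<in>S. R (x # xs))}"
      by (auto simp: L_def)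
    then obtain A where A: "\<And>i. i < r \<Longrightarrow> A i \<subseteq> V \<and> card (A i) = T"
       "\<And>xs. length xs = r \<Longrightarrow> \<forall>i<r. xs ! i \<in> A i \<Longrightarrow> \<forall>x\<in>S. R (x # xs)"
      using n0[OF V n'(1), of "\<lambda>xs. \<forall>x\<in>S. R (x # xs)"] S(3) by auto
    show "\<exists>A. (\<forall>i<Suc r. A i \<subseteq> V \<and> card (A i) = T) \<and>
       (\<forall>xs. length xs = Suc r \<longrightarrow> (\<forall>i<Suc r. xs ! i \<in> A i) \<longrightarrow> R xs)"
    proof (intro exI[of _ "case_nat S A"] conjI allI impI)
      fix i assume "i < Suc r"
      then show "(case i of 0 \<Rightarrow> S | Suc j \<Rightarrow> A j) \<subseteq> V" "card (case i of 0 \<Rightarrow> S | Suc j \<Rightarrow> A j) = T"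
        using S J XV A(1) by (auto split: nat.splits)
    next
      fix xs :: "'b list"
      assume xs: "length xs = Suc r" "\<forall>i<Suc r. xs ! i \<in> (case i of 0 \<Rightarrow> S | Suc j \<Rightarrow> A j)"
      then obtain x ys where x: "xs = x # ys" "length ys = r" by (auto simp: length_Suc_conv)
      have "x \<in> S" using xs(2) x by (auto dest: spec[of _ 0])
      moreover have "\<forall>i<r. ys ! i \<in> A i" using xs(2) x by (auto dest: spec[of _ "Suc _"])
      ultimately show "R xs" using A(2)[OF x(2)] x by blast
    qed
  qed
qed

lemma transversal_list:
  assumes "\<And>l. l < r \<Longrightarrow> A l \<noteq> {}" "i < r" "j < r" "u \<in> A i" "w \<in> A j" "i = j \<longrightarrow> u = w"
  shows "\<exists>xs. length xs = r \<and> (\<forall>l<r. xs ! l \<in> A l) \<and> xs ! i = u \<and> xs ! j = w"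
proof -
  let ?xs = "map (\<lambda>l. if l = i then u else if l = j then w else (SOME x. x \<in> A l)) [0..<r]"
  have "(SOME x. x \<in> A l) \<in> A l" if "l < r" for l using assms(1)[OF that] by (simp add: some_in_eq)
  then show ?thesis using assms by (intro exI[of _ ?xs]) auto
qed

text \<open>Any two vertices from different parts occur in a common list through all parts, and
  \<open>sorted_wrt adj\<close> makes the entries of such a list pairwise adjacent.\<close>

lemma clique_lists_complete:
  assumes A: "\<And>l. l < r \<Longrightarrow> A l \<noteq> {}"
    and xs: "\<And>xs. length xs = r \<Longrightarrow> \<forall>l<r. xs ! l \<in> A l \<Longrightarrow> sorted_wrt adj xs"
    and sym: "\<And>u v. adj u v \<Longrightarrow> adj v u"
    and uw: "i < r" "j < r" "i \<noteq> j" "u \<in> A i" "w \<in> A j"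
  shows "adj u w"
proof -
  obtain ys where ys: "length ys = r" "\<forall>l<r. ys ! l \<in> A l" "ys ! i = u" "ys ! j = w"
    using transversal_list[of r A i j u w] A uw by blast
  have "sorted_wrt adj ys" using xs ys by blast
  then show ?thesis
    using sorted_wrt_nth_less[of adj ys i j] sorted_wrt_nth_less[of adj ys j i] ys uw sym
    by (cases i j rule: linorder_cases) auto
qed

lemma card_cliques_le_lists:
  fixes V :: "'b set"
  assumes "finite V" "W \<subseteq> V"
  shows "card (cliques adj W r) \<le> card {xs \<in> {xs. set xs \<subseteq> V \<and> length xs = r}. set xs \<subseteq> W \<and> sorted_wrt adj xs}"
proof -
  have finW: "finite W" using assms finite_subset by blast
  have ex: "\<exists>xs. set xs = S \<and> distinct xs" if "S \<in> cliques adj W r" for S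
    using that finW finite_distinct_list[of S] by (auto simp: cliques_def dest: finite_subset)
  define f where "f = (\<lambda>S :: 'b set. SOME xs. set xs = S \<and> distinct xs)"
  have f: "set (f S) = S" "distinct (f S)" if "S \<in> cliques adj W r" for S
    using someI_ex[OF ex[OF that]] by (auto simp: f_def)
  show ?thesis
  proof (rule card_inj_on_le[where f = f])
    show "inj_on f (cliques adj W r)" using f by (metis inj_onI)
    show "f ` cliques adj W r \<subseteq> {xs \<in> {xs. set xs \<subseteq> V \<and> length xs = r}. set xs \<subseteq> W \<and> sorted_wrt adj xs}"
    proof
      fix xs assume "xs \<in> f ` cliques adj W r"
      then obtain S where S: "S \<in> cliques adj W r" "xs = f S" by blast
      have "length xs = r" using f[OF S(1)] S distinct_card[of xs] by (simp add: cliques_def)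
      moreover have "sorted_wrt adj xs"
        unfolding sorted_wrt_iff_nth_less
        using f[OF S(1)] S nth_eq_iff_index_eq[of xs] by (auto simp: cliques_def) (metis less_trans nat_neq_iff nth_mem)
      ultimately show "xs \<in> {xs \<in> {xs. set xs \<subseteq> V \<and> length xs = r}. set xs \<subseteq> W \<and> sorted_wrt adj xs}"
        using f[OF S(1)] S assms by (auto simp: cliques_def)
    qed
    have "finite {xs. set xs \<subseteq> V \<and> length xs = r}" using finite_lists_length_eq[OF assms(1)] .
    then show "finite {xs \<in> {xs. set xs \<subseteq> V \<and> length xs = r}. set xs \<subseteq> W \<and> sorted_wrt adj xs}"
      by (rule rev_finite_subset) blast
  qed
qed

section \<open>Maximal families of triggers\<close>

text \<open>Triggers are chosen greedily with both vertices outside all earlier hyperedges; a new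
  hyperedge differs from the earlier ones because it contains new vertices. If the choice stops
  early, the hyperedges chosen so far form \<open>\<E>\<close>, and every trigger has a vertex in
  their union. The hyperedges themselves may overlap.\<close>

lemma trigger_sequence:
  assumes Q: "\<And>y z e. Q y z e \<Longrightarrow> y \<in> e \<and> z \<in> e \<and> y \<noteq> z"
  shows "(\<exists>y z e. (\<forall>i<m. Q (y i) (z i) (e i)) \<and> inj_on y {..<m} \<and> inj_on z {..<m} \<and>
        y ` {..<m} \<inter> z ` {..<m} = {} \<and> inj_on e {..<m}) \<or>
    (\<exists>\<E>. finite \<E> \<and> card \<E> < m \<and> (\<forall>e\<in>\<E>. \<exists>y z. Q y z e) \<and>
      (\<forall>y z e. Q y z e \<longrightarrow> y \<in> \<Union>\<E> \<or> z \<in> \<Union>\<E>))"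
proof (induction m)
  case 0 then show ?case by simp
next
  case (Suc m)
  from Suc show ?case
  proof (elim disjE exE conjE)
    fix y z e
    assume S: "\<forall>i<m. Q (y i) (z i) (e i)" "inj_on y {..<m}" "inj_on z {..<m}"
      "y ` {..<m} \<inter> z ` {..<m} = {}" "inj_on e {..<m}"
    let ?E = "e ` {..<m}"
    show ?thesis
    proof (cases "\<forall>y z h. Q y z h \<longrightarrow> y \<in> \<Union>?E \<or> z \<in> \<Union>?E")
      case True
      moreover have "card ?E < Suc m" using card_image_le[of "{..<m}" e] by simp
      moreover have "\<forall>h\<in>?E. \<exists>y z. Q y z h" using S(1) by blast
      ultimately show ?thesis by (intro disjI2 exI[of _ ?E] conjI) simp_all
    next
      case False
      then obtain y' z' e' where n: "Q y' z' e'" "y' \<notin> \<Union>?E" "z' \<notin> \<Union>?E" by blast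
      have in_e: "y i \<in> \<Union>?E" "z i \<in> \<Union>?E" if "i < m" for i using S(1) Q that by blast+
      have "e' \<notin> ?E" using n Q by blast
      let ?y = "y(m := y')" and ?z = "z(m := z')" and ?e = "e(m := e')"
      have img: "?y ` {..<m} = y ` {..<m}" "?z ` {..<m} = z ` {..<m}" "?e ` {..<m} = e ` {..<m}"
        by (auto intro!: image_cong)
      have "\<forall>i<Suc m. Q (?y i) (?z i) (?e i)" using S(1) n(1) by (simp add: less_Suc_eq)
      moreover have "inj_on ?y {..<Suc m}" "inj_on ?z {..<Suc m}" "inj_on ?e {..<Suc m}"
        using S n in_e \<open>e' \<notin> ?E\<close> by (fastforce simp: inj_on_def less_Suc_eq)+
      moreover have "?y ` {..<Suc m} \<inter> ?z ` {..<Suc m} = {}"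
      proof -
        have "y' \<notin> z ` {..<m}" "z' \<notin> y ` {..<m}" using n(2,3) in_e by blast+
        then show ?thesis using S(4) Q[OF n(1)] unfolding lessThan_Suc image_insert img by auto
      qed
      ultimately show ?thesis by blast
    qed
  next
    fix \<E> assume "finite \<E>" "card \<E> < m" "\<forall>e\<in>\<E>. \<exists>y z. Q y z e" "\<forall>y z e. Q y z e \<longrightarrow> y \<in> \<Union>\<E> \<or> z \<in> \<Union>\<E>"
    then show ?thesis by (intro disjI2 exI[of _ \<E>]) auto
  qed
qed

lemma card_Union_bounded:
  assumes "finite \<E>" "\<And>e. e \<in> \<E> \<Longrightarrow> card e \<le> k"
  shows "card (\<Union>\<E>) \<le> card \<E> * k"
  using card_UN_le[OF assms(1), of "\<lambda>e. e"] sum_bounded_above[of \<E> card k] assms by simp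

section \<open>The heavy graph\<close>

locale berge_problem = critical_graph F r s a b gr
  for F :: "'a hypergraph" and r s and a b :: "nat \<Rightarrow> 'a" and gr +
  fixes k :: nat
  assumes k3: "3 \<le> k" and kr: "k \<le> r" and s1: "1 \<le> s"
begin

text \<open>A pair in \<open>L\<close> hyperedges still has a free one after all other edges of
  \<open>F\<close> and \<open>s\<close> prescribed hyperedges have been served.\<close>

definition "L = card (hedges F) + s"
text \<open>The size that suffices in \<open>trigger_embedding\<close> for completely joined parts:
  room for all vertices of \<open>F\<close> beside at most \<open>2 * s\<close> trigger
  vertices.\<close>

definition "t = 2 * s + card (verts F)"
text \<open>\<open>c0 * n ^ (k - 1)\<close> is asymptotically the number of \<open>k\<close>-cliques of \<open>T(n, r)\<close> at a vertex.\<close>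
definition "c0 = real (r - 1 choose (k - 1)) / real r ^ (k - 1)"

definition free_system :: "'b set \<Rightarrow> 'b set set \<Rightarrow> bool" where
  "free_system V E \<longleftrightarrow> finite V \<and> E \<subseteq> Pow V \<and> (\<forall>e\<in>E. card e = k) \<and> Berge_free F (V, E)"

definition min_degree_cond :: "real \<Rightarrow> 'b set \<Rightarrow> 'b set set \<Rightarrow> bool" where
  "min_degree_cond \<delta> V E \<longleftrightarrow> (\<forall>v\<in>V. (c0 - \<delta>) * card V ^ (k - 1) \<le> card {e \<in> E. v \<in> e})"

abbreviation "adj \<equiv> heavy L"

definition nbrs :: "'b set set \<Rightarrow> 'b set \<Rightarrow> 'b \<Rightarrow> 'b set" where
  "nbrs E X v = {w \<in> X. adj E v w}"

lemma free_systemD: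
  assumes "free_system V E"
  shows "finite V" "finite E" "hypergraph (V, E)" "\<And>e. e \<in> E \<Longrightarrow> e \<subseteq> V" "\<And>e. e \<in> E \<Longrightarrow> card e = k"
    "\<And>e. e \<in> E \<Longrightarrow> finite e"
proof -
  show V: "finite V" and "hypergraph (V, E)" and sub: "\<And>e. e \<in> E \<Longrightarrow> e \<subseteq> V" and "\<And>e. e \<in> E \<Longrightarrow> card e = k"
    using assms by (auto simp: free_system_def hypergraph_def)
  have "E \<subseteq> Pow V" using sub by blast
  then show "finite E" using V by (simp add: finite_subset)
  show "finite e" if "e \<in> E" for e using sub[OF that] V by (rule finite_subset)
qed

lemma r_pos: "r > 0" using k3 kr by simp

lemma finite_nbrs: "finite X \<Longrightarrow> finite (nbrs E X v)"
  by (simp add: nbrs_def)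

lemma adj_hyperedge:
  assumes "adj E u w" obtains e where "e \<in> E" "u \<in> e" "w \<in> e"
proof -
  have "0 < card {e \<in> E. u \<in> e \<and> w \<in> e}" using assms s1 by (simp add: heavy_def L_def)
  then have "{e \<in> E. u \<in> e \<and> w \<in> e} \<noteq> {}" by (metis card.empty less_irrefl)
  then show ?thesis using that by blast
qed

section \<open>Exceptional vertices and heavy degrees\<close>

text \<open>\<open>s\<close> vertices of \<open>X\<close> would be apexes for all critical edges at
  once. The parts are completely joined, so \<open>D = 0\<close> and bounded parts already have room
  for \<open>F\<close>.\<close>

lemma complete_no_apexes:
  assumes fs: "free_system V E"
    and A: "\<And>j. j < r \<Longrightarrow> A j \<subseteq> V \<and> t \<le> card (A j)"
    and cpl: "\<And>i j u w. i < r \<Longrightarrow> j < r \<Longrightarrow> i \<noteq> j \<Longrightarrow> u \<in> A i \<Longrightarrow> w \<in> A j \<Longrightarrow> adj E u w"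
    and X: "X \<subseteq> V" "\<And>x j. x \<in> X \<Longrightarrow> j < r \<Longrightarrow> t \<le> card (nbrs E (A j) x)"
  shows "card X < s"
proof (rule ccontr)
  assume "\<not> ?thesis"
  then have "s \<le> card X" by simp
  then obtain Y where Y: "Y \<subseteq> X" "card Y = s" "finite Y" by (rule obtain_subset_with_card_n)
  obtain y where y: "bij_betw y {..<s} Y"
    using ex_bij_betw_nat_finite[OF Y(3)] Y(2) by (auto simp: atLeast0LessThan)
  have "\<not> Berge_free F (V, E)"
  proof (rule trigger_embedding[where I = "{..<s}" and y = y and P = A and D = 0 and M = t])
    show "card {w \<in> A j. \<not> adj E u w} \<le> 0" if "i < r" "j < r" "i \<noteq> j" "u \<in> A i" for i j u
    proof -
      have e: "{w \<in> A j. \<not> adj E u w} = {}" using cpl that by blast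
      show ?thesis unfolding e by simp
    qed
    show "t \<le> card {w \<in> A j. adj E (y i) w}" if "i \<in> {..<s}" "j < r" for i j
      using X(2)[of "y i" j] y Y that by (auto simp: nbrs_def bij_betw_def)
    show "y ` {..<s} \<subseteq> V" using y Y X by (auto simp: bij_betw_def)
    show "inj_on y {..<s}" using y by (simp add: bij_betw_def)
  qed (use A free_systemD(3)[OF fs] r_pos in \<open>simp_all add: L_def t_def\<close>)
  then show False using fs by (simp add: free_system_def)
qed

text \<open>Too many such vertices would include \<open>s\<close> whose neighbourhoods share a
  positive proportion of all \<open>r\<close>-lists as cliques. These contain a complete
  \<open>r\<close>-partite graph inside the common neighbourhood, against
  \<open>complete_no_apexes\<close>.\<close>

lemma few_dense_neighbourhoods:
  fixes \<delta> :: real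
  assumes "\<delta> > 0"
  shows "\<exists>M n0. \<forall>(V :: 'b set) E. free_system V E \<longrightarrow> n0 \<le> card V \<longrightarrow>
    card {v \<in> V. \<delta> * card V ^ r \<le> card (cliques (adj E) (nbrs E V v) r)} \<le> M"
proof -
  define M where "M = nat \<lceil>2 * s / \<delta>\<rceil> + s"
  define \<delta>' where "\<delta>' = \<delta> / (2 * 2 ^ M)"
  have \<delta>': "\<delta>' > 0" using assms by (simp add: \<delta>'_def)
  have t0: "t > 0" using s1 by (simp add: t_def)
  obtain n0 where n0: "\<And>(V :: 'b set) R. finite V \<Longrightarrow> n0 \<le> card V \<Longrightarrow>
    \<delta>' * card V ^ r \<le> card {xs. set xs \<subseteq> V \<and> length xs = r \<and> R xs} \<Longrightarrow>
    (\<exists>A. (\<forall>i<r. A i \<subseteq> V \<and> card (A i) = t) \<and>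
       (\<forall>xs. length xs = r \<longrightarrow> (\<forall>i<r. xs ! i \<in> A i) \<longrightarrow> R xs))"
    using dense_lists_complete[OF \<delta>' t0, of r] by blast
  show ?thesis
  proof (rule exI[of _ M], rule exI[of _ n0], intro allI impI)
    fix V :: "'b set" and E
    assume fs: "free_system V E" and n: "n0 \<le> card V"
    let ?X = "{v \<in> V. \<delta> * card V ^ r \<le> card (cliques (adj E) (nbrs E V v) r)}"
    note finV = free_systemD(1)[OF fs]
    show "card ?X \<le> M"
    proof (rule ccontr)
      assume "\<not> ?thesis"
      then have "M \<le> card ?X" by simp
      then obtain J where J: "J \<subseteq> ?X" "card J = M" "finite J"
        by (rule obtain_subset_with_card_n)
      define Y where "Y = {xs. set xs \<subseteq> V \<and> length xs = r}"
      have Y: "finite Y" "card Y = card V ^ r"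
        using finite_lists_length_eq[OF finV] card_lists_length_eq[OF finV] by (auto simp: Y_def)
      define R where "R = (\<lambda>v xs. set xs \<subseteq> nbrs E V v \<and> sorted_wrt (adj E) xs)"
      have "2 * s / \<delta> \<le> M" unfolding M_def by linarith
      then have a: "2 * real s \<le> \<delta> * card J" using assms J by (simp add: field_simps)
      have b: "s \<le> card J" using J by (simp add: M_def)
      have d: "\<delta> * card Y \<le> card {xs \<in> Y. R v xs}" if "v \<in> J" for v
      proof -
        have "\<delta> * card Y \<le> card (cliques (adj E) (nbrs E V v) r)" using that J Y by auto
        also have "\<dots> \<le> card {xs \<in> Y. R v xs}"
          using card_cliques_le_lists[OF finV, of "nbrs E V v" "adj E" r]
          by (simp add: Y_def R_def nbrs_def)
        finally show ?thesis by simp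
      qed
      have s0: "0 < s" using s1 by simp
      obtain S where S: "S \<subseteq> J" "card S = s" "\<delta>' * card Y \<le> card {xs \<in> Y. \<forall>v\<in>S. R v xs}"
        using dense_sets_common[OF Y(1) J(3) a b s0, of R] d J(2) unfolding \<delta>'_def by blast
      have "{xs \<in> Y. \<forall>v\<in>S. R v xs} = {xs. set xs \<subseteq> V \<and> length xs = r \<and> (\<forall>v\<in>S. R v xs)}"
        by (auto simp: Y_def)
      then obtain A where A: "\<And>i. i < r \<Longrightarrow> A i \<subseteq> V \<and> card (A i) = t"
         "\<And>xs. length xs = r \<Longrightarrow> \<forall>i<r. xs ! i \<in> A i \<Longrightarrow> \<forall>v\<in>S. R v xs"
        using n0[OF finV n, of "\<lambda>xs. \<forall>v\<in>S. R v xs"] S(3) Y by auto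
      have ne: "A l \<noteq> {}" if "l < r" for l using A(1)[OF that] t0 by auto
      have "S \<noteq> {}" using S s0 by auto
      have "card S < s"
      proof (rule complete_no_apexes[OF fs])
        show "A j \<subseteq> V \<and> t \<le> card (A j)" if "j < r" for j using A(1)[OF that] by simp
        show "adj E u w" if "i < r" "j < r" "i \<noteq> j" "u \<in> A i" "w \<in> A j" for i j u w
        proof (rule clique_lists_complete[OF ne _ _ that])
          show "sorted_wrt (adj E) xs" if "length xs = r" "\<forall>l<r. xs ! l \<in> A l" for xs
            using A(2)[OF that] \<open>S \<noteq> {}\<close> by (auto simp: R_def)
        qed (auto intro: heavy_sym)
        show "S \<subseteq> V" using S J by auto
        show "t \<le> card (nbrs E (A j) x)" if "x \<in> S" "j < r" for x j
        proof -
          have "w \<in> nbrs E V x" if w: "w \<in> A j" for w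
          proof -
            obtain xs where xs: "length xs = r" "\<forall>l<r. xs ! l \<in> A l" "xs ! j = w"
              using transversal_list[of r A j j w w] ne w \<open>j < r\<close> by blast
            then have "set xs \<subseteq> nbrs E V x" using A(2)[OF xs(1,2)] \<open>x \<in> S\<close> by (auto simp: R_def)
            then show ?thesis using xs \<open>j < r\<close> by (metis nth_mem subsetD)
          qed
          then have "nbrs E (A j) x = A j" by (auto simp: nbrs_def)
          then show ?thesis using A(1)[OF that(2)] by simp
        qed
      qed
      then show False using S by simp
    qed
  qed
qed

text \<open>At most \<open>card V ^ 2\<close> pairs are light and each lies in fewer than
  \<open>L\<close> hyperedges, so at most \<open>L * card V ^ 2\<close> hyperedges contain one.
  Since \<open>k - 1 \<ge> 2\<close>, only constantly many vertices can have a positive proportion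
  of \<open>card V ^ (k - 1)\<close> of them.\<close>

lemma few_light_vertices:
  fixes \<delta> :: real
  assumes "\<delta> > 0"
  shows "\<exists>C. \<forall>(V :: 'b set) E. free_system V E \<longrightarrow>
    card {v \<in> V. \<delta> * card V ^ (k - 1) \<le> card {e \<in> E. v \<in> e \<and> (\<exists>u\<in>e. \<exists>w\<in>e. u \<noteq> w \<and> \<not> adj E u w)}} \<le> C"
proof (intro exI[of _ "nat \<lceil>k * L / \<delta>\<rceil>"] allI impI)
  fix V :: "'b set" and E
  assume fs: "free_system V E"
  note H = free_systemD[OF fs]
  let ?n = "real (card V)"
  define B where "B = {e \<in> E. \<exists>u\<in>e. \<exists>w\<in>e. u \<noteq> w \<and> \<not> adj E u w}"
  define X where "X = {v \<in> V. \<delta> * card V ^ (k - 1) \<le> card {e \<in> E. v \<in> e \<and> (\<exists>u\<in>e. \<exists>w\<in>e. u \<noteq> w \<and> \<not> adj E u w)}}"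
  have finB: "finite B" and finX: "finite X" and XV: "X \<subseteq> V" using H by (auto simp: B_def X_def)
  have "card X \<le> nat \<lceil>k * L / \<delta>\<rceil>"
  proof (cases "X = {}")
    case False
    then have n: "?n \<ge> 1" using XV H(1) by (metis Suc_leI card_gt_0_iff of_nat_1 of_nat_le_iff One_nat_def subset_empty)
    define Q where "Q = {p \<in> V \<times> V. fst p \<noteq> snd p \<and> \<not> adj E (fst p) (snd p)}"
    define h where "h = (\<lambda>p. {e \<in> E. fst p \<in> e \<and> snd p \<in> e})"
    have finQ: "finite Q" using H by (simp add: Q_def)
    have "B \<subseteq> (\<Union>p\<in>Q. h p)"
    proof
      fix e assume "e \<in> B"
      then obtain u w where "e \<in> E" "u \<in> e" "w \<in> e" "u \<noteq> w" "\<not> adj E u w" by (auto simp: B_def)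
      then have "(u, w) \<in> Q" "e \<in> h (u, w)" using H(4)[of e] by (auto simp: Q_def h_def)
      then show "e \<in> (\<Union>p\<in>Q. h p)" by blast
    qed
    then have "card B \<le> card (\<Union>p\<in>Q. h p)" using finQ H by (intro card_mono) (auto simp: h_def)
    also have "\<dots> \<le> (\<Sum>p\<in>Q. card (h p))" by (rule card_UN_le[OF finQ])
    also have "\<dots> \<le> (\<Sum>p\<in>Q. L)"
      by (rule sum_mono) (auto simp: Q_def h_def heavy_def not_le)
    also have "\<dots> = card Q * L" by simp
    also have "\<dots> \<le> (card V * card V) * L"
      using card_mono[of "V \<times> V" Q] H by (intro mult_le_mono1) (auto simp: Q_def card_cartesian_product)
    finally have cB: "card B \<le> card V * card V * L" .
    have "card X * (\<delta> * ?n ^ (k - 1)) \<le> (\<Sum>v\<in>X. real (card {e \<in> B. v \<in> e}))"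
    proof -
      have "{e \<in> E. v \<in> e \<and> (\<exists>u\<in>e. \<exists>w\<in>e. u \<noteq> w \<and> \<not> adj E u w)} = {e \<in> B. v \<in> e}" for v
        by (auto simp: B_def)
      then have "\<delta> * ?n ^ (k - 1) \<le> card {e \<in> B. v \<in> e}" if "v \<in> X" for v
        using that by (auto simp: X_def)
      then show ?thesis using sum_mono[of X "\<lambda>_. \<delta> * ?n ^ (k - 1)"] by simp
    qed
    also have "\<dots> \<le> (\<Sum>v\<in>V. real (card {e \<in> B. v \<in> e}))"
      using XV H by (intro sum_mono2) auto
    also have "\<dots> = real (\<Sum>e\<in>B. k)"
    proof -
      have "(\<Sum>v\<in>V. card {e \<in> B. v \<in> e}) = (\<Sum>e\<in>B. k)"
      proof (rule sum_multicount_gen)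
        show "\<forall>e\<in>B. card {v \<in> V. v \<in> e} = k"
        proof
          fix e assume "e \<in> B"
          then have e: "e \<in> E" by (simp add: B_def)
          have "{v \<in> V. v \<in> e} = e" using H(4)[OF e] by blast
          then show "card {v \<in> V. v \<in> e} = k" using H(5)[OF e] by simp
        qed
      qed (use H finB in auto)
      then show ?thesis by (simp only: of_nat_sum[symmetric])
    qed
    also have "\<dots> = real k * card B" by simp
    also have "\<dots> \<le> k * (?n * ?n * L)"
    proof -
      have "real (card B) \<le> real (card V * card V * L)" using cB by (simp only: of_nat_le_iff)
      then show ?thesis by (intro mult_left_mono) auto
    qed
    also have "\<dots> \<le> k * (?n ^ (k - 1) * L)"
    proof -
      have "?n ^ 2 \<le> ?n ^ (k - 1)" using n k3 by (intro power_increasing) auto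
      then show ?thesis by (intro mult_left_mono mult_right_mono) (auto simp: power2_eq_square)
    qed
    finally have "(card X * \<delta>) * ?n ^ (k - 1) \<le> (k * L) * ?n ^ (k - 1)" by (simp add: mult_ac)
    then have "card X * \<delta> \<le> k * L" using n by (auto dest: mult_right_le_imp_le)
    then have "card X \<le> k * L / \<delta>" using assms by (simp add: field_simps)
    then show ?thesis by linarith
  qed simp
  then show "card {v \<in> V. \<delta> * card V ^ (k - 1) \<le> card {e \<in> E. v \<in> e \<and> (\<exists>u\<in>e. \<exists>w\<in>e. u \<noteq> w \<and> \<not> adj E u w)}}
      \<le> nat \<lceil>k * L / \<delta>\<rceil>"
    by (simp add: X_def)
qed

lemma finite_graph_adj: "finite W \<Longrightarrow> finite_graph (adj E) W"
  by unfold_locales (auto intro: heavy_sym)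

text \<open>Outside two bounded sets of vertices, the hyperedges at \<open>v\<close> give almost
  Turan-many \<open>(k - 1)\<close>-cliques in its heavy neighbourhood while
  \<open>r\<close>-cliques are sparse there. Then \<open>few_vertices_many_cliques\<close>, used
  with \<open>r - 1\<close> and \<open>k - 1\<close>, excludes a small neighbourhood. One half of
  \<open>\<delta>1\<close> pays for the missing degree, the other for the hyperedges with light
  pairs.\<close>

lemma almost_all_degrees:
  fixes \<epsilon> :: real
  assumes \<epsilon>: "\<epsilon> > 0"
  shows "\<exists>\<delta>>0. \<exists>n0. \<forall>(V :: 'b set) E. free_system V E \<longrightarrow> min_degree_cond \<delta> V E \<longrightarrow> n0 \<le> card V \<longrightarrow>
    card {v \<in> V. card (nbrs E V v) < (1 - 1 / r - \<epsilon>) * card V} \<le> \<epsilon> * card V"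
proof -
  have K: "1 \<le> k - 1" "k - 1 \<le> r - 1" and R: "r - 1 + 1 = r" "real (r - 1) + 1 = r"
    using k3 kr by auto
  have "\<exists>\<delta>>0. \<forall>(adj :: 'b \<Rightarrow> 'b \<Rightarrow> bool) W (n :: real). finite_graph adj W \<longrightarrow> n > 0 \<longrightarrow>
    card W \<le> (1 - 1 / r - \<epsilon>) * n \<longrightarrow> (c0 - \<delta>) * n ^ (k - 1) \<le> card (cliques adj W (k - 1)) \<longrightarrow>
    \<delta> * n ^ r \<le> card (cliques adj W r)"
    using few_vertices_many_cliques[OF K \<epsilon>, where 'b = 'b] unfolding R c0_def[symmetric] by (simp only: R c0_def of_nat_power)
  then obtain \<delta>1 where \<delta>1: "\<delta>1 > 0" and many: "\<And>(adj :: 'b \<Rightarrow> 'b \<Rightarrow> bool) W (n :: real). finite_graph adj W \<Longrightarrow> n > 0 \<Longrightarrow>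
    card W \<le> (1 - 1 / r - \<epsilon>) * n \<Longrightarrow> (c0 - \<delta>1) * n ^ (k - 1) \<le> card (cliques adj W (k - 1)) \<Longrightarrow>
    \<delta>1 * n ^ r \<le> card (cliques adj W r)"
    by blast
  have \<delta>2: "\<delta>1 / 2 > 0" using \<delta>1 by simp
  obtain C where C: "\<And>(V :: 'b set) E. free_system V E \<Longrightarrow>
    card {v \<in> V. \<delta>1 / 2 * card V ^ (k - 1) \<le> card {e \<in> E. v \<in> e \<and> (\<exists>u\<in>e. \<exists>w\<in>e. u \<noteq> w \<and> \<not> adj E u w)}} \<le> C"
    using few_light_vertices[OF \<delta>2, where 'b = 'b] by blast
  obtain M n0 where M: "\<And>(V :: 'b set) E. free_system V E \<Longrightarrow> n0 \<le> card V \<Longrightarrow>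
    card {v \<in> V. \<delta>1 * card V ^ r \<le> card (cliques (adj E) (nbrs E V v) r)} \<le> M"
    using few_dense_neighbourhoods[OF \<delta>1, where 'b = 'b] by blast
  show ?thesis
  proof (rule exI[of _ "\<delta>1 / 2"], rule conjI[OF \<delta>2], rule exI[of _ "max (max n0 1) (nat \<lceil>(C + M) / \<epsilon>\<rceil>)"], intro allI impI)
    fix V :: "'b set" and E
    assume fs: "free_system V E" and md: "min_degree_cond (\<delta>1 / 2) V E"
      and n: "max (max n0 1) (nat \<lceil>(C + M) / \<epsilon>\<rceil>) \<le> card V"
    note H = free_systemD[OF fs]
    let ?n = "real (card V)"
    have n': "n0 \<le> card V" "?n > 0" "(C + M) / \<epsilon> \<le> ?n" using n by auto
    let ?bad = "\<lambda>v. {e \<in> E. v \<in> e \<and> (\<exists>u\<in>e. \<exists>w\<in>e. u \<noteq> w \<and> \<not> adj E u w)}"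
    let ?X = "{v \<in> V. card (nbrs E V v) < (1 - 1 / r - \<epsilon>) * ?n}"
    let ?X1 = "{v \<in> V. \<delta>1 / 2 * ?n ^ (k - 1) \<le> card (?bad v)}"
    let ?X2 = "{v \<in> V. \<delta>1 * ?n ^ r \<le> card (cliques (adj E) (nbrs E V v) r)}"
    have "?X \<subseteq> ?X1 \<union> ?X2"
    proof
      fix v assume v: "v \<in> ?X"
      show "v \<in> ?X1 \<union> ?X2"
      proof (cases "v \<in> ?X1")
        case False
        let ?W = "nbrs E V v"
        have finW: "finite ?W" using H by (simp add: finite_nbrs)
        let ?G = "{e \<in> E. v \<in> e} - ?bad v"
        have img: "(\<lambda>e. e - {v}) ` ?G \<subseteq> cliques (adj E) ?W (k - 1)"
        proof
          fix S assume "S \<in> (\<lambda>e. e - {v}) ` ?G"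
          then obtain e where e: "e \<in> E" "v \<in> e" "\<And>u w. u \<in> e \<Longrightarrow> w \<in> e \<Longrightarrow> u \<noteq> w \<Longrightarrow> adj E u w" "S = e - {v}"
            by blast
          have "card S = k - 1" using H(5,6)[OF e(1)] e by simp
          moreover have "S \<subseteq> ?W" using H(4)[OF e(1)] e by (auto simp: nbrs_def)
          ultimately show "S \<in> cliques (adj E) ?W (k - 1)" using e by (auto simp: cliques_def)
        qed
        have inj: "inj_on (\<lambda>e. e - {v}) ?G" by (rule inj_onI) blast
        have "finite (cliques (adj E) ?W (k - 1))"
          using finite_graph.finite_cliques[OF finite_graph_adj[OF finW]] .
        then have "card ?G \<le> card (cliques (adj E) ?W (k - 1))" by (rule card_inj_on_le[OF inj img])
        moreover have "card ?G = card {e \<in> E. v \<in> e} - card (?bad v)"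
          using H by (intro card_Diff_subset) auto
        moreover have "(c0 - \<delta>1 / 2) * ?n ^ (k - 1) \<le> card {e \<in> E. v \<in> e}"
          using md v by (auto simp: min_degree_cond_def)
        moreover have "card (?bad v) < \<delta>1 / 2 * ?n ^ (k - 1)" using False v by auto
        ultimately have "(c0 - \<delta>1 / 2) * ?n ^ (k - 1) - \<delta>1 / 2 * ?n ^ (k - 1) \<le> card (cliques (adj E) ?W (k - 1))"
          by linarith
        then have c: "(c0 - \<delta>1) * ?n ^ (k - 1) \<le> card (cliques (adj E) ?W (k - 1))" by (simp add: algebra_simps)
        have "\<delta>1 * ?n ^ r \<le> card (cliques (adj E) ?W r)"
          by (rule many[OF finite_graph_adj[OF finW] n'(2) _ c]) (use v in auto)
        then show ?thesis using v by auto
      qed simp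
    qed
    then have "card ?X \<le> card (?X1 \<union> ?X2)" using H by (intro card_mono) auto
    also have "\<dots> \<le> C + M"
      using C[OF fs] M[OF fs n'(1)] card_Un_le[of ?X1 ?X2] by simp
    finally have "real (card ?X) \<le> C + M" by linarith
    also have "\<dots> \<le> \<epsilon> * ?n" using n'(3) \<epsilon> by (simp add: field_simps)
    finally show "real (card ?X) \<le> \<epsilon> * ?n" .
  qed
qed

text \<open>Cliques are built as lists inside \<open>V'\<close>: fewer than \<open>r\<close>
  vertices exclude at most \<open>(r - 1) * (1 / r + \<epsilon>) * card V\<close> vertices, so at
  least \<open>card V / (2 * r)\<close> choices remain for the next one. The resulting density of
  \<open>r\<close>-cliques yields the parts.\<close>

lemma complete_parts_exist:
  assumes T: "T > 0"
  shows "\<exists>n0. \<forall>(V :: 'b set) V' E (\<epsilon> :: real). finite V \<longrightarrow> n0 \<le> card V \<longrightarrow> V' \<subseteq> V \<longrightarrow> 0 < \<epsilon> \<longrightarrow> \<epsilon> \<le> 1 / (4 * r\<^sup>2) \<longrightarrow>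
    card (V - V') \<le> \<epsilon> * card V \<longrightarrow> (\<forall>v\<in>V'. (1 - 1 / r - \<epsilon>) * card V \<le> card (nbrs E V v)) \<longrightarrow>
    (\<exists>A. (\<forall>i<r. A i \<subseteq> V' \<and> card (A i) = T) \<and>
      (\<forall>i<r. \<forall>j<r. i \<noteq> j \<longrightarrow> (\<forall>u\<in>A i. \<forall>w\<in>A j. adj E u w)))"
proof -
  define \<delta> where "\<delta> = (1 / (2 * real r)) ^ r"
  have \<delta>: "\<delta> > 0" using r_pos by (simp add: \<delta>_def)
  obtain n0 where n0: "\<And>(V :: 'b set) R. finite V \<Longrightarrow> n0 \<le> card V \<Longrightarrow>
    \<delta> * card V ^ r \<le> card {xs. set xs \<subseteq> V \<and> length xs = r \<and> R xs} \<Longrightarrow>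
    (\<exists>A. (\<forall>i<r. A i \<subseteq> V \<and> card (A i) = T) \<and>
       (\<forall>xs. length xs = r \<longrightarrow> (\<forall>i<r. xs ! i \<in> A i) \<longrightarrow> R xs))"
    using dense_lists_complete[OF \<delta> T, of r] by blast
  show ?thesis
  proof (rule exI[of _ n0], intro allI impI)
    fix V V' :: "'b set" and E and \<epsilon> :: real
    assume V: "finite V" and n: "n0 \<le> card V" and V': "V' \<subseteq> V" and \<epsilon>: "0 < \<epsilon>" "\<epsilon> \<le> 1 / (4 * r\<^sup>2)"
      and few: "card (V - V') \<le> \<epsilon> * card V" and deg: "\<forall>v\<in>V'. (1 - 1 / r - \<epsilon>) * card V \<le> card (nbrs E V v)"
    let ?n = "real (card V)"
    define G where "G = (\<lambda>j. {xs. set xs \<subseteq> V \<and> length xs = j \<and> (set xs \<subseteq> V' \<and> sorted_wrt (adj E) xs)})"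
    have finG: "finite (G j)" for j
      using finite_lists_length_eq[OF V, of j] by (rule rev_finite_subset) (auto simp: G_def)
    define ext where "ext = (\<lambda>xs. {x \<in> V'. \<forall>y\<in>set xs. adj E x y})"
    have ext: "?n / (2 * r) \<le> card (ext xs)" if "xs \<in> G j" "j < r" for xs j
    proof -
      have xs: "set xs \<subseteq> V'" "length xs = j" using that by (auto simp: G_def)
      have sub: "V \<subseteq> ext xs \<union> (V - V') \<union> (\<Union>y\<in>set xs. V - nbrs E V y)"
        by (auto simp: ext_def nbrs_def dest: heavy_sym)
      have fe: "finite (ext xs)" using V V' by (auto simp: ext_def dest: finite_subset)
      have "card V \<le> card (ext xs \<union> (V - V') \<union> (\<Union>y\<in>set xs. V - nbrs E V y))"
        using V fe by (intro card_mono sub) auto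
      also have "\<dots> \<le> card (ext xs) + card (V - V') + card (\<Union>y\<in>set xs. V - nbrs E V y)"
        using card_Un_le[of "ext xs \<union> (V - V')" "\<Union>y\<in>set xs. V - nbrs E V y"] card_Un_le[of "ext xs" "V - V'"]
        by linarith
      finally have "?n \<le> card (ext xs) + card (V - V') + real (card (\<Union>y\<in>set xs. V - nbrs E V y))" by linarith
      moreover have "real (card (\<Union>y\<in>set xs. V - nbrs E V y)) \<le> (real r - 1) * ((1 / r + \<epsilon>) * ?n)"
      proof -
        have "real (card (\<Union>y\<in>set xs. V - nbrs E V y)) \<le> (\<Sum>y\<in>set xs. real (card (V - nbrs E V y)))"
          using card_UN_le[of "set xs" "\<lambda>y. V - nbrs E V y"] by (simp only: of_nat_sum[symmetric] of_nat_le_iff finite_set)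
        also have "\<dots> \<le> card (set xs) * ((1 / r + \<epsilon>) * ?n)"
        proof (rule sum_bounded_above)
          fix y assume "y \<in> set xs"
          then have "(1 - 1 / r - \<epsilon>) * ?n \<le> card (nbrs E V y)" using deg xs by blast
          moreover have "card (V - nbrs E V y) = card V - card (nbrs E V y)" "card (nbrs E V y) \<le> card V"
            using V by (auto simp: nbrs_def intro!: card_Diff_subset card_mono)
          ultimately show "real (card (V - nbrs E V y)) \<le> (1 / r + \<epsilon>) * ?n"
            by (simp add: of_nat_diff algebra_simps)
        qed
        also have "\<dots> \<le> (real r - 1) * ((1 / r + \<epsilon>) * ?n)"
        proof (rule mult_right_mono)
          have "card (set xs) \<le> j" using xs card_length[of xs] by simp
          then show "real (card (set xs)) \<le> real r - 1" using that(2) by linarith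
        qed (use \<epsilon> in auto)
        finally show ?thesis .
      qed
      ultimately have "?n \<le> card (ext xs) + \<epsilon> * ?n + (real r - 1) * ((1 / r + \<epsilon>) * ?n)" using few by linarith
      also have "\<dots> = card (ext xs) + (\<epsilon> * r + 1 - 1 / r) * ?n" using r_pos by (simp add: field_simps)
      finally have "(1 / r - \<epsilon> * r) * ?n \<le> card (ext xs)" by (simp add: algebra_simps)
      moreover have "1 / (2 * r) \<le> 1 / r - \<epsilon> * r"
      proof -
        have "\<epsilon> * r \<le> 1 / (4 * r\<^sup>2) * r" using \<epsilon> by (intro mult_right_mono) auto
        also have "\<dots> = 1 / (4 * r)" using r_pos by (simp add: power2_eq_square)
        finally show ?thesis using r_pos by (simp add: field_simps)
      qed
      then have "1 / (2 * r) * ?n \<le> (1 / r - \<epsilon> * r) * ?n" by (intro mult_right_mono) auto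
      ultimately show ?thesis by simp
    qed
    have "(?n / (2 * r)) ^ j \<le> card (G j)" if "j \<le> r" for j
      using that
    proof (induction j)
      case 0
      have "G 0 = {[]}" by (auto simp: G_def)
      then show ?case by simp
    next
      case (Suc j)
      have sub: "(\<lambda>(xs, x). x # xs) ` (SIGMA xs:G j. ext xs) \<subseteq> G (Suc j)"
        using V' by (auto simp: G_def ext_def)
      have "(?n / (2 * r)) ^ Suc j \<le> card (G j) * (?n / (2 * r))"
        using Suc mult_right_mono[of "(?n / (2 * r)) ^ j" "card (G j)" "?n / (2 * r)"] by (simp add: mult.commute)
      also have "\<dots> = (\<Sum>xs\<in>G j. ?n / (2 * r))" by simp
      also have "\<dots> \<le> (\<Sum>xs\<in>G j. real (card (ext xs)))" using ext Suc.prems by (intro sum_mono) auto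
      also have "\<dots> = card (SIGMA xs:G j. ext xs)"
      proof -
        have "finite (ext xs)" for xs using V V' by (auto simp: ext_def dest: finite_subset)
        then show ?thesis using finG by simp
      qed
      also have "\<dots> = card ((\<lambda>(xs, x). x # xs) ` (SIGMA xs:G j. ext xs))"
        by (subst card_image) (auto simp: inj_on_def)
      also have "\<dots> \<le> card (G (Suc j))" using card_mono[OF finG sub] by simp
      finally show ?case .
    qed
    from this[of r] have "\<delta> * ?n ^ r \<le> card (G r)" by (simp add: \<delta>_def power_divide power_mult_distrib mult.commute)
    from n0[OF V n this[unfolded G_def of_nat_power[symmetric]]] obtain A where
      A0: "(\<forall>i<r. A i \<subseteq> V \<and> card (A i) = T) \<and>
        (\<forall>xs. length xs = r \<longrightarrow> (\<forall>i<r. xs ! i \<in> A i) \<longrightarrow> set xs \<subseteq> V' \<and> sorted_wrt (adj E) xs)" ..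
    then have A: "\<And>i. i < r \<Longrightarrow> card (A i) = T"
      "\<And>xs. length xs = r \<Longrightarrow> \<forall>i<r. xs ! i \<in> A i \<Longrightarrow> set xs \<subseteq> V' \<and> sorted_wrt (adj E) xs"
      by simp_all
    have ne: "A l \<noteq> {}" if "l < r" for l using A(1)[OF that] T by auto
    show "\<exists>A. (\<forall>i<r. A i \<subseteq> V' \<and> card (A i) = T) \<and>
      (\<forall>i<r. \<forall>j<r. i \<noteq> j \<longrightarrow> (\<forall>u\<in>A i. \<forall>w\<in>A j. adj E u w))"
    proof (intro exI[of _ A] conjI allI impI ballI)
      fix i assume i: "i < r"
      show "card (A i) = T" using A(1)[OF i] by simp
      show "A i \<subseteq> V'"
      proof
        fix u assume u: "u \<in> A i"
        obtain xs where xs: "length xs = r" "\<forall>l<r. xs ! l \<in> A l" "xs ! i = u"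
          using transversal_list[of r A i i u u] ne u i by blast
        then show "u \<in> V'" using A(2)[OF xs(1,2)] i by (metis nth_mem subsetD)
      qed
    next
      fix i j u w assume "i < r" "j < r" "i \<noteq> j" "u \<in> A i" "w \<in> A j"
      note uw = this
      show "adj E u w"
      proof (rule clique_lists_complete[OF ne _ _ uw])
        show "sorted_wrt (adj E) xs" if "length xs = r" "\<forall>l<r. xs ! l \<in> A l" for xs
          using A(2)[OF that] by simp
      qed (auto intro: heavy_sym)
    qed
  qed
qed

end

lemma sum_remove_le:
  fixes f :: "nat \<Rightarrow> real"
  assumes "i < r" "\<And>j. j < r \<Longrightarrow> j \<noteq> i \<Longrightarrow> f j \<le> c"
  shows "(\<Sum>j<r. f j) \<le> f i + (real r - 1) * c"
proof -
  have "(\<Sum>j<r. f j) = f i + (\<Sum>j\<in>{..<r} - {i}. f j)" using assms(1) by (simp add: sum.remove)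
  also have "(\<Sum>j\<in>{..<r} - {i}. f j) \<le> card ({..<r} - {i}) * c"
    using assms(2) by (intro sum_bounded_above) auto
  also have "real (card ({..<r} - {i})) = real r - 1" using assms(1) by (simp add: of_nat_diff)
  finally show ?thesis by simp
qed

context berge_problem
begin

section \<open>The almost complete partition\<close>

text \<open>The classes need not cover \<open>V\<close>. In exchange the condition on hyperedges is
  exact: none meets a class twice, so no heavy pair lies inside a class.\<close>

definition core_partition :: "real \<Rightarrow> 'b set \<Rightarrow> 'b set set \<Rightarrow> (nat \<Rightarrow> 'b set) \<Rightarrow> bool" where
  "core_partition \<epsilon> V E P \<longleftrightarrow> (\<forall>j<r. P j \<subseteq> V \<and> (1 / r - \<epsilon>) * card V \<le> card (P j) \<and>
      card (P j) \<le> (1 / r + \<epsilon>) * card V \<and> (\<forall>i<r. i \<noteq> j \<longrightarrow> P i \<inter> P j = {}) \<and>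
      (\<forall>e\<in>E. \<forall>y\<in>P j \<inter> e. \<forall>z\<in>P j \<inter> e. y = z) \<and>
      (\<forall>v\<in>P j. real (card {w \<in> V - P j. \<not> adj E v w}) \<le> \<epsilon> * real (card V)))"

text \<open>Most vertices miss almost nothing of a fixed complete \<open>r\<close>-partite graph \<open>A\<close> of bounded
  size except for one part, which determines their class.\<close>
lemma classification_by_trace:
  fixes V :: "'b set" and T :: nat and \<epsilon> :: real
  assumes fs: "free_system V E" and \<epsilon>: "0 < \<epsilon>" and V': "V' \<subseteq> V" "card (V - V') \<le> \<epsilon> * card V"
    and deg: "\<And>v. v \<in> V' \<Longrightarrow> (1 - 1 / r - \<epsilon>) * card V \<le> card (nbrs E V v)"
    and A: "\<And>j. j < r \<Longrightarrow> A j \<subseteq> V' \<and> card (A j) = T"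
    and cpl: "\<And>i j u w. i < r \<Longrightarrow> j < r \<Longrightarrow> i \<noteq> j \<Longrightarrow> u \<in> A i \<Longrightarrow> w \<in> A j \<Longrightarrow> adj E u w"
    and T: "8 * t \<le> T" "t \<le> \<epsilon> * T" and n: "s \<le> \<epsilon> * card V"
  shows "\<exists>W. (\<forall>i<r. W i \<subseteq> V') \<and> card (V - (\<Union>i<r. W i)) \<le> (4 * r + 10) * \<epsilon> * card V \<and>
    (\<forall>i<r. \<forall>j<r. i \<noteq> j \<longrightarrow> W i \<inter> W j = {}) \<and>
    (\<forall>i<r. \<forall>j<r. i \<noteq> j \<longrightarrow> (\<forall>y\<in>W i. \<forall>z\<in>W i. t \<le> card {w \<in> A j. adj E y w \<and> adj E z w}))"
proof -
  note H = free_systemD[OF fs]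
  let ?n = "real (card V)"
  have t0: "t > 0" using s1 by (simp add: t_def)
  have T0: "real T > 0" using T t0 by simp
  have AV: "A j \<subseteq> V" if "j < r" for j using A[OF that] V' by blast
  have finA: "finite (A j)" if "j < r" for j using AV[OF that] H(1) finite_subset by blast
  define f where "f = (\<lambda>v j. card (nbrs E (A j) v))"
  have fT: "f v j \<le> T" if "j < r" for v j
    using card_mono[OF finA[OF that], of "nbrs E (A j) v"] A[OF that] by (auto simp: f_def nbrs_def)
  \<comment> \<open>From here \<open>F v\<close> is the number of heavy neighbours of
    \<open>v\<close> counted over all parts, no longer the forbidden graph. Double counting makes
    its average almost \<open>(r - 1) * T\<close>, while a vertex outside the small set
    \<open>X\<close> has fewer than \<open>t\<close> neighbours in some part and so exceeds this by
    less than \<open>t\<close>. Hence few vertices fall short by \<open>T / 4\<close>.\<close>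
  define F where "F = (\<lambda>v. \<Sum>j<r. real (f v j))"
  define X where "X = {v \<in> V. \<forall>j<r. t \<le> f v j}"
  have cX: "card X < s"
    by (rule complete_no_apexes[OF fs, of A]) (use AV A T cpl in \<open>auto simp: X_def f_def\<close>)
  define B where "B = {v \<in> V - X. F v < (real r - 1) * T - T / 4}"
  have finXB: "finite X" "finite B" using H by (auto simp: X_def B_def)
  have "(real r * T) * ((1 - 1 / r - \<epsilon>) * ?n) \<le> (\<Sum>v\<in>V. F v)"
  proof -
    have "(\<Sum>v\<in>V. F v) = (\<Sum>j<r. \<Sum>v\<in>V. real (f v j))" unfolding F_def by (rule sum.swap)
    also have "\<dots> = (\<Sum>j<r. \<Sum>a\<in>A j. real (card (nbrs E V a)))"
    proof (rule sum.cong[OF refl])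
      fix j assume "j \<in> {..<r}"
      then have "(\<Sum>v\<in>V. card {a \<in> A j. adj E v a}) = (\<Sum>a\<in>A j. card (nbrs E V a))"
        using H finA by (intro sum_multicount_gen)
          (auto simp: nbrs_def intro!: arg_cong[where f = card] intro: heavy_sym)
      then show "(\<Sum>v\<in>V. real (f v j)) = (\<Sum>a\<in>A j. real (card (nbrs E V a)))"
        by (simp add: f_def nbrs_def of_nat_sum[symmetric] del: of_nat_sum)
    qed
    also have "\<dots> \<ge> (\<Sum>j<r. \<Sum>a\<in>A j. (1 - 1 / r - \<epsilon>) * ?n)"
      by (intro sum_mono deg) (use A in blast)
    finally show ?thesis using A by simp
  qed
  moreover have "(real r * T) * ((1 - 1 / r - \<epsilon>) * ?n) = (real r - 1) * T * ?n - r * \<epsilon> * T * ?n"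
    using r_pos by (simp add: field_simps)
  moreover have "(\<Sum>v\<in>V. F v) \<le> ((real r - 1) * T + t) * ?n + T * card X - T / 4 * card B"
  proof -
    have "F v \<le> (real r - 1) * T + t + (if v \<in> X then real T else 0) - (if v \<in> B then T / 4 else 0)"
      if v: "v \<in> V" for v
    proof -
      consider "v \<in> X" "v \<notin> B" | "v \<in> B" "v \<notin> X" | "v \<notin> X" "v \<notin> B" by (auto simp: B_def)
      then show ?thesis
      proof cases
        case 1
        have "F v \<le> (\<Sum>j<r. real T)" unfolding F_def using fT by (intro sum_mono) auto
        then show ?thesis using 1 by (simp add: algebra_simps)
      next
        case 2
        then show ?thesis by (simp add: B_def)
      next
        case 3
        then obtain j where j: "j < r" "f v j < t" using v by (auto simp: X_def not_le)
        have "F v \<le> f v j + (real r - 1) * T" unfolding F_def using fT j by (intro sum_remove_le) auto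
        then show ?thesis using 3 j by simp
      qed
    qed
    then have "(\<Sum>v\<in>V. F v) \<le> (\<Sum>v\<in>V. (real r - 1) * T + t + (if v \<in> X then real T else 0) - (if v \<in> B then T / 4 else 0))"
      by (rule sum_mono)
    also have "\<dots> = ((real r - 1) * T + t) * ?n + T * card (V \<inter> X) - T / 4 * card (V \<inter> B)"
      using H(1) by (simp add: sum.distrib sum_subtractf sum.If_cases)
    also have "V \<inter> X = X" by (auto simp: X_def)
    also have "V \<inter> B = B" by (auto simp: B_def)
    finally show ?thesis .
  qed
  ultimately have "T / 4 * card B \<le> t * ?n + T * card X + r * \<epsilon> * T * ?n" by (simp add: algebra_simps)
  also have "\<dots> \<le> (\<epsilon> * T) * ?n + T * (\<epsilon> * ?n) + r * \<epsilon> * T * ?n"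
  proof -
    have "real (card X) \<le> \<epsilon> * ?n" using n cX by linarith
    then have "real T * card X \<le> T * (\<epsilon> * ?n)" by (intro mult_left_mono) auto
    moreover have "real t * ?n \<le> (\<epsilon> * T) * ?n" using T by (intro mult_right_mono) auto
    ultimately show ?thesis unfolding of_nat_mult by linarith
  qed
  also have "\<dots> = T / 4 * (4 * (real r + 2) * \<epsilon> * ?n)" by (simp add: algebra_simps)
  finally have cB: "card B \<le> 4 * (real r + 2) * \<epsilon> * ?n" using T0 by (simp add: mult_le_cancel_left)
  define W where "W = (\<lambda>i. {v \<in> V'. v \<notin> X \<and> v \<notin> B \<and> f v i < t})"
  \<comment> \<open>The total is at least \<open>(r - 1) * T - T / 4\<close>, of which part
    \<open>i\<close> contributes less than \<open>t\<close> and each remaining part at most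
    \<open>T\<close>.\<close>
  have fW: "3 / 4 * T - t \<le> f v j" if "i < r" "j < r" "i \<noteq> j" "v \<in> W i" for i j v
  proof -
    have F: "(real r - 1) * T - T / 4 \<le> F v" using that V' by (auto simp: W_def B_def)
    have "F v = f v j + (\<Sum>l\<in>{..<r} - {j}. real (f v l))"
      unfolding F_def by (rule sum.remove) (use that in auto)
    also have "(\<Sum>l\<in>{..<r} - {j}. real (f v l)) = f v i + (\<Sum>l\<in>{..<r} - {j} - {i}. real (f v l))"
      by (rule sum.remove) (use that in auto)
    also have "(\<Sum>l\<in>{..<r} - {j} - {i}. real (f v l)) \<le> card ({..<r} - {j} - {i}) * real T"
      using fT by (intro sum_bounded_above) auto
    also have "real (card ({..<r} - {j} - {i})) = real r - 2" using that by (simp add: of_nat_diff)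
    finally have "F v \<le> f v j + (f v i + (real r - 2) * T)" by simp
    moreover have "real (f v i) \<le> t" using that by (simp add: W_def)
    ultimately show ?thesis using F by (simp add: algebra_simps)
  qed
  have "card (V - (\<Union>i<r. W i)) \<le> (4 * r + 10) * \<epsilon> * ?n"
  proof -
    have "V - (\<Union>i<r. W i) \<subseteq> (V - V') \<union> X \<union> B" by (fastforce simp: W_def X_def not_le)
    then have "card (V - (\<Union>i<r. W i)) \<le> card ((V - V') \<union> X \<union> B)"
      using H finXB by (intro card_mono) auto
    also have "\<dots> \<le> card (V - V') + card X + card B"
      using card_Un_le[of "V - V' \<union> X" B] card_Un_le[of "V - V'" X] by linarith
    finally have "real (card (V - (\<Union>i<r. W i))) \<le> real (card (V - V')) + card X + card B" by linarith
    also have "\<dots> \<le> \<epsilon> * ?n + \<epsilon> * ?n + 4 * (real r + 2) * \<epsilon> * ?n"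
      using V' n cX cB by (intro add_mono) auto
    also have "\<dots> = (4 * r + 10) * \<epsilon> * ?n" by (simp add: algebra_simps)
    finally show ?thesis .
  qed
  moreover have "W i \<inter> W j = {}" if "i < r" "j < r" "i \<noteq> j" for i j
  proof -
    have False if v: "v \<in> W i" "v \<in> W j" for v
    proof -
      have "f v j < t" using v by (simp add: W_def)
      moreover have "3 / 4 * T - t \<le> f v j" using fW[of i j v] \<open>i < r\<close> \<open>j < r\<close> \<open>i \<noteq> j\<close> v by simp
      ultimately show False using T(1) by linarith
    qed
    then show ?thesis by blast
  qed
  moreover have "t \<le> card {w \<in> A j. adj E y w \<and> adj E z w}"
    if "i < r" "j < r" "i \<noteq> j" "y \<in> W i" "z \<in> W i" for i j y z
  proof -
    have eq: "{w \<in> A j. adj E y w \<and> adj E z w} = nbrs E (A j) y \<inter> nbrs E (A j) z" by (auto simp: nbrs_def)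
    have fin: "finite (nbrs E (A j) y)" "finite (nbrs E (A j) z)" using finA that by (auto simp: nbrs_def)
    have "card (nbrs E (A j) y \<union> nbrs E (A j) z) \<le> T"
      using card_mono[OF finA[OF that(2)], of "nbrs E (A j) y \<union> nbrs E (A j) z"] A[OF that(2)] by (auto simp: nbrs_def)
    then have "f y j + f z j \<le> T + card {w \<in> A j. adj E y w \<and> adj E z w}"
      using card_Un_Int[OF fin] by (simp add: eq f_def)
    \<comment> \<open>Two sets of size at least \<open>3 / 4 * T - t\<close> in a part of size
      \<open>T\<close> share at least \<open>T / 2 - 2 * t\<close> elements, which is at least
      \<open>t\<close> by \<open>8 * t \<le> T\<close>.\<close>
    then show ?thesis using fW[OF that(1-4)] fW[OF that(1-3,5)] T(1) by linarith
  qed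
  ultimately show ?thesis by (intro exI[of _ W]) (auto simp: W_def)
qed

text \<open>A hyperedge with two vertices in one \<open>W i\<close> is a pair trigger over the
  complete parts \<open>A\<close>, so the vertices \<open>U\<close> of fewer than \<open>s\<close>
  hyperedges meet all such pairs; dropping \<open>U\<close> makes the classes exact. Heavy
  neighbours of a vertex of \<open>P i\<close> then lie outside \<open>P i\<close>, so its degree
  bounds the class from above. As the classes cover almost everything, none can be much smaller than
  the others.\<close>

lemma core_partition_exists:
  fixes \<epsilon> :: real
  assumes "\<epsilon> > 0"
  shows "\<exists>\<delta>>0. \<exists>n0. \<forall>(V :: 'b set) E. free_system V E \<longrightarrow> min_degree_cond \<delta> V E \<longrightarrow> n0 \<le> card V \<longrightarrow>
    (\<exists>P. core_partition \<epsilon> V E P)"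
proof -
  \<comment> \<open>\<open>5 * r + 12\<close> is the multiple of \<open>\<epsilon>1\<close> lost in
    the final estimate \<open>miss\<close>. The bound \<open>1 / (4 * r\<^sup>2)\<close> is required
    by \<open>complete_parts_exist\<close>, and \<open>1 / 8\<close> turns
    \<open>t \<le> \<epsilon>1 * T\<close> into \<open>8 * t \<le> T\<close>.\<close>
  define \<epsilon>1 where "\<epsilon>1 = min (\<epsilon> / (5 * r + 12)) (min (1 / (4 * r\<^sup>2)) (1 / 8))"
  have r0: "real r > 0" using r_pos by simp
  have \<epsilon>1: "\<epsilon>1 > 0" "\<epsilon>1 \<le> \<epsilon> / (5 * r + 12)" "\<epsilon>1 \<le> 1 / (4 * r\<^sup>2)" "\<epsilon>1 \<le> 1 / 8"
  proof -
    have "\<epsilon> / (5 * r + 12) > 0" "1 / (4 * r\<^sup>2) > (0::real)" using assms r0 by simp_all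
    then show "\<epsilon>1 > 0" unfolding \<epsilon>1_def by simp
  qed (unfold \<epsilon>1_def, linarith+)
  have \<epsilon>2: "(5 * r + 12) * \<epsilon>1 \<le> \<epsilon>" using \<epsilon>1(2) r0 by (simp add: field_simps)
  define T where "T = nat \<lceil>t / \<epsilon>1\<rceil> + 1"
  have T0: "T > 0" by (simp add: T_def)
  have "t / \<epsilon>1 \<le> T" unfolding T_def by linarith
  then have tT: "t \<le> \<epsilon>1 * T" using \<epsilon>1 by (simp add: field_simps)
  also have "\<dots> \<le> 1 / 8 * T" using \<epsilon>1 by (intro mult_right_mono) auto
  finally have T8: "8 * t \<le> T" by linarith
  obtain \<delta> n1 where \<delta>: "\<delta> > 0" and n1: "\<And>(V :: 'b set) E. free_system V E \<Longrightarrow> min_degree_cond \<delta> V E \<Longrightarrow> n1 \<le> card V \<Longrightarrow>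
    card {v \<in> V. card (nbrs E V v) < (1 - 1 / r - \<epsilon>1) * card V} \<le> \<epsilon>1 * card V"
    using almost_all_degrees[OF \<epsilon>1(1), where 'b = 'b] by blast
  obtain n2 where n2: "\<forall>(V :: 'b set) V' E (\<epsilon> :: real). finite V \<longrightarrow> n2 \<le> card V \<longrightarrow> V' \<subseteq> V \<longrightarrow> 0 < \<epsilon> \<longrightarrow> \<epsilon> \<le> 1 / (4 * r\<^sup>2) \<longrightarrow>
    card (V - V') \<le> \<epsilon> * card V \<longrightarrow> (\<forall>v\<in>V'. (1 - 1 / r - \<epsilon>) * card V \<le> card (nbrs E V v)) \<longrightarrow>
    (\<exists>A. (\<forall>i<r. A i \<subseteq> V' \<and> card (A i) = T) \<and>
      (\<forall>i<r. \<forall>j<r. i \<noteq> j \<longrightarrow> (\<forall>u\<in>A i. \<forall>w\<in>A j. adj E u w)))"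
    using complete_parts_exist[OF T0, where 'b = 'b] ..
  show ?thesis
  proof (rule exI[of _ \<delta>], rule conjI[OF \<delta>], rule exI[of _ "max (max n1 n2) (nat \<lceil>s * k / \<epsilon>1\<rceil>)"], intro allI impI)
    fix V :: "'b set" and E
    assume fs: "free_system V E" and md: "min_degree_cond \<delta> V E"
      and n: "max (max n1 n2) (nat \<lceil>s * k / \<epsilon>1\<rceil>) \<le> card V"
    note H = free_systemD[OF fs]
    let ?n = "real (card V)"
    have n': "n1 \<le> card V" "n2 \<le> card V" "s * k / \<epsilon>1 \<le> ?n" using n by auto
    have skn: "s * k \<le> \<epsilon>1 * ?n" using n'(3) \<epsilon>1 by (simp add: field_simps)
    have "real s * 1 \<le> real s * real k" using k3 by (intro mult_left_mono) auto
    then have sn: "s \<le> \<epsilon>1 * ?n" using skn by simp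
    define V' where "V' = {v \<in> V. (1 - 1 / r - \<epsilon>1) * ?n \<le> card (nbrs E V v)}"
    have V': "V' \<subseteq> V" by (auto simp: V'_def)
    have "V - V' = {v \<in> V. card (nbrs E V v) < (1 - 1 / r - \<epsilon>1) * ?n}" by (auto simp: V'_def)
    then have cV': "card (V - V') \<le> \<epsilon>1 * ?n" using n1[OF fs md n'(1)] by simp
    have deg: "\<forall>v\<in>V'. (1 - 1 / r - \<epsilon>1) * ?n \<le> card (nbrs E V v)" by (simp add: V'_def)
    obtain A where A0: "(\<forall>i<r. A i \<subseteq> V' \<and> card (A i) = T) \<and>
      (\<forall>i<r. \<forall>j<r. i \<noteq> j \<longrightarrow> (\<forall>u\<in>A i. \<forall>w\<in>A j. adj E u w))"
      using n2[rule_format, OF H(1) n'(2) V' \<epsilon>1(1,3) cV' bspec[OF deg]] ..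
    then have A: "\<And>j. j < r \<Longrightarrow> A j \<subseteq> V' \<and> card (A j) = T"
      and cpl: "\<And>i j u w. i < r \<Longrightarrow> j < r \<Longrightarrow> i \<noteq> j \<Longrightarrow> u \<in> A i \<Longrightarrow> w \<in> A j \<Longrightarrow> adj E u w"
      by simp_all
    obtain W where W0: "(\<forall>i<r. W i \<subseteq> V') \<and> card (V - (\<Union>i<r. W i)) \<le> (4 * r + 10) * \<epsilon>1 * card V \<and>
      (\<forall>i<r. \<forall>j<r. i \<noteq> j \<longrightarrow> W i \<inter> W j = {}) \<and>
      (\<forall>i<r. \<forall>j<r. i \<noteq> j \<longrightarrow> (\<forall>y\<in>W i. \<forall>z\<in>W i. t \<le> card {w \<in> A j. adj E y w \<and> adj E z w}))"
      using classification_by_trace[OF fs \<epsilon>1(1) V' cV' bspec[OF deg] A cpl T8 tT sn] ..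
    then have W: "\<And>i. i < r \<Longrightarrow> W i \<subseteq> V'" "card (V - (\<Union>i<r. W i)) \<le> (4 * r + 10) * \<epsilon>1 * ?n"
      "\<And>i j. i < r \<Longrightarrow> j < r \<Longrightarrow> i \<noteq> j \<Longrightarrow> W i \<inter> W j = {}"
      "\<And>i j y z. i < r \<Longrightarrow> j < r \<Longrightarrow> i \<noteq> j \<Longrightarrow> y \<in> W i \<Longrightarrow> z \<in> W i \<Longrightarrow> t \<le> card {w \<in> A j. adj E y w \<and> adj E z w}"
      by simp_all
    define Q where "Q = (\<lambda>y z e. e \<in> E \<and> y \<in> e \<and> z \<in> e \<and> y \<noteq> z \<and> (\<exists>i<r. y \<in> W i \<and> z \<in> W i))"
    have "\<not> (\<exists>y z e. (\<forall>i<s. Q (y i) (z i) (e i)) \<and> inj_on y {..<s} \<and> inj_on z {..<s} \<and>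
        y ` {..<s} \<inter> z ` {..<s} = {} \<and> inj_on e {..<s})"
    proof (intro notI, elim exE conjE)
      fix y z e
      assume q: "\<forall>i<s. Q (y i) (z i) (e i)" and inj: "inj_on y {..<s}" "inj_on z {..<s}"
        "y ` {..<s} \<inter> z ` {..<s} = {}" "inj_on e {..<s}"
      have "\<forall>i. \<exists>j. i < s \<longrightarrow> j < r \<and> y i \<in> W j \<and> z i \<in> W j" using q by (auto simp: Q_def)
      from choice[OF this] obtain \<kappa> where
        \<kappa>: "\<forall>i. i < s \<longrightarrow> \<kappa> i < r \<and> y i \<in> W (\<kappa> i) \<and> z i \<in> W (\<kappa> i)" ..
      have "\<not> Berge_free F (V, E)"
      proof (rule trigger_embedding[where I = "{}" and y = y and z = z and ee = e and P = A and D = 0 and M = t and \<kappa> = \<kappa>])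
        show "card {w \<in> A j. \<not> adj E u w} \<le> 0" if "i < r" "j < r" "i \<noteq> j" "u \<in> A i" for i j u
        proof -
          have e: "{w \<in> A j. \<not> adj E u w} = {}" using cpl that by blast
          show ?thesis unfolding e by simp
        qed
        show "e i \<in> E \<and> y i \<in> e i \<and> z i \<in> e i \<and> \<kappa> i < r" if "i \<in> {..<s} - {}" for i
          using q \<kappa> that by (simp add: Q_def)
        show "t \<le> card {w \<in> A j. adj E (y i) w \<and> adj E (z i) w}"
          if "i \<in> {..<s} - {}" "j < r" "j \<noteq> \<kappa> i" for i j
          using W(4)[of "\<kappa> i" j "y i" "z i"] \<kappa> that by auto
        show "y ` {..<s} \<subseteq> V" using q H(4) by (auto simp: Q_def)
        show "A j \<subseteq> V" "t \<le> card (A j)" if "j < r" for j using A[OF that] V' T8 by auto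
      qed (use inj H(3) r_pos in \<open>simp_all add: L_def t_def\<close>)
      then show False using fs by (simp add: free_system_def)
    qed
    moreover have "y \<in> e \<and> z \<in> e \<and> y \<noteq> z" if "Q y z e" for y z e using that by (simp add: Q_def)
    ultimately have "\<exists>\<E>. finite \<E> \<and> card \<E> < s \<and> (\<forall>e\<in>\<E>. \<exists>y z. Q y z e) \<and>
      (\<forall>y z e. Q y z e \<longrightarrow> y \<in> \<Union>\<E> \<or> z \<in> \<Union>\<E>)"
      using trigger_sequence[of Q s] by (simp only: simp_thms)
    then obtain \<E> where \<E>: "finite \<E>" "card \<E> < s" "\<And>e. e \<in> \<E> \<Longrightarrow> \<exists>y z. Q y z e"
      "\<And>y z e. Q y z e \<Longrightarrow> y \<in> \<Union>\<E> \<or> z \<in> \<Union>\<E>" by blast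
    define U where "U = \<Union>\<E>"
    have \<E>E: "e \<in> E" if "e \<in> \<E>" for e using \<E>(3)[OF that] by (auto simp: Q_def)
    have finU: "finite U" unfolding U_def using \<E>(1) \<E>E H(6) by blast
    have "card U \<le> card \<E> * k" unfolding U_def using \<E>(1) \<E>E H(5) by (intro card_Union_bounded) auto
    also have "\<dots> \<le> s * k" using \<E>(2) by simp
    finally have "real (card U) \<le> s * k" by (simp only: of_nat_le_iff)
    then have cU: "card U \<le> \<epsilon>1 * ?n" using skn by simp
    define P where "P = (\<lambda>i. W i - U)"
    have PV: "P i \<subseteq> V" if "i < r" for i using W(1)[OF that] V' by (auto simp: P_def)
    have finP: "finite (P i)" if "i < r" for i using PV[OF that] H(1) by (rule finite_subset)
    have one: "y = z" if "i < r" "e \<in> E" "y \<in> P i" "y \<in> e" "z \<in> P i" "z \<in> e" for i e y z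
    proof (rule ccontr)
      assume "y \<noteq> z"
      then have "Q y z e" using that by (auto simp: Q_def P_def)
      from \<E>(4)[OF this] show False using that by (auto simp: P_def U_def)
    qed
    have nbrP: "nbrs E V v \<subseteq> V - P i" if "i < r" "v \<in> P i" for i v
    proof
      fix w assume w: "w \<in> nbrs E V v"
      then have a: "adj E v w" by (simp add: nbrs_def)
      then obtain e where "e \<in> E" "v \<in> e" "w \<in> e" by (rule adj_hyperedge)
      then have "w \<notin> P i" using one[of i e v w] that a by (auto simp: heavy_irrefl)
      then show "w \<in> V - P i" using w by (auto simp: nbrs_def)
    qed
    have cVP: "real (card (V - P i)) = ?n - card (P i)" if "i < r" for i
      using card_Diff_subset[OF finP PV] card_mono[OF H(1) PV] that by (simp add: of_nat_diff)
    have degP: "(1 - 1 / r - \<epsilon>1) * ?n \<le> card (nbrs E V v)" if "i < r" "v \<in> P i" for i v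
      using deg W(1)[OF that(1)] that(2) by (auto simp: P_def)
    have up: "card (P i) \<le> (1 / r + \<epsilon>1) * ?n" if "i < r" for i
    proof (cases "P i = {}")
      case True
      have "0 \<le> (1 / r + \<epsilon>1) * ?n" using \<epsilon>1 by simp
      then show ?thesis using True by simp
    next
      case False
      then obtain v where v: "v \<in> P i" by blast
      have "card (nbrs E V v) \<le> card (V - P i)" using nbrP[OF that v] H(1) by (intro card_mono) auto
      then have "real (card (nbrs E V v)) \<le> ?n - card (P i)" using cVP[OF that] by linarith
      then show ?thesis using degP[OF that v] by (simp add: algebra_simps)
    qed
    have cov: "?n \<le> (\<Sum>j<r. real (card (P j))) + (4 * r + 11) * \<epsilon>1 * ?n"
    proof -
      have "V \<subseteq> (\<Union>j<r. P j) \<union> (V - (\<Union>i<r. W i)) \<union> U" by (auto simp: P_def)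
      then have "card V \<le> card ((\<Union>j<r. P j) \<union> (V - (\<Union>i<r. W i)) \<union> U)"
        using H(1) finP finU by (intro card_mono) auto
      also have "\<dots> \<le> card (\<Union>j<r. P j) + card (V - (\<Union>i<r. W i)) + card U"
        using card_Un_le[of "(\<Union>j<r. P j) \<union> (V - (\<Union>i<r. W i))" U] card_Un_le[of "\<Union>j<r. P j" "V - (\<Union>i<r. W i)"] by linarith
      also have "card (\<Union>j<r. P j) \<le> (\<Sum>j<r. card (P j))" by (rule card_UN_le) simp
      finally have "card V \<le> (\<Sum>j<r. card (P j)) + card (V - (\<Union>i<r. W i)) + card U" by simp
      then have "?n \<le> (\<Sum>j<r. real (card (P j))) + card (V - (\<Union>i<r. W i)) + card U"
        by (simp only: of_nat_sum[symmetric] of_nat_add[symmetric] of_nat_le_iff)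
      also have "\<dots> \<le> (\<Sum>j<r. real (card (P j))) + (4 * r + 10) * \<epsilon>1 * ?n + \<epsilon>1 * ?n"
        using W(2) cU by (intro add_mono) auto
      finally show ?thesis by (simp add: algebra_simps)
    qed
    have low: "(1 / r - (5 * r + 11) * \<epsilon>1) * ?n \<le> card (P i)" if "i < r" for i
    proof -
      have "(\<Sum>j<r. real (card (P j))) \<le> card (P i) + (real r - 1) * ((1 / r + \<epsilon>1) * ?n)"
        using up that by (intro sum_remove_le) auto
      then have "?n - (real r - 1) * ((1 / r + \<epsilon>1) * ?n) - (4 * r + 11) * \<epsilon>1 * ?n \<le> card (P i)"
        using cov by linarith
      moreover have "?n - (real r - 1) * ((1 / r + \<epsilon>1) * ?n) - (4 * r + 11) * \<epsilon>1 * ?n =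
          (1 / r - (5 * r + 10) * \<epsilon>1) * ?n"
        using r0 by (simp add: field_simps)
      moreover have "(1 / r - (5 * r + 11) * \<epsilon>1) * ?n \<le> (1 / r - (5 * r + 10) * \<epsilon>1) * ?n"
        using \<epsilon>1 by (intro mult_right_mono) auto
      ultimately show ?thesis by linarith
    qed
    have miss: "card {w \<in> V - P i. \<not> adj E v w} \<le> (5 * r + 12) * \<epsilon>1 * ?n" if "i < r" "v \<in> P i" for i v
    proof -
      have "{w \<in> V - P i. \<not> adj E v w} = (V - P i) - nbrs E V v" by (auto simp: nbrs_def)
      then have "card {w \<in> V - P i. \<not> adj E v w} = card (V - P i) - card (nbrs E V v)"
        using card_Diff_subset[of "nbrs E V v" "V - P i"] nbrP[OF that] H(1) by (simp add: finite_nbrs)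
      moreover have "card (nbrs E V v) \<le> card (V - P i)" using nbrP[OF that] H(1) by (intro card_mono) auto
      ultimately have "real (card {w \<in> V - P i. \<not> adj E v w}) = ?n - card (P i) - card (nbrs E V v)"
        using cVP[OF that(1)] by (simp add: of_nat_diff)
      also have "\<dots> \<le> ?n - (1 / r - (5 * r + 11) * \<epsilon>1) * ?n - (1 - 1 / r - \<epsilon>1) * ?n"
        using low[OF that(1)] degP[OF that] by linarith
      also have "\<dots> = (5 * r + 12) * \<epsilon>1 * ?n" by (simp add: algebra_simps)
      finally show ?thesis .
    qed
    have m: "(5 * r + 12) * \<epsilon>1 * ?n \<le> \<epsilon> * ?n" using \<epsilon>2 by (intro mult_right_mono) auto
    have l: "(1 / r - \<epsilon>) * ?n \<le> (1 / r - (5 * r + 11) * \<epsilon>1) * ?n"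
      using \<epsilon>2 \<epsilon>1 by (intro mult_right_mono) (auto simp: algebra_simps)
    have u: "(1 / r + \<epsilon>1) * ?n \<le> (1 / r + \<epsilon>) * ?n"
    proof -
      have "1 * \<epsilon>1 \<le> (5 * r + 12) * \<epsilon>1" using \<epsilon>1 by (intro mult_right_mono) auto
      then show ?thesis using \<epsilon>2 by (intro mult_right_mono) auto
    qed
    have "core_partition \<epsilon> V E P"
      unfolding core_partition_def
    proof (intro allI impI conjI ballI)
      fix j assume j: "j < r"
      show "P j \<subseteq> V" by (rule PV[OF j])
      show "(1 / r - \<epsilon>) * ?n \<le> card (P j)" using l low[OF j] by linarith
      show "card (P j) \<le> (1 / r + \<epsilon>) * ?n" using u up[OF j] by linarith
      show "P i \<inter> P j = {}" if "i < r" "i \<noteq> j" for i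
        using W(3)[OF that(1) j that(2)] by (auto simp: P_def)
      show "y = z" if "e \<in> E" "y \<in> P j \<inter> e" "z \<in> P j \<inter> e" for e y z
        using one[OF j that(1)] that by blast
      show "real (card {w \<in> V - P j. \<not> adj E v w}) \<le> \<epsilon> * ?n" if "v \<in> P j" for v
        using miss[OF j that] m by linarith
    qed
    then show "\<exists>P. core_partition \<epsilon> V E P" by (rule exI[of _ P])
  qed
qed

end

section \<open>The upper bound\<close>

lemma esym_le:
  fixes x :: real
  assumes "finite I" "\<And>i. i \<in> I \<Longrightarrow> p i \<le> x"
  shows "real (esym k I p) \<le> (card I choose k) * x ^ k"
proof -
  have "real (esym k I p) = (\<Sum>S | S \<subseteq> I \<and> card S = k. \<Prod>i\<in>S. real (p i))"
    by (simp add: esym_def)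
  also have "\<dots> \<le> (\<Sum>S | S \<subseteq> I \<and> card S = k. x ^ k)"
  proof (rule sum_mono)
    fix S assume S: "S \<in> {S. S \<subseteq> I \<and> card S = k}"
    then have "(\<Prod>i\<in>S. real (p i)) \<le> (\<Prod>i\<in>S. x)" using assms(2) by (intro prod_mono) auto
    then show "(\<Prod>i\<in>S. real (p i)) \<le> x ^ k" using S by simp
  qed
  also have "\<dots> = (card I choose k) * x ^ k" using n_subsets[OF assms(1), of k] by simp
  finally show ?thesis .
qed

text \<open>Putting class \<open>j\<close> at \<open>x - w\<close> and all others except
  \<open>i\<close> at \<open>x\<close>, Pascal's rule yields the leading term minus \<open>w\<close>
  times a binomial multiple of \<open>x ^ k\<close>; \<open>k \<le> r - 2\<close> makes this
  binomial at least \<open>1\<close>. It serves to show that a vertex with few neighbours in class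
  \<open>i\<close> cannot miss many in class \<open>j\<close>.\<close>

lemma esym_defect_le:
  fixes x y w :: real
  assumes ij: "i < r" "j < r" "i \<noteq> j" and x: "x \<ge> 0" "\<And>l. l < r \<Longrightarrow> p l \<le> x"
    and y: "p i \<le> y" and w: "p j \<le> x - w" "w \<ge> 0" and k: "k \<le> r - 2" and w1: "x \<ge> w1" "w1 \<ge> 0"
  shows "real (esym (Suc k) {..<r} p) \<le> y * ((r - 1 choose k) * x ^ k) + (r - 1 choose Suc k) * x ^ Suc k - w * w1 ^ k"
proof -
  define J where "J = {..<r} - {i}"
  define J' where "J' = J - {j}"
  have I: "{..<r} = insert i J" "J = insert j J'" using ij by (auto simp: J_def J'_def)
  have fin: "finite J" "finite J'" "i \<notin> J" "j \<notin> J'" by (auto simp: J_def J'_def)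
  have c: "card J = r - 1" "card J' = r - 2" using ij by (auto simp: J_def J'_def)
  have r: "r - 1 = Suc (r - 2)" using ij by linarith
  let ?a = "real (r - 2 choose k) * x ^ k"
  have e1: "real (esym k J p) \<le> (r - 1 choose k) * x ^ k"
    using esym_le[OF fin(1), of p x k] x c by (auto simp: J_def)
  have e2: "real (esym k J' p) \<le> ?a" "real (esym (Suc k) J' p) \<le> (r - 2 choose Suc k) * x ^ Suc k"
  proof -
    have "real (esym m J' p) \<le> (card J' choose m) * x ^ m" for m
      using x(2) by (intro esym_le[OF fin(2)]) (auto simp: J'_def J_def)
    from this[of k] this[of "Suc k"] show "real (esym k J' p) \<le> ?a"
      "real (esym (Suc k) J' p) \<le> (r - 2 choose Suc k) * x ^ Suc k" unfolding c .
  qed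
  have "esym (Suc k) {..<r} p = esym (Suc k) J' p + p j * esym k J' p + p i * esym k J p"
    using esym_insert[OF fin(1,3), of k p] esym_insert[OF fin(2,4), of k p]
    unfolding I(1)[symmetric] I(2)[symmetric] by simp
  then have "real (esym (Suc k) {..<r} p) = esym (Suc k) J' p + real (p j) * esym k J' p + real (p i) * esym k J p"
    by simp
  also have "\<dots> \<le> (r - 2 choose Suc k) * x ^ Suc k + (x - w) * ?a + y * ((r - 1 choose k) * x ^ k)"
  proof (intro add_mono e2)
    have "0 \<le> x - w" "0 \<le> y" using w y by (linarith, meson of_nat_0_le_iff order_trans)
    then show "real (p j) * real (esym k J' p) \<le> (x - w) * ?a"
      "real (p i) * esym k J p \<le> y * ((r - 1 choose k) * x ^ k)"
      using w y e1 e2 x by (auto intro!: mult_mono)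
  qed
  also have "\<dots> = y * ((r - 1 choose k) * x ^ k) + (r - 1 choose Suc k) * x ^ Suc k - w * ?a"
    unfolding r by (simp add: algebra_simps)
  also have "\<dots> \<le> y * ((r - 1 choose k) * x ^ k) + (r - 1 choose Suc k) * x ^ Suc k - w * w1 ^ k"
  proof -
    have "(1::real) \<le> real (r - 2 choose k)" using k by (simp add: Suc_leI)
    moreover have "w1 ^ k \<le> x ^ k" using w1 by (rule power_mono)
    ultimately have "1 * w1 ^ k \<le> ?a" using x w1 by (intro mult_mono) auto
    then have "w * w1 ^ k \<le> w * ?a" using w(2) by (intro mult_left_mono) auto
    then show ?thesis by simp
  qed
  finally show ?thesis .
qed

context berge_problem
begin

section \<open>Degrees relative to the partition\<close>

lemma codegree_le:
  assumes fs: "free_system V E" and "y \<noteq> z"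
  shows "card {e \<in> E. y \<in> e \<and> z \<in> e} \<le> card V ^ (k - 2)"
proof -
  note H = free_systemD[OF fs]
  let ?X = "{S. S \<subseteq> V \<and> card S = k - 2}"
  have img: "(\<lambda>e. e - {y, z}) ` {e \<in> E. y \<in> e \<and> z \<in> e} \<subseteq> ?X"
  proof
    fix S assume "S \<in> (\<lambda>e. e - {y, z}) ` {e \<in> E. y \<in> e \<and> z \<in> e}"
    then obtain e where e: "e \<in> E" "y \<in> e" "z \<in> e" "S = e - {y, z}" by blast
    have "card S = card e - card {y, z}" using e H(6)[OF e(1)] by (simp add: card_Diff_subset)
    then show "S \<in> ?X" using e H(4,5)[OF e(1)] assms(2) by auto
  qed
  have inj: "inj_on (\<lambda>e. e - {y, z}) {e \<in> E. y \<in> e \<and> z \<in> e}"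
    by (rule inj_onI) blast
  have "card {e \<in> E. y \<in> e \<and> z \<in> e} \<le> card ?X"
    by (rule card_inj_on_le[OF inj img]) (use H(1) in auto)
  also have "\<dots> = card V choose (k - 2)" by (rule n_subsets[OF H(1)])
  also have "\<dots> \<le> card V ^ (k - 2)"
    by (cases "k - 2 \<le> card V") (auto simp: binomial_le_pow binomial_eq_0)
  finally show ?thesis .
qed

lemma edges_through_le:
  assumes fs: "free_system V E" and Z: "Z \<subseteq> V" "y \<notin> Z"
    and c: "\<And>z. z \<in> Z \<Longrightarrow> card {e \<in> E. y \<in> e \<and> z \<in> e} \<le> c"
  shows "card {e \<in> E. y \<in> e \<and> (\<exists>z\<in>Z. z \<in> e)} \<le> card Z * c"
proof -
  note H = free_systemD[OF fs]
  have finZ: "finite Z" using Z(1) H(1) by (rule finite_subset)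
  have "{e \<in> E. y \<in> e \<and> (\<exists>z\<in>Z. z \<in> e)} \<subseteq> (\<Union>z\<in>Z. {e \<in> E. y \<in> e \<and> z \<in> e})" by blast
  then have "card {e \<in> E. y \<in> e \<and> (\<exists>z\<in>Z. z \<in> e)} \<le> card (\<Union>z\<in>Z. {e \<in> E. y \<in> e \<and> z \<in> e})"
    using finZ H(2) by (intro card_mono) auto
  also have "\<dots> \<le> (\<Sum>z\<in>Z. card {e \<in> E. y \<in> e \<and> z \<in> e})" by (rule card_UN_le[OF finZ])
  also have "\<dots> \<le> (\<Sum>z\<in>Z. c)" by (rule sum_mono) (rule c)
  finally show ?thesis by simp
qed

lemma light_edges_through_le:
  assumes fs: "free_system V E" and "y \<in> V"
  shows "card {e \<in> E. y \<in> e \<and> (\<exists>z\<in>e. z \<noteq> y \<and> \<not> adj E y z)} \<le> card V * L"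
proof -
  note H = free_systemD[OF fs]
  let ?Z = "{z \<in> V. z \<noteq> y \<and> \<not> adj E y z}"
  have "{e \<in> E. y \<in> e \<and> (\<exists>z\<in>e. z \<noteq> y \<and> \<not> adj E y z)} = {e \<in> E. y \<in> e \<and> (\<exists>z\<in>?Z. z \<in> e)}"
    using H(4) by blast
  also have "card \<dots> \<le> card ?Z * L"
    by (rule edges_through_le[OF fs]) (auto simp: heavy_def not_le)
  also have "\<dots> \<le> card V * L" using H(1) by (intro mult_le_mono1 card_mono) auto
  finally show ?thesis .
qed

lemma core_partition_rest:
  fixes \<epsilon> :: real
  assumes fs: "free_system V E" and cp: "core_partition \<epsilon> V E P"
  shows "card (V - (\<Union>j<r. P j)) \<le> r * \<epsilon> * card V"
proof -
  note H = free_systemD[OF fs]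
  have P: "P j \<subseteq> V" "(1 / r - \<epsilon>) * card V \<le> card (P j)" if "j < r" for j
    using cp that by (auto simp: core_partition_def)
  have finP: "finite (P j)" if "j < r" for j using P(1)[OF that] H(1) by (rule finite_subset)
  have disj: "P i \<inter> P j = {}" if "i < r" "j < r" "i \<noteq> j" for i j
    using cp that unfolding core_partition_def by blast
  have "real (card (\<Union>j<r. P j)) = (\<Sum>j<r. real (card (P j)))"
    using card_UN_disjoint[of "{..<r}" P] finP disj by simp
  also have "\<dots> \<ge> (\<Sum>j<r. (1 / r - \<epsilon>) * card V)" using P by (intro sum_mono) auto
  finally have "r * ((1 / r - \<epsilon>) * card V) \<le> card (\<Union>j<r. P j)" by simp
  moreover have "r * ((1 / r - \<epsilon>) * card V) = (1 - r * \<epsilon>) * card V"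
    using r_pos by (simp add: field_simps)
  ultimately have "(1 - r * \<epsilon>) * card V \<le> card (\<Union>j<r. P j)" by simp
  moreover have sub: "(\<Union>j<r. P j) \<subseteq> V" using P by blast
  moreover have "card (V - (\<Union>j<r. P j)) = card V - card (\<Union>j<r. P j)"
    using sub finite_subset[OF sub H(1)] by (rule card_Diff_subset[rotated])
  moreover have "card (\<Union>j<r. P j) \<le> card V" using sub H(1) by (intro card_mono)
  ultimately show ?thesis by (simp add: of_nat_diff algebra_simps)
qed

text \<open>A hyperedge at \<open>x\<close> without light pairs at \<open>x\<close> and without
  further vertices outside the classes consists, apart from \<open>x\<close>, of heavy neighbours of
  \<open>x\<close> in distinct classes. The two exceptional kinds give the two error terms.\<close>

lemma degree_le_esym:
  fixes \<epsilon> :: real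
  assumes fs: "free_system V E" and cp: "core_partition \<epsilon> V E P" and x: "x \<in> V"
  shows "card {e \<in> E. x \<in> e} \<le> card V * L + r * \<epsilon> * card V * card V ^ (k - 2) +
    real (esym (k - 1) {..<r} (\<lambda>j. card (nbrs E (P j) x)))"
proof -
  note H = free_systemD[OF fs]
  let ?R = "V - (\<Union>j<r. P j)"
  have disj: "P i \<inter> P j = {}" if "i < r" "j < r" "i \<noteq> j" for i j
    using cp that unfolding core_partition_def by blast
  have one: "y = z" if "j < r" "e \<in> E" "y \<in> P j" "y \<in> e" "z \<in> P j" "z \<in> e" for j e y z
    using cp that unfolding core_partition_def by blast
  have PV: "P j \<subseteq> V" if "j < r" for j using cp that by (simp add: core_partition_def)
  let ?B1 = "{e \<in> E. x \<in> e \<and> (\<exists>z\<in>e. z \<noteq> x \<and> \<not> adj E x z)}"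
  let ?B2 = "{e \<in> E. x \<in> e \<and> (\<exists>z\<in>?R - {x}. z \<in> e)}"
  define B3 where "B3 = {e \<in> E. x \<in> e} - ?B1 - ?B2"
  have b1: "card ?B1 \<le> card V * L" by (rule light_edges_through_le[OF fs x])
  have "card ?B2 \<le> card (?R - {x}) * card V ^ (k - 2)"
    using codegree_le[OF fs] by (intro edges_through_le[OF fs]) auto
  also have "\<dots> \<le> card ?R * card V ^ (k - 2)"
    using H(1) by (intro mult_le_mono1 card_mono) auto
  finally have "real (card ?B2) \<le> real (card ?R * card V ^ (k - 2))" by (simp only: of_nat_le_iff)
  also have "\<dots> = real (card ?R) * real (card V) ^ (k - 2)" by simp
  also have "\<dots> \<le> (r * \<epsilon> * card V) * card V ^ (k - 2)"
    using core_partition_rest[OF fs cp] by (simp only: of_nat_power) (intro mult_right_mono, auto)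
  finally have b2: "card ?B2 \<le> (r * \<epsilon> * card V) * card V ^ (k - 2)" .
  define W where "W = (\<Union>j<r. nbrs E (P j) x)"
  define col where "col = (\<lambda>v. SOME j. j < r \<and> v \<in> P j)"
  have col: "col v = j" if "j < r" "v \<in> P j" for j v
  proof -
    have "col v < r \<and> v \<in> P (col v)" unfolding col_def by (rule someI[of _ j]) (use that in simp)
    then show ?thesis using disj[of "col v" j] that by blast
  qed
  have "W \<subseteq> V" using PV by (auto simp: W_def nbrs_def)
  then have finW: "finite W" using H(1) by (rule finite_subset)
  have img: "(\<lambda>e. e - {x}) ` B3 \<subseteq> transversals (k - 1) W col"
  proof
    fix S assume "S \<in> (\<lambda>e. e - {x}) ` B3"
    then obtain e where e: "e \<in> B3" "S = e - {x}" by blast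
    have eE: "e \<in> E" "x \<in> e" using e by (auto simp: B3_def)
    have eW: "\<exists>j<r. z \<in> P j \<and> adj E x z" if z: "z \<in> e" "z \<noteq> x" for z
    proof -
      have "adj E x z" using e z eE by (auto simp: B3_def)
      moreover have "z \<notin> ?R" using e z eE by (auto simp: B3_def)
      then have "\<exists>j<r. z \<in> P j" using H(4)[OF eE(1)] z by auto
      ultimately show ?thesis by blast
    qed
    have "S \<subseteq> W" using eW e by (fastforce simp: W_def nbrs_def)
    moreover have "card S = k - 1" using e eE H(5,6)[OF eE(1)] by simp
    moreover have "inj_on col S"
    proof (rule inj_onI)
      fix y z assume yz: "y \<in> S" "z \<in> S" "col y = col z"
      obtain i where i: "i < r" "y \<in> P i" using eW[of y] yz e by blast
      obtain j where j: "j < r" "z \<in> P j" using eW[of z] yz e by blast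
      have "i = j" using col[OF i] col[OF j] yz by simp
      then show "y = z" using one[OF i(1) eE(1) i(2) _ _] j yz e by blast
    qed
    ultimately show "S \<in> transversals (k - 1) W col" by (simp add: transversals_def)
  qed
  have inj: "inj_on (\<lambda>e. e - {x}) B3" by (rule inj_onI) (auto simp: B3_def)
  have "card B3 \<le> card (transversals (k - 1) W col)"
    by (rule card_inj_on_le[OF inj img finite_transversals[OF finW]])
  also have "\<dots> = esym (k - 1) {..<r} (\<lambda>j. card {w \<in> W. col w = j})"
    by (rule card_transversals) (use finW col in \<open>auto simp: W_def nbrs_def\<close>)
  also have "\<dots> = esym (k - 1) {..<r} (\<lambda>j. card (nbrs E (P j) x))"
  proof (rule esym_cong)
    fix j assume "j \<in> {..<r}"
    then have "{w \<in> W. col w = j} = nbrs E (P j) x"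
      using col by (auto simp: W_def nbrs_def)
    then show "card {w \<in> W. col w = j} = card (nbrs E (P j) x)" by simp
  qed
  finally have b3: "card B3 \<le> esym (k - 1) {..<r} (\<lambda>j. card (nbrs E (P j) x))" .
  have "{e \<in> E. x \<in> e} \<subseteq> ?B1 \<union> ?B2 \<union> B3" by (auto simp: B3_def)
  then have "card {e \<in> E. x \<in> e} \<le> card (?B1 \<union> ?B2 \<union> B3)"
    using H(2) by (intro card_mono) (auto simp: B3_def)
  also have "\<dots> \<le> card ?B1 + card ?B2 + card B3"
    using card_Un_le[of "?B1 \<union> ?B2" B3] card_Un_le[of ?B1 ?B2] by linarith
  finally have "real (card {e \<in> E. x \<in> e}) \<le> real (card ?B1) + card ?B2 + card B3" by linarith
  also have "\<dots> \<le> real (card V * L) + (r * \<epsilon> * card V) * card V ^ (k - 2) + esym (k - 1) {..<r} (\<lambda>j. card (nbrs E (P j) x))"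
    using b1 b2 b3 by (intro add_mono) (simp_all only: of_nat_le_iff)
  finally show ?thesis by simp
qed

text \<open>A defect of \<open>n / (4 * r)\<close> neighbours in one class lowers the degree bound
  by \<open>6 * \<kappa>0 * n ^ (k - 1)\<close>, which outweighs the five errors of one
  \<open>\<kappa>0\<close> each in \<open>nbrs_large\<close>.\<close>

definition "\<kappa>0 = 1 / (24 * real r ^ (k - 1))"
text \<open>In units of \<open>n ^ (k - 2)\<close>, the number of ways to choose
  \<open>k - 2\<close> vertices from distinct ones of the other \<open>r - 1\<close> classes, each
  of size at most \<open>2 * n / r\<close>; it is the price of one neighbour in the sparse
  class.\<close>

definition "Cst = real (r - 1 choose (k - 2)) * (2 / real r) ^ (k - 2)"

lemma \<kappa>0_pos: "\<kappa>0 > 0" using r_pos by (simp add: \<kappa>0_def)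

lemma Cst_pos: "Cst > 0" using k3 kr by (simp add: Cst_def)

text \<open>Few neighbours in class \<open>i\<close> leave essentially \<open>r - 1\<close> classes,
  and full adjacency to these only just gives the main term \<open>c0\<close>. A defect in a further
  class would push the degree below the minimum.\<close>

lemma nbrs_large:
  fixes \<epsilon> \<delta> \<theta> :: real
  assumes fs: "free_system V E" and md: "min_degree_cond \<delta> V E" and cp: "core_partition \<epsilon> V E P"
    and x: "x \<in> V" and i: "i < r" "card (nbrs E (P i) x) \<le> \<theta> * card V" and j: "j < r" "j \<noteq> i"
    and \<epsilon>: "0 < \<epsilon>" "\<epsilon> \<le> 1 / r" "r * \<epsilon> \<le> \<kappa>0" "real (r - 1 choose (k - 1)) * (1 / r + \<epsilon>) ^ (k - 1) \<le> c0 + \<kappa>0"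
    and \<delta>: "\<delta> \<le> \<kappa>0" and \<theta>: "0 \<le> \<theta>" "\<theta> * Cst \<le> \<kappa>0" and n: "1 \<le> card V" "L \<le> \<kappa>0 * card V"
  shows "card (P j) - card V / (4 * r) \<le> card (nbrs E (P j) x)"
proof (rule ccontr)
  assume neg: "\<not> ?thesis"
  note H = free_systemD[OF fs]
  define N where "N = real (card V)"
  define X where "X = (1 / r + \<epsilon>) * N"
  define q where "q = k - 2"
  have kq: "k - 1 = Suc q" "k - 2 = q" using k3 by (auto simp: q_def)
  have N1: "N \<ge> 1" using n by (simp add: N_def)
  have r0: "real r > 0" using r_pos by simp
  have PX: "card (P l) \<le> X" "P l \<subseteq> V" if "l < r" for l
    using cp that by (auto simp: core_partition_def X_def N_def)
  have dX: "card (nbrs E (P l) x) \<le> X" if "l < r" for l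
  proof -
    have "card (nbrs E (P l) x) \<le> card (P l)"
      using finite_subset[OF PX(2)[OF that] H(1)] by (intro card_mono) (auto simp: nbrs_def)
    then show ?thesis using PX(1)[OF that] by linarith
  qed
  have X0: "X \<ge> 0" and XN: "N / r \<le> X" "X \<le> 2 / r * N"
    using \<epsilon> N1 r0 by (auto simp: X_def field_simps intro: mult_right_mono)
  have dj: "card (nbrs E (P j) x) \<le> X - N / (4 * r)"
    using neg PX(1)[OF j(1)] by (simp add: N_def)
  have "real (esym (Suc q) {..<r} (\<lambda>j. card (nbrs E (P j) x))) \<le>
      \<theta> * N * ((r - 1 choose q) * X ^ q) + (r - 1 choose Suc q) * X ^ Suc q - N / (4 * r) * (N / r) ^ q"
  proof (rule esym_defect_le[OF i(1) j(1)])
    show "i \<noteq> j" using j by simp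
    show "q \<le> r - 2" using kr by (simp add: q_def)
  qed (use X0 XN dX dj i N1 in \<open>auto simp: N_def\<close>)
  also have "\<theta> * N * ((r - 1 choose q) * X ^ q) \<le> \<theta> * N * ((r - 1 choose q) * (2 / r * N) ^ q)"
    using \<theta> N1 X0 XN by (intro mult_left_mono power_mono) auto
  also have "\<dots> = \<theta> * Cst * N ^ Suc q"
    unfolding power_mult_distrib[of "2 / r" N] by (simp add: Cst_def kq)
  also have "\<dots> \<le> \<kappa>0 * N ^ Suc q" using \<theta> N1 by (intro mult_right_mono) auto
  also have "(r - 1 choose Suc q) * X ^ Suc q = (r - 1 choose Suc q) * (1 / r + \<epsilon>) ^ Suc q * N ^ Suc q"
    by (simp add: X_def power_mult_distrib)
  also have "\<dots> \<le> (c0 + \<kappa>0) * N ^ Suc q" using \<epsilon>(4) N1 unfolding kq by (intro mult_right_mono) auto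
  also have "N / (4 * r) * (N / r) ^ q = 6 * \<kappa>0 * N ^ Suc q"
  proof -
    have "\<kappa>0 = 1 / (24 * real r ^ Suc q)" by (simp only: \<kappa>0_def kq)
    then show ?thesis using r0 by (simp add: power_divide field_simps)
  qed
  finally have es: "real (esym (Suc q) {..<r} (\<lambda>j. card (nbrs E (P j) x))) \<le> (c0 - 4 * \<kappa>0) * N ^ Suc q"
    by (simp add: algebra_simps)
  have "N * L \<le> N * (\<kappa>0 * N)" using n N1 by (intro mult_left_mono) (auto simp: N_def)
  also have "\<dots> = \<kappa>0 * N ^ 2" by (simp add: power2_eq_square)
  also have "\<dots> \<le> \<kappa>0 * N ^ Suc q" using N1 k3 \<kappa>0_pos by (intro mult_left_mono power_increasing) (auto simp: q_def)
  finally have NL: "N * L \<le> \<kappa>0 * N ^ Suc q" .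
  have "r * \<epsilon> * N * N ^ q = r * \<epsilon> * N ^ Suc q" by simp
  also have "\<dots> \<le> \<kappa>0 * N ^ Suc q" using \<epsilon> N1 by (intro mult_right_mono) auto
  finally have R: "r * \<epsilon> * N * N ^ q \<le> \<kappa>0 * N ^ Suc q" .
  have "(c0 - \<delta>) * N ^ Suc q \<le> card {e \<in> E. x \<in> e}"
    using md x unfolding min_degree_cond_def kq N_def of_nat_power by blast
  also have "\<dots> \<le> N * L + r * \<epsilon> * N * N ^ q + real (esym (Suc q) {..<r} (\<lambda>j. card (nbrs E (P j) x)))"
    using degree_le_esym[OF fs cp x] unfolding kq N_def by simp
  also have "\<dots> \<le> \<kappa>0 * N ^ Suc q + \<kappa>0 * N ^ Suc q + (c0 - 4 * \<kappa>0) * N ^ Suc q"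
    using NL R es by linarith
  also have "\<dots> = (c0 - 2 * \<kappa>0) * N ^ Suc q" by (simp add: algebra_simps)
  finally have "(c0 - \<delta>) * N ^ Suc q \<le> (c0 - 2 * \<kappa>0) * N ^ Suc q" .
  then have "c0 - \<delta> \<le> c0 - 2 * \<kappa>0" using N1 by (auto dest: mult_right_le_imp_le)
  then show False using \<delta> \<kappa>0_pos by linarith
qed

text \<open>The vertices of \<open>A\<close> act as apexes for the first groups, pairs of one color
  inside a hyperedge for the rest. Two vertices outside \<open>A\<close> of the same color each miss
  at most \<open>n / (4 * r)\<close> of any other class, and classes have at least
  \<open>7 * n / (8 * r)\<close> vertices, so the two have at least \<open>\<theta> * n\<close>
  common neighbours there.\<close>

lemma same_class_triggers:
  fixes \<epsilon> \<theta> :: real and col :: "'b \<Rightarrow> nat"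
  assumes fs: "free_system V E" and cp: "core_partition \<epsilon> V E P"
    and A: "A = {x \<in> V. \<forall>j<r. \<theta> * card V \<le> card (nbrs E (P j) x)}"
    and col: "\<And>x. x \<in> V - A \<Longrightarrow> col x < r"
    and large: "\<And>x j. x \<in> V - A \<Longrightarrow> j < r \<Longrightarrow> j \<noteq> col x \<Longrightarrow> card (P j) - card V / (4 * r) \<le> card (nbrs E (P j) x)"
    and \<theta>: "\<theta> \<le> 1 / (8 * r)" and \<epsilon>: "0 < \<epsilon>" "\<epsilon> \<le> 1 / (8 * r)" "card (verts F) * \<epsilon> \<le> \<theta> / 2"
    and n: "2 * t \<le> \<theta> * card V"
  defines "Q \<equiv> \<lambda>y z e. e \<in> E \<and> y \<in> e \<and> z \<in> e \<and> y \<noteq> z \<and> y \<notin> A \<and> z \<notin> A \<and> col y = col z"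
  shows "card A < s" "\<exists>\<E>. finite \<E> \<and> card \<E> < s - card A \<and> (\<forall>e\<in>\<E>. e \<in> E) \<and>
      (\<forall>y z e. Q y z e \<longrightarrow> y \<in> \<Union>\<E> \<or> z \<in> \<Union>\<E>)"
proof -
  note H = free_systemD[OF fs]
  let ?n = "real (card V)"
  have r0: "real r > 0" using r_pos by simp
  have AV: "A \<subseteq> V" and finA: "finite A" using H(1) by (auto simp: A)
  have P: "P j \<subseteq> V" "(1 / r - \<epsilon>) * ?n \<le> card (P j)" if "j < r" for j
    using cp that by (auto simp: core_partition_def)
  have finP: "finite (P j)" if "j < r" for j using P(1)[OF that] H(1) by (rule finite_subset)
  have disj: "P i \<inter> P j = {}" if "i < r" "j < r" "i \<noteq> j" for i j
    using cp that unfolding core_partition_def by blast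
  \<comment> \<open>\<open>card A < s\<close> is still to be shown. Capping at \<open>s\<close> lets
    one argument do both: a family with fewer than \<open>s - a'\<close> members forces
    \<open>a' < s\<close> and hence \<open>a' = card A\<close>.\<close>
  define a' where "a' = min (card A) s"
  obtain Y where Y: "Y \<subseteq> A" "card Y = a'" "finite Y"
    using obtain_subset_with_card_n[of a' A] by (auto simp: a'_def)
  obtain h where h: "bij_betw h {..<a'} Y"
    using ex_bij_betw_nat_finite[OF Y(3)] Y(2) by (auto simp: atLeast0LessThan)
  \<comment> \<open>A class vertex misses up to \<open>\<epsilon> * n\<close> vertices of another
    class, so in contrast to the bounded complete parts \<open>D\<close> and \<open>M\<close> are
    linear in \<open>n\<close> here.\<close>
  define D where "D = nat \<lfloor>\<epsilon> * ?n\<rfloor>"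
  define M where "M = 2 * s + card (verts F) * (D + 1)"
  have en: "0 \<le> \<epsilon> * ?n" using \<epsilon> by simp
  have D: "D \<le> \<epsilon> * ?n" using en unfolding D_def by linarith
  have MM: "M \<le> \<theta> * ?n"
  proof -
    have "real M = t + card (verts F) * real D" by (simp add: M_def t_def algebra_simps)
    also have "\<dots> \<le> t + card (verts F) * (\<epsilon> * ?n)" using D by (intro add_left_mono mult_left_mono) auto
    also have "\<dots> \<le> t + \<theta> / 2 * ?n"
    proof -
      have "card (verts F) * \<epsilon> * ?n \<le> \<theta> / 2 * ?n" using \<epsilon>(3) by (intro mult_right_mono) auto
      then show ?thesis by (simp add: algebra_simps)
    qed
    also have "\<dots> \<le> \<theta> * ?n" using n by simp
    finally show ?thesis .
  qed
  have \<theta>n: "\<theta> * ?n \<le> 1 / (8 * r) * ?n" using \<theta> by (intro mult_right_mono) auto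
  have \<epsilon>n: "\<epsilon> * ?n \<le> 1 / (8 * r) * ?n" using \<epsilon> by (intro mult_right_mono) auto
  have rn: "1 / r * ?n = 8 * (1 / (8 * r) * ?n)" "?n / (4 * r) = 2 * (1 / (8 * r) * ?n)" by simp_all
  have rn0: "1 / (8 * r) * ?n \<ge> 0" by simp
  have Pbig: "7 * (1 / (8 * r) * ?n) \<le> card (P j)" if "j < r" for j
    using P(2)[OF that] \<epsilon>n rn by (simp add: algebra_simps)
  have common: "M \<le> card {w \<in> P j. adj E y w \<and> adj E z w}"
    if "y \<in> V - A" "z \<in> V - A" "col y = col z" "j < r" "j \<noteq> col y" for y z j
  proof -
    have eq: "{w \<in> P j. adj E y w \<and> adj E z w} = nbrs E (P j) y \<inter> nbrs E (P j) z" by (auto simp: nbrs_def)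
    have fin: "finite (nbrs E (P j) y)" "finite (nbrs E (P j) z)" using finP that by (auto simp: nbrs_def)
    have "card (nbrs E (P j) y \<union> nbrs E (P j) z) \<le> card (P j)"
      using finP[OF that(4)] by (intro card_mono) (auto simp: nbrs_def)
    then have "card (nbrs E (P j) y) + card (nbrs E (P j) z) \<le> card (P j) + card {w \<in> P j. adj E y w \<and> adj E z w}"
      using card_Un_Int[OF fin] by (simp add: eq)
    then have "real (card (nbrs E (P j) y)) + card (nbrs E (P j) z) \<le> real (card (P j)) + card {w \<in> P j. adj E y w \<and> adj E z w}"
      by linarith
    then have "real M \<le> card {w \<in> P j. adj E y w \<and> adj E z w}"
      using large[of y j] large[of z j] that Pbig[OF that(4)] MM \<theta>n rn rn0 by auto
    then show ?thesis by simp
  qed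
  have no: "\<not> (\<exists>y z e. (\<forall>i<s - a'. Q (y i) (z i) (e i)) \<and> inj_on y {..<s - a'} \<and> inj_on z {..<s - a'} \<and>
        y ` {..<s - a'} \<inter> z ` {..<s - a'} = {} \<and> inj_on e {..<s - a'})"
  proof (intro notI, elim exE conjE)
    fix y z e
    assume q: "\<forall>i<s - a'. Q (y i) (z i) (e i)" and inj: "inj_on y {..<s - a'}" "inj_on z {..<s - a'}"
      "y ` {..<s - a'} \<inter> z ` {..<s - a'} = {}" "inj_on e {..<s - a'}"
    define y' where "y' = (\<lambda>i. if i < a' then h i else y (i - a'))"
    define z' where "z' = (\<lambda>i. z (i - a'))"
    define e' where "e' = (\<lambda>i. e (i - a'))"
    have as: "a' \<le> s" by (simp add: a'_def)
    have q': "Q (y' i) (z' i) (e' i)" if "i < s" "a' \<le> i" for i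
      using q that by (auto simp: y'_def z'_def e'_def)
    have qV: "y' i \<in> V - A" "z' i \<in> V - A" if "i < s" "a' \<le> i" for i
      using q'[OF that] H(4) by (auto simp: Q_def)
    have hA: "h i \<in> A" if "i < a'" for i using h Y that by (auto simp: bij_betw_def)
    have injh: "inj_on h {..<a'}" using h by (simp add: bij_betw_def)
    have "\<not> Berge_free F (V, E)"
    proof (rule trigger_embedding[where I = "{..<a'}" and y = y' and z = z' and ee = e' and P = P and D = D
          and M = M and \<kappa> = "\<lambda>i. col (y' i)"])
      show "card {w \<in> P j. \<not> adj E u w} \<le> D" if "i < r" "j < r" "i \<noteq> j" "u \<in> P i" for i j u
      proof -
        have "card {w \<in> P j. \<not> adj E u w} \<le> card {w \<in> V - P i. \<not> adj E u w}"
          using H(1) P(1)[OF that(2)] disj[OF that(1-3)] by (intro card_mono) auto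
        also have "real \<dots> \<le> \<epsilon> * ?n" using cp that unfolding core_partition_def by blast
        finally show ?thesis unfolding D_def by linarith
      qed
      show "M \<le> card (P j)" if "j < r" for j
      proof -
        have "real M \<le> card (P j)" using Pbig[OF that] MM \<theta>n rn0 by linarith
        then show ?thesis by simp
      qed
      show "M \<le> card {w \<in> P j. adj E (y' i) w}" if "i \<in> {..<a'}" "j < r" for i j
      proof -
        have "\<theta> * ?n \<le> card (nbrs E (P j) (h i))" using hA[of i] that by (auto simp: A)
        then have "real M \<le> card (nbrs E (P j) (h i))" using MM by linarith
        then show ?thesis using that by (simp add: y'_def nbrs_def)
      qed
      show "e' i \<in> E \<and> y' i \<in> e' i \<and> z' i \<in> e' i \<and> col (y' i) < r" if "i \<in> {..<s} - {..<a'}" for i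
        using q'[of i] qV[of i] col that by (auto simp: Q_def)
      show "M \<le> card {w \<in> P j. adj E (y' i) w \<and> adj E (z' i) w}"
        if "i \<in> {..<s} - {..<a'}" "j < r" "j \<noteq> col (y' i)" for i j
        using common[of "y' i" "z' i" j] q'[of i] qV[of i] that by (auto simp: Q_def)
      show "y' ` {..<s} \<subseteq> V"
      proof
        fix v assume "v \<in> y' ` {..<s}"
        then obtain i where "i < s" "v = y' i" by auto
        then show "v \<in> V" using qV[of i] hA[of i] AV by (cases "i < a'") (auto simp: y'_def)
      qed
      show "inj_on y' {..<s}"
      proof (rule inj_onI)
        fix i j assume ij: "i \<in> {..<s}" "j \<in> {..<s}" "y' i = y' j"
        have "i < a' \<longleftrightarrow> y' i \<in> A" if "i < s" for i using that qV[of i] hA[of i] by (auto simp: y'_def not_less)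
        then have "i < a' \<longleftrightarrow> j < a'" using ij by auto
        then show "i = j"
        proof (cases "i < a'")
          case True
          then show ?thesis using ij \<open>i < a' \<longleftrightarrow> j < a'\<close> injh by (auto simp: y'_def dest: inj_onD)
        next
          case False
          then have "i - a' = j - a'" using ij \<open>i < a' \<longleftrightarrow> j < a'\<close> by (intro inj_onD[OF inj(1)]) (auto simp: y'_def)
          then show ?thesis using False \<open>i < a' \<longleftrightarrow> j < a'\<close> by linarith
        qed
      qed
      show "inj_on z' ({..<s} - {..<a'})"
      proof (rule inj_onI)
        fix i j assume ij: "i \<in> {..<s} - {..<a'}" "j \<in> {..<s} - {..<a'}" "z' i = z' j"
        then have "i - a' = j - a'" by (intro inj_onD[OF inj(2)]) (auto simp: z'_def)
        then show "i = j" using ij by auto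
      qed
      show "inj_on e' ({..<s} - {..<a'})"
      proof (rule inj_onI)
        fix i j assume ij: "i \<in> {..<s} - {..<a'}" "j \<in> {..<s} - {..<a'}" "e' i = e' j"
        then have "i - a' = j - a'" by (intro inj_onD[OF inj(4)]) (auto simp: e'_def)
        then show "i = j" using ij by auto
      qed
      show "y' ` {..<s} \<inter> z' ` ({..<s} - {..<a'}) = {}"
      proof -
        have "y' i \<noteq> z' j" if "i < s" "j < s" "a' \<le> j" for i j
        proof (cases "i < a'")
          case True
          then show ?thesis using hA[OF True] qV(2)[OF that(2,3)] by (auto simp: y'_def)
        next
          case False
          have "y (i - a') \<in> y ` {..<s - a'}" "z (j - a') \<in> z ` {..<s - a'}" using False that by auto
          then have "y (i - a') \<noteq> z (j - a')" using inj(3) by (metis disjoint_iff)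
          then show ?thesis using False by (simp add: y'_def z'_def)
        qed
        then show ?thesis by auto
      qed
    qed (use H(3) r_pos P as in \<open>simp_all add: L_def M_def\<close>)
    then show False using fs by (simp add: free_system_def)
  qed
  have "y \<in> e \<and> z \<in> e \<and> y \<noteq> z" if "Q y z e" for y z e using that by (simp add: Q_def)
  then have "\<exists>\<E>. finite \<E> \<and> card \<E> < s - a' \<and> (\<forall>e\<in>\<E>. \<exists>y z. Q y z e) \<and>
      (\<forall>y z e. Q y z e \<longrightarrow> y \<in> \<Union>\<E> \<or> z \<in> \<Union>\<E>)"
    using trigger_sequence[of Q "s - a'"] no by (simp only: simp_thms)
  then obtain \<E> where \<E>: "finite \<E> \<and> card \<E> < s - a' \<and> (\<forall>e\<in>\<E>. \<exists>y z. Q y z e) \<and>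
      (\<forall>y z e. Q y z e \<longrightarrow> y \<in> \<Union>\<E> \<or> z \<in> \<Union>\<E>)" ..
  then have "a' < s" by linarith
  then have aA: "card A = a'" by (simp add: a'_def min_def split: if_splits)
  then show "card A < s" using \<open>a' < s\<close> by simp
  have "\<forall>e\<in>\<E>. e \<in> E" using \<E> by (auto simp: Q_def)
  then show "\<exists>\<E>. finite \<E> \<and> card \<E> < s - card A \<and> (\<forall>e\<in>\<E>. e \<in> E) \<and>
      (\<forall>y z e. Q y z e \<longrightarrow> y \<in> \<Union>\<E> \<or> z \<in> \<Union>\<E>)"
    using \<E> unfolding aA by (intro exI[of _ \<E>]) simp
qed

definition "tc n = turan_clique_count (s - 1) (n - (s - 1)) r k"

text \<open>The linear requirements hold below a minimum of constants. The left side of the last one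
  tends to \<open>c0\<close> as \<open>\<epsilon>\<close> tends to \<open>0\<close>, so continuity
  provides it.\<close>

lemma constants_exist:
  fixes \<theta> :: real
  assumes "\<theta> > 0"
  shows "\<exists>\<epsilon>::real>0. \<epsilon> \<le> 1 / (8 * real r) \<and> r * \<epsilon> \<le> \<kappa>0 \<and> r * \<epsilon> \<le> \<theta> \<and> card (verts F) * \<epsilon> \<le> \<theta> / 2 \<and>
    real (r - 1 choose (k - 1)) * (1 / r + \<epsilon>) ^ (k - 1) \<le> c0 + \<kappa>0"
proof -
  have r0: "real r > 0" using r_pos by simp
  define m where "m = Min {1 / (8 * real r), \<kappa>0 / r, \<theta> / r, \<theta> / (2 * (card (verts F) + 1))}"
  have m0: "m > 0" using r0 assms \<kappa>0_pos by (auto simp: m_def)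
  have m: "m \<le> 1 / (8 * real r)" "m \<le> \<kappa>0 / r" "m \<le> \<theta> / r" "m \<le> \<theta> / (2 * (card (verts F) + 1))"
    by (auto simp: m_def)
  define g where "g = (\<lambda>\<epsilon>. real (r - 1 choose (k - 1)) * (1 / r + \<epsilon>) ^ (k - 1))"
  have "isCont g 0" unfolding g_def by (intro continuous_intros)
  moreover have "g 0 = c0" by (simp add: g_def c0_def power_divide)
  ultimately have "(g \<longlongrightarrow> c0) (at_right 0)" by (simp add: isCont_def filterlim_at_split)
  then have "eventually (\<lambda>\<epsilon>. g \<epsilon> < c0 + \<kappa>0) (at_right 0)"
    using \<kappa>0_pos by (intro order_tendstoD(2)[of g c0]) auto
  moreover have "eventually (\<lambda>\<epsilon>. \<epsilon> \<in> {0<..<m}) (at_right 0)"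
    using m0 by (rule eventually_at_right_real)
  ultimately have "eventually (\<lambda>\<epsilon>. g \<epsilon> < c0 + \<kappa>0 \<and> \<epsilon> \<in> {0<..<m}) (at_right (0::real))"
    by (rule eventually_conj)
  then obtain \<epsilon> where \<epsilon>: "g \<epsilon> < c0 + \<kappa>0" "0 < \<epsilon>" "\<epsilon> < m"
    using eventually_happens[of _ "at_right (0::real)"] by (auto simp: trivial_limit_at_right_real)
  have "real (card (verts F)) * \<epsilon> \<le> (card (verts F) + 1) * m"
    using \<epsilon> by (intro mult_mono) auto
  also have "\<dots> \<le> (card (verts F) + 1) * (\<theta> / (2 * (card (verts F) + 1)))"
    using m(4) by (intro mult_left_mono) auto
  also have "\<dots> = \<theta> / 2" by (simp add: field_simps)
  finally have "card (verts F) * \<epsilon> \<le> \<theta> / 2" .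
  moreover have "\<epsilon> \<le> \<kappa>0 / r" "\<epsilon> \<le> \<theta> / r" using \<epsilon> m by linarith+
  then have "r * \<epsilon> \<le> \<kappa>0" "r * \<epsilon> \<le> \<theta>" using r0 by (simp_all add: field_simps)
  moreover have "\<epsilon> \<le> 1 / (8 * real r)" using \<epsilon> m by linarith
  ultimately show ?thesis using \<epsilon> unfolding g_def by (intro exI[of _ \<epsilon>]) simp
qed

section \<open>Comparison with the extremal pattern\<close>

text \<open>Such a hyperedge contains one of at most \<open>s * k\<close> vertices \<open>y\<close>.
  A partner \<open>z\<close> of the same color forms a light pair with \<open>y\<close>, or is one
  of its few heavy neighbours in class \<open>col y\<close>, or lies outside all classes. Each case
  contributes at most \<open>\<theta> * n ^ (k - 1)\<close> hyperedges per \<open>y\<close>.\<close>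

lemma bad_edges_le:
  fixes \<epsilon> \<theta> :: real
  assumes fs: "free_system V E" and cp: "core_partition \<epsilon> V E P"
    and col: "\<And>x. x \<in> V - A \<Longrightarrow> col x < r \<and> card (nbrs E (P (col x)) x) \<le> \<theta> * card V"
    and colP: "\<And>x j. j < r \<Longrightarrow> x \<in> P j \<Longrightarrow> x \<notin> A \<and> col x = j"
    and \<E>: "finite \<E>" "card \<E> \<le> s" "\<E> \<subseteq> E"
    and \<theta>: "\<theta> > 0" "r * \<epsilon> \<le> \<theta>" and n: "1 \<le> card V" "L \<le> \<theta> * card V"
  shows "card {e \<in> E. \<exists>y\<in>e. \<exists>z\<in>e. y \<in> \<Union>\<E> \<and> y \<noteq> z \<and> y \<notin> A \<and> z \<notin> A \<and> col y = col z}
    \<le> s * k * (3 * \<theta> * card V ^ (k - 1))"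
proof -
  note H = free_systemD[OF fs]
  define N where "N = real (card V)"
  define q where "q = k - 2"
  have kq: "k - 1 = Suc q" "k - 2 = q" using k3 by (auto simp: q_def)
  have N1: "N \<ge> 1" using n by (simp add: N_def)
  define U where "U = \<Union>\<E> - A"
  have UV: "U \<subseteq> V" using \<E> H(4) by (auto simp: U_def)
  have finU: "finite U" using UV H(1) by (rule finite_subset)
  have "card (\<Union>\<E>) \<le> card \<E> * k" using \<E> H(5) by (intro card_Union_bounded) auto
  also have "\<dots> \<le> s * k" using \<E> by simp
  finally have "card (\<Union>\<E>) \<le> s * k" .
  moreover have "card U \<le> card (\<Union>\<E>)"
    unfolding U_def using \<E> H(6) by (intro card_mono) auto
  ultimately have cU: "real (card U) \<le> s * k" by (simp only: of_nat_le_iff)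
  let ?R = "V - (\<Union>j<r. P j)"
  let ?B = "\<lambda>y. {e \<in> E. y \<in> e \<and> (\<exists>z\<in>e. y \<noteq> z \<and> z \<notin> A \<and> col y = col z)}"
  have B: "real (card (?B y)) \<le> 3 * \<theta> * N ^ Suc q" if y: "y \<in> U" for y
  proof -
    have yV: "y \<in> V - A" using y UV by (auto simp: U_def)
    let ?Z = "nbrs E (P (col y)) y \<union> (?R - {y})"
    let ?B1 = "{e \<in> E. y \<in> e \<and> (\<exists>z\<in>e. z \<noteq> y \<and> \<not> adj E y z)}"
    let ?B2 = "{e \<in> E. y \<in> e \<and> (\<exists>z\<in>?Z. z \<in> e)}"
    have sub: "?B y \<subseteq> ?B1 \<union> ?B2"
    proof
      fix e assume "e \<in> ?B y"
      then obtain z where e: "e \<in> E" "y \<in> e" "z \<in> e" "y \<noteq> z" "z \<notin> A" "col y = col z" by blast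
      show "e \<in> ?B1 \<union> ?B2"
      proof (cases "adj E y z")
        case True
        have "z \<in> ?Z"
        proof (cases "z \<in> ?R")
          case False
          then obtain j where j: "j < r" "z \<in> P j" using e H(4) by blast
          then have "j = col y" using colP e(6) by metis
          then show ?thesis using j True by (simp add: nbrs_def)
        qed (use e in auto)
        then show ?thesis using e by blast
      next
        case False
        then show ?thesis using e by auto
      qed
    qed
    have b1: "card ?B1 \<le> card V * L" by (rule light_edges_through_le[OF fs]) (use yV in auto)
    have PV: "P (col y) \<subseteq> V" using cp col[OF yV] by (simp add: core_partition_def)
    have ZV: "?Z \<subseteq> V" using PV by (auto simp: nbrs_def)
    have yZ: "y \<notin> ?Z" by (auto simp: nbrs_def heavy_irrefl)
    have "card ?B2 \<le> card ?Z * card V ^ (k - 2)"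
    proof (rule edges_through_le[OF fs ZV yZ])
      fix z assume "z \<in> ?Z"
      then have "y \<noteq> z" using yZ by blast
      then show "card {e \<in> E. y \<in> e \<and> z \<in> e} \<le> card V ^ (k - 2)" by (rule codegree_le[OF fs])
    qed
    then have b2: "real (card ?B2) \<le> card ?Z * N ^ q"
      unfolding N_def kq of_nat_power[symmetric] of_nat_mult[symmetric] of_nat_le_iff .
    have "card ?Z \<le> card (nbrs E (P (col y)) y) + card (?R - {y})" by (rule card_Un_le)
    also have "card (?R - {y}) \<le> card ?R" using H(1) by (intro card_mono) auto
    finally have "real (card ?Z) \<le> real (card (nbrs E (P (col y)) y)) + card ?R" by simp
    also have "\<dots> \<le> \<theta> * N + r * \<epsilon> * N"
      using col[OF yV] core_partition_rest[OF fs cp] unfolding N_def by (intro add_mono) auto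
    also have "\<dots> \<le> \<theta> * N + \<theta> * N" using \<theta> N1 by (intro add_left_mono mult_right_mono) auto
    finally have cZ: "real (card ?Z) \<le> 2 * \<theta> * N" by linarith
    have "card (?B y) \<le> card (?B1 \<union> ?B2)" using sub H(2) by (intro card_mono) auto
    also have "\<dots> \<le> card ?B1 + card ?B2" by (rule card_Un_le)
    finally have "real (card (?B y)) \<le> real (card ?B1) + card ?B2" by linarith
    also have "\<dots> \<le> N * L + 2 * \<theta> * N * N ^ q"
    proof (rule add_mono)
      show "real (card ?B1) \<le> N * L" using b1 unfolding N_def of_nat_mult[symmetric] of_nat_le_iff .
      have "card ?Z * N ^ q \<le> 2 * \<theta> * N * N ^ q" using cZ N1 by (intro mult_right_mono) auto
      then show "real (card ?B2) \<le> 2 * \<theta> * N * N ^ q" using b2 by linarith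
    qed
    also have "N * L \<le> \<theta> * N ^ Suc q"
    proof -
      have "N * L \<le> N * (\<theta> * N)" using n N1 by (intro mult_left_mono) (auto simp: N_def)
      also have "\<dots> = \<theta> * N ^ 2" by (simp add: power2_eq_square)
      also have "\<dots> \<le> \<theta> * N ^ Suc q"
        using N1 k3 \<theta> by (intro mult_left_mono power_increasing) (auto simp: q_def)
      finally show ?thesis .
    qed
    finally show ?thesis by (simp add: mult_ac)
  qed
  have "{e \<in> E. \<exists>y\<in>e. \<exists>z\<in>e. y \<in> \<Union>\<E> \<and> y \<noteq> z \<and> y \<notin> A \<and> z \<notin> A \<and> col y = col z} \<subseteq> (\<Union>y\<in>U. ?B y)"
    by (auto simp: U_def)
  then have "card {e \<in> E. \<exists>y\<in>e. \<exists>z\<in>e. y \<in> \<Union>\<E> \<and> y \<noteq> z \<and> y \<notin> A \<and> z \<notin> A \<and> col y = col z} \<le> card (\<Union>y\<in>U. ?B y)"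
    using finU H(2) by (intro card_mono) auto
  also have "\<dots> \<le> (\<Sum>y\<in>U. card (?B y))" by (rule card_UN_le[OF finU])
  finally have "real (card {e \<in> E. \<exists>y\<in>e. \<exists>z\<in>e. y \<in> \<Union>\<E> \<and> y \<noteq> z \<and> y \<notin> A \<and> z \<notin> A \<and> col y = col z})
      \<le> (\<Sum>y\<in>U. real (card (?B y)))"
    by (simp only: of_nat_le_iff of_nat_sum[symmetric])
  also have "\<dots> \<le> card U * (3 * \<theta> * N ^ Suc q)" by (rule sum_bounded_above) (rule B)
  also have "\<dots> \<le> real (s * k) * (3 * \<theta> * N ^ Suc q)" using cU \<theta> N1 by (intro mult_right_mono) auto
  finally show ?thesis unfolding N_def kq by simp
qed

text \<open>A hyperedge outside \<open>apex_transversals\<close> contains two vertices of one color,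
  so it meets \<open>\<Union>\<E>\<close> in such a pair. With \<open>s - 1\<close> apexes
  \<open>\<E>\<close> is empty. With fewer, promoting one class vertex \<open>x\<close> to an apex
  gains \<open>q ^ (k - 1)\<close> cliques, which pays for all bad hyperedges, and filling up to
  \<open>s - 1\<close> apexes loses nothing.\<close>

lemma upper_bound_min_degree:
  "\<exists>\<delta>>0. \<exists>n0. \<forall>(V :: 'b set) E. free_system V E \<longrightarrow> min_degree_cond \<delta> V E \<longrightarrow> n0 \<le> card V \<longrightarrow> card E \<le> tc (card V)"
proof -
  have r0: "real r > 0" using r_pos by simp
  \<comment> \<open>In turn: the contribution of a sparse class stays within
    \<open>\<kappa>0\<close>, vertices of one color keep many common neighbours, and the bad
    hyperedges number at most \<open>(n / (4 * r)) ^ (k - 1)\<close>.\<close>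
  define \<theta> where "\<theta> = Min {\<kappa>0 / Cst, 1 / (8 * real r), (1 / (4 * real r)) ^ (k - 1) / (3 * s * k)}"
  have \<theta>0: "\<theta> > 0" using r0 s1 k3 \<kappa>0_pos Cst_pos by (auto simp: \<theta>_def)
  have \<theta>: "\<theta> \<le> \<kappa>0 / Cst" "\<theta> \<le> 1 / (8 * real r)" "\<theta> \<le> (1 / (4 * real r)) ^ (k - 1) / (3 * s * k)"
    by (auto simp: \<theta>_def)
  have \<theta>C: "\<theta> * Cst \<le> \<kappa>0" using \<theta>(1) Cst_pos by (simp add: field_simps)
  have \<theta>s: "s * k * (3 * \<theta>) \<le> (1 / (4 * real r)) ^ (k - 1)"
  proof -
    have "real (3 * s * k) > 0" using s1 k3 by simp
    then have "\<theta> * real (3 * s * k) \<le> (1 / (4 * real r)) ^ (k - 1)" using \<theta>(3) by (simp only: pos_le_divide_eq)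
    then show ?thesis by (simp add: mult_ac)
  qed
  from constants_exist[OF \<theta>0] obtain \<epsilon> :: real where \<epsilon>:
    "\<epsilon> > 0" "\<epsilon> \<le> 1 / (8 * real r)" "r * \<epsilon> \<le> \<kappa>0" "r * \<epsilon> \<le> \<theta>" "card (verts F) * \<epsilon> \<le> \<theta> / 2"
    "real (r - 1 choose (k - 1)) * (1 / r + \<epsilon>) ^ (k - 1) \<le> c0 + \<kappa>0"
    by (elim exE conjE)
  have "1 / (8 * real r) \<le> 1 / real r" using r0 by (intro divide_left_mono) auto
  then have \<epsilon>r: "\<epsilon> \<le> 1 / real r" using \<epsilon>(2) by linarith
  obtain \<delta>' n1 where \<delta>': "\<delta>' > 0" and n1: "\<And>(V :: 'b set) E. free_system V E \<Longrightarrow> min_degree_cond \<delta>' V E \<Longrightarrow> n1 \<le> card V \<Longrightarrow>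
    (\<exists>P. core_partition \<epsilon> V E P)"
    using core_partition_exists[OF \<epsilon>(1), where 'b = 'b] by blast
  define \<delta> where "\<delta> = min \<delta>' \<kappa>0"
  have \<delta>: "\<delta> > 0" "\<delta> \<le> \<delta>'" "\<delta> \<le> \<kappa>0" using \<delta>' \<kappa>0_pos by (auto simp: \<delta>_def)
  define n0 where "n0 = n1 + s + 1 + nat \<lceil>L / \<kappa>0\<rceil> + nat \<lceil>L / \<theta>\<rceil> + nat \<lceil>2 * t / \<theta>\<rceil> + 8 * r"
  show ?thesis
  proof (rule exI[of _ \<delta>], rule conjI[OF \<delta>(1)], rule exI[of _ n0], intro allI impI)
    fix V :: "'b set" and E
    assume fs: "free_system V E" and md: "min_degree_cond \<delta> V E" and n: "n0 \<le> card V"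
    note H = free_systemD[OF fs]
    let ?n = "real (card V)"
    have n': "n1 \<le> card V" "s \<le> card V" "1 \<le> card V" "nat \<lceil>L / \<kappa>0\<rceil> \<le> card V" "nat \<lceil>L / \<theta>\<rceil> \<le> card V"
      "nat \<lceil>2 * t / \<theta>\<rceil> \<le> card V" "8 * r \<le> card V"
      using n unfolding n0_def by linarith+
    have "L / \<kappa>0 \<le> ?n" "L / \<theta> \<le> ?n" "2 * t / \<theta> \<le> ?n" using n'(4-6) by linarith+
    then have nL: "L \<le> \<kappa>0 * ?n" "L \<le> \<theta> * ?n" "2 * t \<le> \<theta> * ?n"
      using \<theta>0 \<kappa>0_pos by (simp_all add: field_simps)
    have "min_degree_cond \<delta>' V E"
      unfolding min_degree_cond_def
    proof
      fix v assume v: "v \<in> V"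
      have "(c0 - \<delta>') * real (card V ^ (k - 1)) \<le> (c0 - \<delta>) * real (card V ^ (k - 1))"
        using \<delta> by (intro mult_right_mono) auto
      also have "\<dots> \<le> card {e \<in> E. v \<in> e}" using md v by (simp add: min_degree_cond_def)
      finally show "(c0 - \<delta>') * real (card V ^ (k - 1)) \<le> card {e \<in> E. v \<in> e}" .
    qed
    from n1[OF fs this n'(1)] obtain P where cp: "core_partition \<epsilon> V E P" by (rule exE)
    have P: "P j \<subseteq> V" "(1 / r - \<epsilon>) * ?n \<le> card (P j)" if "j < r" for j
      using cp that by (auto simp: core_partition_def)
    have finP: "finite (P j)" if "j < r" for j using P(1)[OF that] H(1) by (rule finite_subset)
    have disj: "P i \<inter> P j = {}" if "i < r" "j < r" "i \<noteq> j" for i j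
      using cp that unfolding core_partition_def by blast
    have one: "y = z" if "j < r" "e \<in> E" "y \<in> P j" "y \<in> e" "z \<in> P j" "z \<in> e" for j e y z
      using cp that unfolding core_partition_def by blast
    have r8: "1 / r * ?n = 8 * (1 / (8 * r) * ?n)" by simp
    have r1: "1 / (8 * r) * ?n \<ge> 1" using n'(7) r0 by (simp add: field_simps)
    have \<epsilon>n: "\<epsilon> * ?n \<le> 1 / (8 * r) * ?n" using \<epsilon> by (intro mult_right_mono) auto
    have \<theta>n: "\<theta> * ?n \<le> 1 / (8 * r) * ?n" using \<theta> by (intro mult_right_mono) auto
    have Pbig: "7 * (1 / (8 * r) * ?n) \<le> card (P j)" if "j < r" for j
      using P(2)[OF that] \<epsilon>n r8 by (simp add: algebra_simps)
    have \<theta>n0: "\<theta> * ?n > 0" using \<theta>0 n' by simp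
    define A where "A = {x \<in> V. \<forall>j<r. \<theta> * ?n \<le> card (nbrs E (P j) x)}"
    have AV: "A \<subseteq> V" by (auto simp: A_def)
    have finA: "finite A" using AV H(1) by (rule finite_subset)
    \<comment> \<open>A vertex outside \<open>A\<close> sees little of some class and is assigned to
      it. For a vertex of \<open>P j\<close> this can only be \<open>j\<close>, since it sees almost
      all of every other class.\<close>
    define col where "col = (\<lambda>x. SOME i. i < r \<and> card (nbrs E (P i) x) < \<theta> * ?n)"
    have col: "col x < r \<and> card (nbrs E (P (col x)) x) < \<theta> * ?n" if xA: "x \<in> V - A" for x
    proof -
      obtain i where "i < r \<and> card (nbrs E (P i) x) < \<theta> * ?n" using xA by (auto simp: A_def not_le)
      then show ?thesis unfolding col_def by (rule someI)
    qed
    have colP: "x \<notin> A \<and> col x = j" if j: "j < r" "x \<in> P j" for x j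
    proof -
      have xV: "x \<in> V" using P(1)[OF j(1)] j(2) by blast
      have e: "nbrs E (P j) x = {}"
      proof -
        have False if w: "w \<in> nbrs E (P j) x" for w
        proof -
          have "adj E x w" "w \<in> P j" using w by (auto simp: nbrs_def)
          then obtain e where "e \<in> E" "x \<in> e" "w \<in> e" using adj_hyperedge by metis
          then have "x = w" using one[OF j(1)] j(2) \<open>w \<in> P j\<close> by blast
          then show False using \<open>adj E x w\<close> heavy_irrefl by metis
        qed
        then show ?thesis by blast
      qed
      have xA: "x \<notin> A"
      proof
        assume "x \<in> A"
        then have "\<theta> * ?n \<le> card (nbrs E (P j) x)" using j(1) by (simp add: A_def)
        then show False using \<theta>n0 unfolding e by simp
      qed
      have "col x = j"
      proof (rule ccontr)
        assume ne: "col x \<noteq> j"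
        have c: "col x < r" "card (nbrs E (P (col x)) x) < \<theta> * ?n" using col xV xA by auto
        have "x \<in> P j" by fact
        have miss: "card {w \<in> V - P j. \<not> adj E x w} \<le> \<epsilon> * ?n"
          using cp j unfolding core_partition_def by blast
        have "P (col x) \<subseteq> nbrs E (P (col x)) x \<union> {w \<in> V - P j. \<not> adj E x w}"
          using P(1)[OF c(1)] disj[OF c(1) j(1) ne] by (auto simp: nbrs_def)
        then have "card (P (col x)) \<le> card (nbrs E (P (col x)) x \<union> {w \<in> V - P j. \<not> adj E x w})"
          using H(1) finP[OF c(1)] by (intro card_mono) (auto simp: nbrs_def)
        also have "\<dots> \<le> card (nbrs E (P (col x)) x) + card {w \<in> V - P j. \<not> adj E x w}" by (rule card_Un_le)
        finally have "real (card (P (col x))) \<le> \<theta> * ?n + \<epsilon> * ?n" using c miss by linarith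
        then show False using Pbig[OF c(1)] \<theta>n \<epsilon>n r1 by linarith
      qed
      then show ?thesis using xA by blast
    qed
    have large: "card (P j) - ?n / (4 * r) \<le> card (nbrs E (P j) x)" if "x \<in> V - A" "j < r" "j \<noteq> col x" for x j
    proof (rule nbrs_large[OF fs md cp _ _ _ that(2,3) \<epsilon>(1) \<epsilon>r \<epsilon>(3,6) \<delta>(3) _ \<theta>C n'(3) nL(1)])
      show "x \<in> V" "col x < r" "card (nbrs E (P (col x)) x) \<le> \<theta> * ?n" using col[OF that(1)] that by auto
    qed (use \<theta>0 in simp)
    have \<theta>8: "\<theta> \<le> 1 / real (8 * r)" and \<epsilon>8: "\<epsilon> \<le> 1 / real (8 * r)" using \<theta>(2) \<epsilon>(2) by simp_all
    have trig: "card A < s" "\<exists>\<E>. finite \<E> \<and> card \<E> < s - card A \<and> (\<forall>e\<in>\<E>. e \<in> E) \<and>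
      (\<forall>y z e. e \<in> E \<and> y \<in> e \<and> z \<in> e \<and> y \<noteq> z \<and> y \<notin> A \<and> z \<notin> A \<and> col y = col z \<longrightarrow> y \<in> \<Union>\<E> \<or> z \<in> \<Union>\<E>)"
      by (rule same_class_triggers[OF fs cp A_def _ large \<theta>8 \<epsilon>(1) \<epsilon>8 \<epsilon>(5) nL(3)]; use col in blast)+
    from trig(2) obtain \<E> where \<E>0: "finite \<E> \<and> card \<E> < s - card A \<and> (\<forall>e\<in>\<E>. e \<in> E) \<and>
      (\<forall>y z e. e \<in> E \<and> y \<in> e \<and> z \<in> e \<and> y \<noteq> z \<and> y \<notin> A \<and> z \<notin> A \<and> col y = col z \<longrightarrow> y \<in> \<Union>\<E> \<or> z \<in> \<Union>\<E>)" ..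
    then have \<E>: "finite \<E>" "card \<E> < s - card A" "\<E> \<subseteq> E" by auto
    have cover: "y \<in> \<Union>\<E> \<or> z \<in> \<Union>\<E>"
      if "e \<in> E" "y \<in> e" "z \<in> e" "y \<noteq> z" "y \<notin> A" "z \<notin> A" "col y = col z" for y z e
      using \<E>0 that by blast
    let ?T = "apex_transversals k V A col"
    let ?B = "{e \<in> E. \<exists>y\<in>e. \<exists>z\<in>e. y \<in> \<Union>\<E> \<and> y \<noteq> z \<and> y \<notin> A \<and> z \<notin> A \<and> col y = col z}"
    have sub: "E \<subseteq> ?T \<union> ?B"
    proof
      fix e assume e: "e \<in> E"
      show "e \<in> ?T \<union> ?B"
      proof (cases "inj_on col (e - A)")
        case True
        then show ?thesis using e H(4,5) by (auto simp: apex_transversals_def)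
      next
        case False
        then obtain y z where yz: "y \<in> e" "z \<in> e" "y \<notin> A" "z \<notin> A" "y \<noteq> z" "col y = col z"
          by (auto simp: inj_on_def)
        then have "y \<in> \<Union>\<E> \<or> z \<in> \<Union>\<E>" using cover[OF e] by blast
        then have "e \<in> ?B"
        proof
          assume "y \<in> \<Union>\<E>" then show ?thesis using e yz by blast
        next
          assume "z \<in> \<Union>\<E>" then show ?thesis using e yz(1-4) not_sym[OF yz(5)] yz(6)[symmetric] by blast
        qed
        then show ?thesis by blast
      qed
    qed
    have finT: "finite (apex_transversals k V X col)" for X by (rule finite_apex_transversals[OF H(1)])
    have "card E \<le> card (?T \<union> ?B)" using sub finT H(2) by (intro card_mono) auto
    also have "\<dots> \<le> card ?T + card ?B" by (rule card_Un_le)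
    finally have cE: "card E \<le> card ?T + card ?B" .
    have le_tc: "card (apex_transversals k V X col) \<le> tc (card V)" if "A \<subseteq> X" "X \<subseteq> V" "card X = s - 1" for X
      using card_apex_transversals_le[OF H(1) that(2), of col r k] col that by (auto simp: tc_def)
    show "card E \<le> tc (card V)"
    proof (cases "card A = s - 1")
      case True
      then have "card \<E> = 0" using \<E>(2) by linarith
      then have "\<E> = {}" using \<E>(1) by simp
      then have e: "?B = {}" by simp
      show ?thesis using cE le_tc[OF order_refl AV True] unfolding e by simp
    next
      case False
      then have a: "Suc (card A) \<le> s - 1" using trig(1) by linarith
      have "7 * (1 / (8 * r) * ?n) \<le> card (P 0)" using Pbig[OF r_pos] .
      then have "card (P 0) > 0" using r1 by (metis (mono_tags, opaque_lifting) le_zero_eq linorder_not_less mult_le_0_iff not_numeral_le_zero of_nat_le_0_iff of_nat_0 order_trans zero_less_one)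
      then obtain x where x: "x \<in> P 0" by (metis card.empty ex_in_conv less_irrefl)
      have xc: "x \<notin> A" "col x = 0" "x \<in> V" using colP[OF r_pos x] P(1)[OF r_pos] x by auto
      define J where "J = {..<k - 1}"
      \<comment> \<open>Every class has at least \<open>7 * n / (8 * r)\<close> vertices, so
        \<open>n / (4 * r)\<close> leaves room for rounding up and for leaving out
        \<open>x\<close>.\<close>
      define q where "q = nat \<lceil>?n / (4 * r)\<rceil>"
      have cJ: "card J = k - 1" "Suc (card J) = k" "finite J" "col x \<in> J" using k3 xc by (auto simp: J_def)
      have "card (apex_transversals (Suc (card J)) V A col) + q ^ card J
          \<le> card (apex_transversals (Suc (card J)) V (insert x A) col)"
      proof (rule card_apex_transversals_insert[where Q = "\<lambda>j. P j - {x}"])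
        fix j assume "j \<in> J"
        then have j: "j < r" using kr by (auto simp: J_def)
        have "q \<le> card (P j) - 1"
        proof -
          have "?n / (4 * r) = 2 * (1 / (8 * r) * ?n)" by simp
          then have "?n / (4 * r) + 2 \<le> card (P j)" using Pbig[OF j] r1 by linarith
          then show ?thesis unfolding q_def by linarith
        qed
        also have "\<dots> \<le> card (P j - {x})" by (simp add: card_Diff_singleton_if)
        finally show "P j - {x} \<subseteq> V - A - {x} \<and> q \<le> card (P j - {x}) \<and> (\<forall>v\<in>P j - {x}. col v = j)"
          using P(1)[OF j] colP[OF j] by auto
      qed (use H(1) xc cJ in auto)
      moreover have "Suc (k - 1) = k" using k3 by simp
      ultimately have gain: "card ?T + q ^ (k - 1) \<le> card (apex_transversals k V (insert x A) col)"
        by (simp only: cJ(1))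
      have "card (insert x A) = Suc (card A)" using xc finA by simp
      moreover have "s - 1 \<le> card V" using n'(2) by linarith
      ultimately obtain X where X: "insert x A \<subseteq> X" "X \<subseteq> V" "card X = s - 1"
        using exists_subset_between[of "insert x A" "s - 1" V] a AV xc H(1) by auto
      have "card (apex_transversals k V (insert x A) col) \<le> card (apex_transversals k V X col)"
        by (rule card_mono[OF finT apex_transversals_mono[OF X(1)]])
      also have "\<dots> \<le> tc (card V)" using X by (intro le_tc) auto
      finally have "card ?T + q ^ (k - 1) \<le> tc (card V)" using gain by linarith
      moreover have "card ?B \<le> q ^ (k - 1)"
      proof -
        have "real (card ?B) \<le> s * k * (3 * \<theta> * card V ^ (k - 1))"
          by (rule bad_edges_le[OF fs cp _ colP \<E>(1) _ \<E>(3) \<theta>0 \<epsilon>(4) n'(3) nL(2)])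
            (use col \<E>(2) in \<open>auto intro: less_imp_le\<close>)
        also have "\<dots> = s * k * (3 * \<theta>) * ?n ^ (k - 1)" by simp
        also have "\<dots> \<le> (1 / (4 * real r)) ^ (k - 1) * ?n ^ (k - 1)" using \<theta>s by (intro mult_right_mono) auto
        also have "\<dots> = (?n / (4 * r)) ^ (k - 1)" by (simp add: power_divide power_mult_distrib)
        also have "\<dots> \<le> real q ^ (k - 1)"
          using real_nat_ceiling_ge[of "?n / (4 * r)"] by (intro power_mono) (auto simp: q_def)
        finally show ?thesis by (simp only: of_nat_power[symmetric] of_nat_le_iff)
      qed
      ultimately show ?thesis using cE by linarith
    qed
  qed
qed

section \<open>Removing the minimum degree condition\<close>

text \<open>Each new vertex of the extremal graph adds asymptotically at least
  \<open>c0 * n ^ (k - 1)\<close> cliques, because the classes have size \<open>n / r\<close> up to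
  a constant. Hence a hypergraph in which every degree reaches the increment satisfies the minimum
  degree condition.\<close>

lemma tc_increment:
  assumes "\<delta> > 0"
  shows "\<exists>n0. \<forall>n\<ge>n0. tc (n - 1) \<le> tc n \<and> (c0 - \<delta>) * real n ^ (k - 1) \<le> real (tc n - tc (n - 1))"
proof -
  have r0: "real r > 0" using r_pos by simp
  define C where "C = real (r - 1 choose (k - 1))"
  define f where "f = (\<lambda>n. C * (1 / r - (s / r + 1) / real n) ^ (k - 1))"
  have "f \<longlonglongrightarrow> C * (1 / r - 0) ^ (k - 1)"
    unfolding f_def by (intro tendsto_intros lim_const_over_n)
  then have "f \<longlonglongrightarrow> c0" by (simp add: C_def c0_def power_divide)
  then have "eventually (\<lambda>n. c0 - \<delta> < f n) sequentially"
    using assms by (intro order_tendstoD(1)) auto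
  then obtain n1 where n1: "\<And>n. n \<ge> n1 \<Longrightarrow> c0 - \<delta> < f n" by (auto simp: eventually_sequentially)
  show ?thesis
  proof (intro exI[of _ "n1 + s + r + 1"] allI impI)
    fix n assume n: "n1 + s + r + 1 \<le> n"
    then have n': "n1 \<le> n" "s + r < n" by linarith+
    define m where "m = n - s"
    have e: "n - (s - 1) = Suc m" "n - 1 - (s - 1) = m" using n' s1 by (auto simp: m_def)
    have k: "k = Suc (k - 1)" using k3 by simp
    have st: "tc (n - 1) + (r - 1 choose (k - 1)) * (m div r) ^ (k - 1) \<le> tc n"
      using turan_clique_count_Suc[OF r_pos, of "s - 1" m "k - 1"] k unfolding tc_def e by simp
    then have mono: "tc (n - 1) \<le> tc n" by linarith
    have "real m / r - 1 \<le> real (m div r)"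
      using floor_divide_of_nat_eq[of m r, where ?'a = real] floor_correct[of "real m / real r"] by linarith
    moreover have "real m = real n - s" using n' by (simp add: m_def of_nat_diff)
    ultimately have md: "real n / r - s / r - 1 \<le> real (m div r)" by (simp add: diff_divide_distrib)
    have nn: "(1 / r - (s / r + 1) / real n) * real n = real n / r - s / r - 1"
      using n' by (simp add: field_simps)
    have "real (s + r) \<le> real n" using n' by linarith
    then have "(real s + r) / r \<le> n / r" using r0 by (intro divide_right_mono) auto
    then have pos: "0 \<le> real n / r - s / r - 1" using r0 by (simp add: add_divide_distrib)
    have "(c0 - \<delta>) * real n ^ (k - 1) \<le> f n * real n ^ (k - 1)"
      using n1[OF n'(1)] by (intro mult_right_mono) auto
    also have "\<dots> = C * (real n / r - s / r - 1) ^ (k - 1)"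
      unfolding f_def nn[symmetric] power_mult_distrib by simp
    also have "\<dots> \<le> C * real (m div r) ^ (k - 1)"
      using md pos by (intro mult_left_mono power_mono) (auto simp: C_def)
    also have "\<dots> = real ((r - 1 choose (k - 1)) * (m div r) ^ (k - 1))" by (simp add: C_def)
    also have "\<dots> \<le> real (tc n - tc (n - 1))" unfolding of_nat_le_iff using st by linarith
    finally show "tc (n - 1) \<le> tc n \<and> (c0 - \<delta>) * real n ^ (k - 1) \<le> real (tc n - tc (n - 1))"
      using mono by blast
  qed
qed

lemma free_system_delete:
  assumes "free_system V E"
  shows "free_system (V - {v}) {e \<in> E. v \<notin> e}"
proof -
  have "Berge_free F (V - {v}, {e \<in> E. v \<notin> e})"
    unfolding Berge_free_def
  proof (rule notI, elim exE conjE)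
    fix H' G assume H': "subhypergraph H' (V - {v}, {e \<in> E. v \<notin> e})" "isomorphic F G" "is_Berge H' G"
    then have "subhypergraph H' (V, E)" by (auto simp: subhypergraph_def)
    then show False using H' assms unfolding free_system_def Berge_free_def by blast
  qed
  then show ?thesis using assms by (auto simp: free_system_def)
qed

text \<open>Deleting vertices of small degree gains one hyperedge over the bound at each step; the total
  gain is at most the number of hyperedges at the constant size \<open>m\<close>.\<close>
lemma upper_bound:
  "\<exists>n0. \<forall>(V :: 'b set) E. free_system V E \<longrightarrow> n0 \<le> card V \<longrightarrow> card E \<le> tc (card V)"
proof -
  obtain \<delta> n1 where \<delta>: "\<delta> > 0" and n1: "\<And>(V :: 'b set) E. free_system V E \<Longrightarrow> min_degree_cond \<delta> V E \<Longrightarrow>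
      n1 \<le> card V \<Longrightarrow> card E \<le> tc (card V)"
    using upper_bound_min_degree[where 'b = 'b] by blast
  obtain n2 where n2: "\<And>n. n2 \<le> n \<Longrightarrow> tc (n - 1) \<le> tc n \<and> (c0 - \<delta>) * real n ^ (k - 1) \<le> real (tc n - tc (n - 1))"
    using tc_increment[OF \<delta>] by blast
  define m where "m = n1 + n2"
  \<comment> \<open>The surplus starts at \<open>2 ^ m\<close>, the number of subsets of
    \<open>m\<close> vertices, and drops with each added vertex. Subtraction is truncated, so it is
    \<open>0\<close> from \<open>n = m + 2 ^ m\<close> on.\<close>
  have main: "card E \<le> tc n + (2 ^ m - (n - m))" if "m \<le> n" "free_system V E" "card V = n"
    for n and V :: "'b set" and E
    using that
  proof (induction n arbitrary: V E rule: dec_induct)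
    case base
    note H = free_systemD[OF base(1)]
    have "card E \<le> card (Pow V)" using H(1,4) by (intro card_mono) auto
    then show ?case using base(2) H(1) by (simp add: card_Pow)
  next
    case (step n)
    note fs = step.prems(1) and cV = step.prems(2)
    note H = free_systemD[OF fs]
    have inc: "tc n \<le> tc (Suc n)" "(c0 - \<delta>) * real (Suc n) ^ (k - 1) \<le> real (tc (Suc n) - tc n)"
      using n2[of "Suc n"] step.hyps by (auto simp: m_def)
    show ?case
    proof (cases "\<forall>v\<in>V. tc (Suc n) - tc n \<le> card {e \<in> E. v \<in> e}")
      case True
      have "min_degree_cond \<delta> V E"
        unfolding min_degree_cond_def cV of_nat_power
      proof
        fix v assume "v \<in> V"
        then have "real (tc (Suc n) - tc n) \<le> card {e \<in> E. v \<in> e}" using True by simp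
        then show "(c0 - \<delta>) * real (Suc n) ^ (k - 1) \<le> card {e \<in> E. v \<in> e}" using inc(2) by linarith
      qed
      from n1[OF fs this] show ?thesis using cV step.hyps by (simp add: m_def)
    next
      case False
      then obtain v where v: "v \<in> V" "card {e \<in> E. v \<in> e} < tc (Suc n) - tc n" by auto
      have "card (V - {v}) = n" using v cV H(1) by simp
      with step.IH[OF free_system_delete[OF fs]]
      have "card {e \<in> E. v \<notin> e} \<le> tc n + (2 ^ m - (n - m))" by blast
      moreover have "E = {e \<in> E. v \<in> e} \<union> {e \<in> E. v \<notin> e}" by blast
      then have "card E \<le> card {e \<in> E. v \<in> e} + card {e \<in> E. v \<notin> e}" by (metis card_Un_le)
      ultimately show ?thesis using v(2) inc(1) step.hyps by linarith
    qed
  qed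
  show ?thesis
  proof (intro exI[of _ "m + 2 ^ m"] allI impI)
    fix V :: "'b set" and E
    assume "free_system V E" "m + 2 ^ m \<le> card V"
    then show "card E \<le> tc (card V)" using main[of "card V" V E] by simp
  qed
qed

text \<open>The bound freed from the constants of the locale, for use outside it.\<close>

lemma upper_bound_turan_clique_count:
  "\<exists>n0. \<forall>(V :: 'b set) E. finite V \<longrightarrow> E \<subseteq> Pow V \<longrightarrow> (\<forall>e\<in>E. card e = k) \<longrightarrow> Berge_free F (V, E) \<longrightarrow>
    n0 \<le> card V \<longrightarrow> card E \<le> turan_clique_count (s - 1) (card V - (s - 1)) r k"
  using upper_bound[where 'b = 'b] unfolding free_system_def tc_def imp_conjL .

end

section \<open>The extremal construction\<close>

text \<open>On a component whose image avoids \<open>A\<close>, \<open>col\<close> composed with the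
  embedding is a proper coloring with \<open>r\<close> colors. Components are disjoint, so the
  vertices of \<open>A\<close> found for different components are distinct.\<close>

lemma apex_transversals_Berge_free:
  assumes F: "graph F" and card: "card {C \<in> components F. chromatic_number C = r + 1} = s"
    and A: "finite A" "card A < s" and col: "\<And>v. v \<in> V - A \<Longrightarrow> col v < r"
  shows "Berge_free F (V, apex_transversals k V A col)"
  unfolding Berge_free_def
proof (rule notI, elim exE conjE)
  fix H' :: "'b hypergraph" and G :: "'b hypergraph"
  assume sub: "subhypergraph H' (V, apex_transversals k V A col)" and iso: "isomorphic F G" and B: "is_Berge H' G"
  let ?T = "{C \<in> components F. chromatic_number C = r + 1}"
  obtain f where f: "bij_betw f (verts F) (verts G)" "hedges G = (\<lambda>e. f ` e) ` hedges F"
    using iso by (auto simp: isomorphic_def)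
  obtain \<phi> where \<phi>: "bij_betw \<phi> (hedges H') (hedges G)" "\<forall>e\<in>hedges H'. \<phi> e \<subseteq> e"
    and GH: "verts G \<subseteq> verts H'" using B by (auto simp: is_Berge_def)
  have fV: "f u \<in> V" if "u \<in> verts F" for u
    using that f(1) GH sub by (auto simp: bij_betw_def subhypergraph_def)
  have edge: "f u \<in> A \<or> f v \<in> A \<or> col (f u) \<noteq> col (f v)" if e: "{u, v} \<in> hedges F" for u v
  proof -
    have "f ` {u, v} \<in> hedges G" unfolding f(2) using e by (rule imageI)
    also have "hedges G = \<phi> ` hedges H'" using \<phi>(1) by (simp add: bij_betw_def)
    finally have "f ` {u, v} \<in> \<phi> ` hedges H'" .
    then obtain h where h: "h \<in> hedges H'" "f ` {u, v} = \<phi> h" by blast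
    then have "f ` {u, v} \<subseteq> h" using \<phi>(2) by simp
    then have fh: "f u \<in> h" "f v \<in> h" by auto
    have inj: "inj_on col (h - A)" using h sub by (auto simp: subhypergraph_def apex_transversals_def)
    have "f u \<noteq> f v" using graph_edge[OF F e] f(1) by (auto simp: bij_betw_def dest: inj_onD)
    then show ?thesis using inj_onD[OF inj, of "f u" "f v"] fh by blast
  qed
  have "\<exists>u\<in>verts C. f u \<in> A" if C: "C \<in> ?T" for C
  proof (rule ccontr)
    assume no: "\<not> ?thesis"
    obtain v where v: "C = induced_subgraph F (reach F v)" using C by (auto simp: components_reach)
    have CF: "verts C \<subseteq> verts F" "hedges C \<subseteq> hedges F"
      using reach_sub[of F v] by (auto simp: v induced_subgraph_def)
    have gC: "graph C" unfolding v by (rule graph_induced[OF F reach_sub])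
    have "proper_coloring C r (\<lambda>u. col (f u))"
      unfolding proper_coloring_def
    proof (intro conjI allI impI)
      show "(\<lambda>u. col (f u)) ` verts C \<subseteq> {..<r}" using no CF fV col by blast
      fix u v assume e: "{u, v} \<in> hedges C"
      have "u \<in> verts C" "v \<in> verts C" using graph_edge[OF gC e] by auto
      then show "col (f u) \<noteq> col (f v)" using edge[of u v] e CF no by blast
    qed
    then have "chromatic_number C \<le> r" by (rule chromatic_number_le)
    then show False using C by simp
  qed
  then have "\<forall>C\<in>?T. \<exists>u. u \<in> verts C \<and> f u \<in> A" by blast
  from bchoice[OF this] obtain w where w: "\<forall>C\<in>?T. w C \<in> verts C \<and> f (w C) \<in> A" ..
  have comp: "C = induced_subgraph F (reach F u)" "u \<in> verts F" if Cu: "C \<in> ?T" "u \<in> verts C" for C u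
  proof -
    obtain v where v: "C = induced_subgraph F (reach F v)" using Cu by (auto simp: components_reach)
    then have u: "u \<in> reach F v" using Cu by (simp add: induced_subgraph_def)
    show "C = induced_subgraph F (reach F u)" using v reach_eq[OF u] by simp
    show "u \<in> verts F" using u reach_sub[of F v] by blast
  qed
  have "inj_on (\<lambda>C. f (w C)) ?T"
  proof (rule inj_onI)
    fix C C' assume C: "C \<in> ?T" "C' \<in> ?T" "f (w C) = f (w C')"
    have wC: "w C \<in> verts C" "w C' \<in> verts C'" using w C(1,2) by blast+
    then have "w C = w C'" using C(3) comp(2)[OF C(1)] comp(2)[OF C(2)] f(1) by (auto simp: bij_betw_def dest: inj_onD)
    then show "C = C'" using comp(1)[OF C(1) wC(1)] comp(1)[OF C(2) wC(2)] by simp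
  qed
  then have "card ?T \<le> card A"
    using w A(1) by (intro card_inj_on_le[of "\<lambda>C. f (w C)"]) auto
  then show False using card A(2) by simp
qed

section \<open>Copies of the complete graph in the join\<close>

text \<open>A copy is determined by its vertex set, on which it has all pairs as edges; in a graph
  whose adjacency is inequality of \<open>c\<close>, the possible vertex sets are the
  transversals.\<close>

lemma num_copies_complete_graph:
  assumes "finite (verts J)" and adj: "\<And>x y. x \<in> verts J \<Longrightarrow> y \<in> verts J \<Longrightarrow> x \<noteq> y \<Longrightarrow> {x, y} \<in> hedges J \<longleftrightarrow> c x \<noteq> c y"
  shows "num_copies (complete_graph k) J = card (transversals k (verts J) c)"
proof -
  let ?pairs = "\<lambda>W. {e. e \<subseteq> W \<and> card e = 2}"
  let ?S = "{S. subhypergraph S J \<and> isomorphic (complete_graph k) S}"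
  have pairs_img: "(\<lambda>e. f ` e) ` ?pairs X = ?pairs W" if f: "bij_betw f X W" for f :: "nat \<Rightarrow> 'a" and X W
  proof (intro equalityI subsetI)
    fix e assume "e \<in> (\<lambda>e. f ` e) ` ?pairs X"
    then obtain d where d: "d \<subseteq> X" "card d = 2" "e = f ` d" by blast
    have "inj_on f d" using f d(1) by (auto simp: bij_betw_def intro: inj_on_subset)
    then show "e \<in> ?pairs W" using d f by (auto simp: card_image bij_betw_def)
  next
    fix e assume e: "e \<in> ?pairs W"
    let ?d = "inv_into X f ` e"
    have "f ` ?d = e" using e f by (auto simp: bij_betw_def image_image f_inv_into_f subset_iff image_iff)
    moreover have "?d \<subseteq> X" using e f by (auto simp: bij_betw_def intro: inv_into_into)
    moreover have "card ?d = 2"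
    proof -
      have "inj_on (inv_into X f) e" using e f by (intro inj_on_inv_into) (auto simp: bij_betw_def)
      then show ?thesis using e by (simp add: card_image)
    qed
    ultimately show "e \<in> (\<lambda>e. f ` e) ` ?pairs X" by (intro image_eqI[of _ _ ?d]) auto
  qed
  have eq: "?S = (\<lambda>W. (W, ?pairs W)) ` transversals k (verts J) c"
  proof (intro equalityI subsetI)
    fix S assume S: "S \<in> ?S"
    then obtain f where f: "bij_betw f {..<k} (verts S)" "hedges S = (\<lambda>e. f ` e) ` ?pairs {..<k}"
      by (auto simp: isomorphic_def complete_graph_def)
    have SJ: "verts S \<subseteq> verts J" "hedges S \<subseteq> hedges J" using S by (auto simp: subhypergraph_def)
    have h: "hedges S = ?pairs (verts S)" using f(2) pairs_img[OF f(1)] by simp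
    have "card (verts S) = k" using bij_betw_same_card[OF f(1)] by simp
    moreover have "inj_on c (verts S)"
    proof (rule inj_onI, rule ccontr)
      fix x y assume xy: "x \<in> verts S" "y \<in> verts S" "c x = c y" "x \<noteq> y"
      then have "{x, y} \<in> hedges J" using h SJ(2) by auto
      then show False using adj[of x y] xy SJ(1) by blast
    qed
    ultimately have "verts S \<in> transversals k (verts J) c" using SJ by (simp add: transversals_def)
    moreover have "S = (verts S, ?pairs (verts S))" using h by (simp add: prod_eq_iff)
    ultimately show "S \<in> (\<lambda>W. (W, ?pairs W)) ` transversals k (verts J) c" by blast
  next
    fix S assume "S \<in> (\<lambda>W. (W, ?pairs W)) ` transversals k (verts J) c"
    then obtain W where W: "W \<subseteq> verts J" "card W = k" "inj_on c W" "S = (W, ?pairs W)"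
      by (auto simp: transversals_def)
    have finW: "finite W" using W(1) assms(1) by (rule finite_subset)
    obtain f where f: "bij_betw f {..<k} W"
      using ex_bij_betw_nat_finite[OF finW] W(2) by (auto simp: atLeast0LessThan)
    have "?pairs W \<subseteq> hedges J"
    proof
      fix e assume "e \<in> ?pairs W"
      then obtain x y where "e = {x, y}" "x \<noteq> y" "x \<in> W" "y \<in> W" by (auto simp: card_2_iff)
      then show "e \<in> hedges J" using adj[of x y] W by (auto dest: inj_onD)
    qed
    then have "subhypergraph S J" using W finW by (auto simp: subhypergraph_def hypergraph_def)
    moreover have "isomorphic (complete_graph k) S"
      unfolding isomorphic_def complete_graph_def using f pairs_img[OF f] W(4) by (intro exI[of _ f]) simp
    ultimately show "S \<in> ?S" by simp
  qed
  have "inj_on (\<lambda>W. (W, ?pairs W)) (transversals k (verts J) c)" by (rule inj_onI) simp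
  then show ?thesis unfolding num_copies_def eq by (simp add: card_image)
qed

text \<open>The join is itself complete multipartite: \<open>?c\<close> keeps each universal vertex
  as a class of its own and reduces the others modulo \<open>r\<close>.\<close>

lemma num_copies_complete_join_turan:
  assumes r: "r > 0"
  shows "num_copies (complete_graph k) (graph_join (complete_graph a) (turan_graph m r)) = turan_clique_count a m r k"
proof -
  let ?J = "graph_join (complete_graph a) (turan_graph m r)"
  let ?c = "map_sum id (\<lambda>v. v mod r) :: nat + nat \<Rightarrow> nat + nat"
  let ?I = "Inl ` {..<a} \<union> Inr ` {..<r} :: (nat + nat) set"
  have V: "verts ?J = Inl ` {..<a} \<union> Inr ` {..<m}"
    by (auto simp: graph_join_def complete_graph_def turan_graph_def)
  have "{x, y} \<in> hedges ?J \<longleftrightarrow> ?c x \<noteq> ?c y" if xy: "x \<in> verts ?J" "y \<in> verts ?J" "x \<noteq> y" for x y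
  proof -
    have ll: "{Inl u, Inl v} \<in> (\<lambda>e. Inl ` e) ` X \<longleftrightarrow> {u, v} \<in> X" for u v :: nat and X
      by (metis (no_types, lifting) image_empty image_iff image_insert inj_Inl inj_image_eq_iff)
    have rr: "{Inr u, Inr v} \<in> (\<lambda>e. Inr ` e) ` X \<longleftrightarrow> {u, v} \<in> X" for u v :: nat and X
      by (metis (no_types, lifting) image_empty image_iff image_insert inj_Inr inj_image_eq_iff)
    have lr: "{Inl u, Inr v} \<in> {{Inl u, Inr v} | u v. u < a \<and> v < m}" if "u < a" "v < m" for u v :: nat
      using that by blast
    have hJ: "hedges ?J = (\<lambda>e. Inl ` e) ` {e. e \<subseteq> {..<a} \<and> card e = 2} \<union>
        (\<lambda>e. Inr ` e) ` {{u, v} | u v. u < m \<and> v < m \<and> u mod r \<noteq> v mod r} \<union>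
        {{Inl u, Inr v} | u v. u < a \<and> v < m}"
      by (auto simp: graph_join_def complete_graph_def turan_graph_def)
    consider (1) u v where "x = Inl u" "y = Inl v" "u < a" "v < a" | (2) u v where "x = Inl u" "y = Inr v" "u < a" "v < m"
      | (3) u v where "x = Inr u" "y = Inl v" "u < m" "v < a" | (4) u v where "x = Inr u" "y = Inr v" "u < m" "v < m"
      using xy unfolding V by blast
    then show ?thesis
    proof cases
      case (1 u v)
      then have "{x, y} \<in> hedges ?J" using xy(3) unfolding hJ 1(1,2) Un_iff ll by (simp add: card_2_iff')
      then show ?thesis using 1 xy(3) by simp
    next
      case (2 u v)
      then have "{x, y} \<in> hedges ?J" using lr[of u v] unfolding hJ by simp
      then show ?thesis using 2 by simp
    next
      case (3 u v)
      then have "{x, y} \<in> hedges ?J" using lr[of v u] unfolding hJ by (simp add: insert_commute)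
      then show ?thesis using 3 by simp
    next
      case (4 u v)
      have "{x, y} \<in> hedges ?J \<longleftrightarrow> {u, v} \<in> {{u, v} | u v. u < m \<and> v < m \<and> u mod r \<noteq> v mod r}"
        unfolding hJ 4(1,2) Un_iff rr by (auto simp: doubleton_eq_iff)
      also have "\<dots> \<longleftrightarrow> u mod r \<noteq> v mod r" using 4(3,4) by (auto simp: doubleton_eq_iff)
      finally show ?thesis using 4 by simp
    qed
  qed
  then have "num_copies (complete_graph k) ?J = card (transversals k (verts ?J) ?c)"
    by (intro num_copies_complete_graph) (simp_all add: V)
  also have "\<dots> = esym k ?I (\<lambda>i. card {w \<in> verts ?J. ?c w = i})"
    by (rule card_transversals) (use r in \<open>auto simp: V\<close>)
  also have "\<dots> = turan_clique_count a m r k"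
    unfolding turan_clique_count_def
  proof (rule esym_cong)
    fix i assume "i \<in> ?I"
    then consider x where "i = Inl x" "x < a" | j where "i = Inr j" by blast
    then show "card {w \<in> verts ?J. ?c w = i} = case_sum (\<lambda>_. 1) (residue_count m r) i"
    proof cases
      case (1 x)
      then have "{w \<in> verts ?J. ?c w = i} = {Inl x}" by (auto simp: V)
      then show ?thesis using 1 by simp
    next
      case (2 j)
      then have "{w \<in> verts ?J. ?c w = i} = Inr ` {v. v < m \<and> v mod r = j}" by (auto simp: V)
      then show ?thesis using 2 by (simp add: card_image residue_count_def)
    qed
  qed
  finally show ?thesis .
qed

text \<open>The extremal pattern realised on natural numbers, over which \<open>ex_Berge\<close>
  ranges: the first \<open>a\<close> numbers are universal, the others are classed by
  residues.\<close>

lemma card_residue_transversals: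
  assumes r: "r > 0" and "a \<le> n"
  shows "card (apex_transversals k {..<n} {..<a} (\<lambda>v. (v - a) mod r)) = turan_clique_count a (n - a) r k"
proof -
  have "card {v \<in> {..<n} - {..<a}. (v - a) mod r = j} = residue_count (n - a) r j" for j
    unfolding residue_count_def
    by (rule bij_betw_same_card[of "\<lambda>v. v - a"], rule bij_betw_byWitness[where f' = "\<lambda>v. v + a"]) (use assms in auto)
  then have "case_sum (\<lambda>_. 1) (\<lambda>j. card {v \<in> {..<n} - {..<a}. (v - a) mod r = j}) =
      case_sum (\<lambda>_::nat. 1) (residue_count (n - a) r)" by simp
  then show ?thesis
    using assms card_apex_transversals[of "{..<n}" "{..<a}" "\<lambda>v. (v - a) mod r" r k]
    by (simp add: turan_clique_count_def)
qed

theorem theorem1p6: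
  fixes r k s :: nat and F :: "'a hypergraph"
  assumes "k \<ge> 3" and "r \<ge> k" and "s \<ge> 1"
    and "graph F"
    and "card {C \<in> components F. chromatic_number C = r + 1} = s"
    and "\<And>C. C \<in> components F \<Longrightarrow> chromatic_number C = r + 1 \<Longrightarrow> \<exists>e. color_critical_edge C e"
    and "\<And>C. C \<in> components F \<Longrightarrow> chromatic_number C \<noteq> r + 1 \<Longrightarrow> chromatic_number C \<le> r"
  shows "\<exists>n0. \<forall>n>n0. ex_Berge k n F =
    num_copies (complete_graph k) (graph_join (complete_graph (s - 1)) (turan_graph (n - s + 1) r))"
proof -
  obtain a b gr where "critical_graph F r s a b gr"
    using critical_graph_exists[OF assms(4,3,5,6,7)] .
  then have "berge_problem F r s a b gr k"
    using assms(1-3) by (intro berge_problem.intro berge_problem_axioms.intro)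
  from berge_problem.upper_bound_turan_clique_count[OF this, where 'b = nat]
  obtain n0 where n0: "\<forall>(V :: nat set) E. finite V \<longrightarrow> E \<subseteq> Pow V \<longrightarrow> (\<forall>e\<in>E. card e = k) \<longrightarrow> Berge_free F (V, E) \<longrightarrow>
    n0 \<le> card V \<longrightarrow> card E \<le> turan_clique_count (s - 1) (card V - (s - 1)) r k" ..
  have r_pos: "r > 0" using assms(1,2) by simp
  show ?thesis
  proof (intro exI[of _ "max n0 s"] allI impI)
    \<comment> \<open>Beyond \<open>s\<close>, the \<open>s - 1\<close> universal vertices fit into
      \<open>{..<n}\<close> and the truncated \<open>n - s + 1\<close> agrees with
      \<open>n - (s - 1)\<close>.\<close>
    fix n assume n: "n > max n0 s"
    let ?tc = "turan_clique_count (s - 1) (n - (s - 1)) r k"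
    let ?X = "{card (hedges H) | H :: nat hypergraph.
      hypergraph H \<and> card (verts H) = n \<and> uniform k H \<and> Berge_free F H}"
    have up: "x \<le> ?tc" if x: "x \<in> ?X" for x
    proof -
      obtain H :: "nat hypergraph" where H: "x = card (hedges H)" "hypergraph H" "card (verts H) = n"
        "uniform k H" "Berge_free F H" using x by blast
      have "finite (verts H)" "hedges H \<subseteq> Pow (verts H)" "\<forall>e\<in>hedges H. card e = k" "Berge_free F (verts H, hedges H)"
        using H by (auto simp: hypergraph_def uniform_def)
      with n0 n H(3) show ?thesis unfolding H(1) by (metis less_imp_le_nat max_less_iff_conj)
    qed
    let ?col = "\<lambda>v. (v - (s - 1)) mod r"
    let ?E = "apex_transversals k {..<n} {..<s - 1} ?col"
    have "Berge_free F ({..<n}, ?E)"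
      by (rule apex_transversals_Berge_free[OF assms(4,5)]) (use assms(3) r_pos in auto)
    then have "card ?E \<in> ?X"
      by (intro CollectI exI[of _ "({..<n}, ?E)"]) (auto simp: hypergraph_def uniform_def apex_transversals_def)
    moreover have "card ?E = ?tc"
    proof -
      have "s - 1 \<le> n" using n by linarith
      from card_residue_transversals[OF r_pos this, of k] show ?thesis .
    qed
    ultimately have mem: "?tc \<in> ?X" by simp
    have "finite ?X" using up by (intro finite_subset[of ?X "{..?tc}"]) auto
    then have "ex_Berge k n F = ?tc"
      unfolding ex_Berge_def using up mem by (intro Max_eqI) auto
    moreover have "n - s + 1 = n - (s - 1)" using n assms(3) by linarith
    ultimately show "ex_Berge k n F =
        num_copies (complete_graph k) (graph_join (complete_graph (s - 1)) (turan_graph (n - s + 1) r))"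
      by (simp only: num_copies_complete_join_turan[OF r_pos])
  qed
qed

end
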